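(* For $\epsilon\in(0,\epsilon_*]$ let $y^\epsilon$ solve $$dy^\epsilon_t=b_\epsilon(y^\epsilon_t)\,dt+\tfrac{1}{\sqrt{r(\epsilon)}}\,\sigma_\epsilon\,dB^\epsilon_t,\qquad y^\epsilon_0=x,$$ where $\sigma_\epsilon(x)\equiv\sigma_\epsilon$ is a family of constant $d\times k$ matrices, $r(\epsilon)=\log\log\epsilon^{-1}$, and $B^\epsilon_t:=\frac{1}{\sqrt\epsilon}B_{\epsilon t}$ with $B$ a standard $k$-dimensional Brownian motion. If $\epsilon_*$, $U^*$, $b_\epsilon$, $\sigma_\epsilon$ satisfy Assumption 1 (see context), and for every $\delta\in(0,\epsilon_*]$ we have $\sigma_\epsilon\to\sigma_\delta$ and $b_\epsilon\to b_\delta$ as $\epsilon\to\delta$ uniformly on compact subsets of $U^*$, then $\{y^\epsilon\}_{\epsilon\in(0,\epsilon_*]}$ satisfies Assumption 2 (see context).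
   Context: **Path spaces.** For open $V\subset\mathbf{R}^m$ and $t\in(0,1]$, let $V\cup\{\Delta\}$ be the one-point compactification ($\Delta\notin V$). $\mathcal{E}([0,t];V)$: continuous $g:[0,t]\to V\cup\{\Delta\}$ that stay at $\Delta$ once they reach it; $\mathcal{E}_x$: those with $g_0=x$; $\tau_t(g)=\inf\{s\in[0,t]:g_s=\Delta\}$, $\inf\emptyset=\infty$. Closed sets of $\mathcal{E}([0,t];V)$ are those closed under convergence of sequences, where $g_n\to g$ means: for every $s\le t$, $s<\tau_t(g)$, eventually $g_n$ is $V$-valued on $[0,s]$ and $g_n\to g$ uniformly on $[0,s]$. $d_s(g,h)=\sup_{u\in[0,s]}|g_u-h_u|$ if $s<\tau_t(g)\wedge\tau_t(h)$, and $=\infty$ otherwise. $\mathcal{C}^0([0,1];\mathbf{R}^k)$: continuous $f$ with $\dot f\in L^2([0,1])$. **Conventions.** The Brownian motion lives on $(\Omega,\mathcal{F},\mathbf{P})$; $M_{d\times k}$ is the set of real $d\times k$ matrices; "locally Lipschitz" means Lipschitz on every compact subset; $\epsilon_*$ is small enough that $r>0$ on $(0,\epsilon_*]$. As an element of $\mathcal{E}_x([0,t];U^* )$, $y^\epsilon$ is sent to $\Delta$ at its first exit time from $U^*$. **Assumption 1.** $\epsilon_*>0$, $U^*\subset\mathbf{R}^d$ is non-empty and open, and there are locally Lipschitz $b:U^*\to\mathbf{R}^d$, $\sigma:U^*\to M_{d\times k}$ such that: (i) for every $\epsilon\in(0,\epsilon_*]$ there is an open set $U_\epsilon\subset\mathbf{R}^d$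 with $U^*\subset U_\epsilon$ and $b_\epsilon:U_\epsilon\to\mathbf{R}^d$, $\sigma_\epsilon:U_\epsilon\to M_{d\times k}$ are locally Lipschitz; (ii) $b_\epsilon\to b$ and $\sigma_\epsilon\to\sigma$ uniformly on compact subsets of $U^*$ as $\epsilon\to0^+$. **$\mathcal{K}_x$ and $t_*$.** For $x\in U^*$, $S_x(f)\in\mathcal{E}([0,1];U^* )$ is the solution of $\dot g_t=b(g_t)+\sigma(g_t)\dot f_t$, $g_0=x$ (equal to $\Delta$ from its exit time from $U^*$ on); $\lambda(g)=\inf\{\frac12\int_0^1|\dot f_t|^2dt:f\in\mathcal{C}^0([0,1];\mathbf{R}^k),S_{g_0}(f)=g\}$, $\inf\emptyset=\infty$; $\mathcal{K}_x=\{g\in\mathcal{E}_x([0,1];U^* ):\lambda(g)\le1\}$. Let $L\subset U^*$ be compact with $x\in\mathrm{interior}(L)$, and $t_*=t_*(x)\in(0,1]$ such that $g([0,t_*])\subset\mathrm{interior}(L)$ for all $g\in\mathcal{K}_x$ (such $t_*$ exists). **Assumption 2** (for such $L,x,t_*$). (i) For every $\delta>0$ there is $c_0\in(0,1)$ such that for every $c\in(c_0,1)$ there is a $\mathbf{P}$-a.s. finite random variable $J=J(\omega,c)\in\mathbf{N}$ such that $j\ge J$ and $\epsilon\in[c^{j+1},c^j]$ imply $y^\epsilon_t\in L$ for all $t\in[0,t_*]$ and $d_{t_*}(y^{c^j},y^\epsilon)<\delta$. (ii) $\mathbf{P}$-almost surely, $\epsilon\mapsto y^\epsilon:(0,\epsilon_*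 )\to\mathcal{E}_x([0,t_*];U^* )$ is continuous. *)

theory Defs
  imports "HOL-Probability.Probability"
begin

section \<open>Path spaces with a cemetery point\<close>

text \<open>
  The one-point compactification of an open set \<open>V\<close> is the library's
  \<^const>\<open>Alexandroff_compactification\<close>; the point \<open>\<Delta>\<close> is \<^const>\<open>None\<close>.
  Paths on \<open>[0,t]\<close> are extensional, so that they are determined by their values on \<open>[0,t]\<close>.
\<close>

definition path_space :: "real \<Rightarrow> (real^'m) set \<Rightarrow> (real \<Rightarrow> (real^'m) option) set" where
  "path_space t V =
    {g \<in> extensional {0..t}.
       continuous_map (top_of_set {0..t}) (Alexandroff_compactification (top_of_set V)) g \<and>
       (\<forall>s\<in>{0..t}. \<forall>u\<in>{s..t}. g s = None \<longrightarrow> g u = None)}"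

definition path_space_from :: "real \<Rightarrow> (real^'m) set \<Rightarrow> real^'m \<Rightarrow> (real \<Rightarrow> (real^'m) option) set" where
  "path_space_from t V x = {g \<in> path_space t V. g 0 = Some x}"

definition exit_time :: "real \<Rightarrow> (real \<Rightarrow> (real^'m) option) \<Rightarrow> ereal" where
  "exit_time t g = Inf (ereal ` {s \<in> {0..t}. g s = None})"

definition path_converges ::
    "real \<Rightarrow> (nat \<Rightarrow> real \<Rightarrow> (real^'m) option) \<Rightarrow> (real \<Rightarrow> (real^'m) option) \<Rightarrow> bool" where
  "path_converges t gs g \<longleftrightarrow>
    (\<forall>s\<in>{0..t}. ereal s < exit_time t g \<longrightarrow>
       (\<forall>\<^sub>F n in sequentially. \<forall>u\<in>{0..s}. gs n u \<noteq> None) \<and>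
       uniform_limit {0..s} (\<lambda>n u. the (gs n u)) (\<lambda>u. the (g u)) sequentially)"

definition path_closed :: "real \<Rightarrow> (real^'m) set \<Rightarrow> (real \<Rightarrow> (real^'m) option) set \<Rightarrow> bool" where
  "path_closed t V C \<longleftrightarrow> C \<subseteq> path_space t V \<and>
    (\<forall>gs g. (\<forall>n. gs n \<in> C) \<and> g \<in> path_space t V \<and> path_converges t gs g \<longrightarrow> g \<in> C)"

definition path_topology :: "real \<Rightarrow> (real^'m) set \<Rightarrow> (real \<Rightarrow> (real^'m) option) topology" where
  "path_topology t V =
    topology (\<lambda>W. W \<subseteq> path_space t V \<and> path_closed t V (path_space t V - W))"

lemma path_converges_subseq:
  assumes "path_converges t gs g" "strict_mono r"
  shows "path_converges t (gs \<circ> r) g"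
  unfolding path_converges_def
proof (intro ballI impI conjI)
  fix s assume "s \<in> {0..t}" "ereal s < exit_time t g"
  with assms(1) have 1: "\<forall>\<^sub>F n in sequentially. \<forall>u\<in>{0..s}. gs n u \<noteq> None"
    and 2: "uniform_limit {0..s} (\<lambda>n u. the (gs n u)) (\<lambda>u. the (g u)) sequentially"
    unfolding path_converges_def by blast+
  note r = filterlim_subseq[OF assms(2)]
  show "\<forall>\<^sub>F n in sequentially. \<forall>u\<in>{0..s}. (gs \<circ> r) n u \<noteq> None"
    using eventually_compose_filterlim[OF 1 r] by simp
  show "uniform_limit {0..s} (\<lambda>n u. the ((gs \<circ> r) n u)) (\<lambda>u. the (g u)) sequentially"
    using filterlim_compose[OF 2 r] by simp
qed

lemma path_closed_Un:
  assumes "path_closed t V C" "path_closed t V D"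
  shows "path_closed t V (C \<union> D)"
  unfolding path_closed_def
proof (intro conjI allI impI)
  show "C \<union> D \<subseteq> path_space t V"
    using assms by (auto simp: path_closed_def)
  fix gs g
  assume *: "(\<forall>n. gs n \<in> C \<union> D) \<and> g \<in> path_space t V \<and> path_converges t gs g"
  have in_limit: "g \<in> A" if A: "path_closed t V A" "infinite {n. gs n \<in> A}" for A
  proof -
    obtain r :: "nat \<Rightarrow> nat" where r: "strict_mono r" "\<And>n. r n \<in> {n. gs n \<in> A}"
      using infinite_enumerate[OF A(2)] by blast
    have "\<forall>n. (gs \<circ> r) n \<in> A"
      using r(2) by simp
    moreover have "path_converges t (gs \<circ> r) g"
      using * path_converges_subseq r(1) by blast
    ultimately show ?thesis
      using A(1) * unfolding path_closed_def by blast
  qed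
  have "{n. gs n \<in> C} \<union> {n. gs n \<in> D} = UNIV"
    using * by auto
  then have "infinite {n. gs n \<in> C} \<or> infinite {n. gs n \<in> D}"
    by (metis finite_Un infinite_UNIV_nat)
  then show "g \<in> C \<union> D"
    using in_limit assms by blast
qed

lemma istopology_path_space:
  "istopology (\<lambda>W. W \<subseteq> path_space t V \<and> path_closed t V (path_space t V - W))"
  unfolding istopology_def
proof (intro conjI allI impI)
  fix S T
  assume "S \<subseteq> path_space t V \<and> path_closed t V (path_space t V - S)"
    and "T \<subseteq> path_space t V \<and> path_closed t V (path_space t V - T)"
  then show "S \<inter> T \<subseteq> path_space t V" "path_closed t V (path_space t V - S \<inter> T)"
    using path_closed_Un[of t V "path_space t V - S" "path_space t V - T"]
    by (auto simp: Diff_Int)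
next
  fix \<W>
  assume *: "\<forall>W\<in>\<W>. W \<subseteq> path_space t V \<and> path_closed t V (path_space t V - W)"
  then show "\<Union>\<W> \<subseteq> path_space t V" by blast
  show "path_closed t V (path_space t V - \<Union>\<W>)"
    unfolding path_closed_def
  proof (intro conjI allI impI)
    fix gs g
    assume **: "(\<forall>n. gs n \<in> path_space t V - \<Union>\<W>) \<and> g \<in> path_space t V \<and> path_converges t gs g"
    have "g \<notin> W" if "W \<in> \<W>" for W
    proof -
      have "\<forall>n. gs n \<in> path_space t V - W"
        using ** that by blast
      moreover have "path_closed t V (path_space t V - W)"
        using * that by blast
      ultimately show ?thesis
        using ** unfolding path_closed_def by blast
    qed
    then show "g \<in> path_space t V - \<Union>\<W>"
      using ** by blast
  qed blast
qed

lemma openin_path_topology: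
  "openin (path_topology t V) W \<longleftrightarrow> W \<subseteq> path_space t V \<and> path_closed t V (path_space t V - W)"
  unfolding path_topology_def by (subst topology_inverse'[OF istopology_path_space]) (rule refl)

lemma topspace_path_topology: "topspace (path_topology t V) = path_space t V"
proof -
  have "openin (path_topology t V) (path_space t V)"
    by (simp add: openin_path_topology path_closed_def)
  moreover have "topspace (path_topology t V) \<subseteq> path_space t V"
    using openin_topspace[of "path_topology t V"] unfolding openin_path_topology by blast
  ultimately show ?thesis
    using openin_subset by blast
qed

lemma closedin_path_topology: "closedin (path_topology t V) C \<longleftrightarrow> path_closed t V C"
proof -
  have "path_space t V - (path_space t V - C) = C" if "C \<subseteq> path_space t V"
    using that by blast
  then show ?thesis
    unfolding closedin_def topspace_path_topology openin_path_topology
    by (metis Diff_subset path_closed_def)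
qed

definition path_dist ::
    "real \<Rightarrow> real \<Rightarrow> (real \<Rightarrow> (real^'m) option) \<Rightarrow> (real \<Rightarrow> (real^'m) option) \<Rightarrow> ereal" where
  "path_dist t s g h =
    (if ereal s < min (exit_time t g) (exit_time t h)
     then SUP u\<in>{0..s}. ereal (norm (the (g u) - the (h u))) else \<infinity>)"

text \<open>A path regarded on \<open>[0,t]\<close> and sent to \<open>\<Delta>\<close> at its first exit time from \<open>V\<close>.\<close>

definition killed_path ::
    "real \<Rightarrow> (real^'m) set \<Rightarrow> (real \<Rightarrow> (real^'m) option) \<Rightarrow> real \<Rightarrow> (real^'m) option" where
  "killed_path t V g =
    (\<lambda>s\<in>{0..t}. if \<forall>u\<in>{0..s}. g u \<in> Some ` V then g s else None)"


section \<open>Brownian motion and the equations\<close>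

definition standard_brownian_motion :: "'w measure \<Rightarrow> (real \<Rightarrow> 'w \<Rightarrow> real^'k) \<Rightarrow> bool" where
  "standard_brownian_motion M B \<longleftrightarrow>
    prob_space M \<and>
    (\<forall>t\<ge>0. B t \<in> borel_measurable M) \<and>
    (AE \<omega> in M. B 0 \<omega> = 0) \<and>
    (\<forall>s t. 0 \<le> s \<and> s < t \<longrightarrow>
       distributed M lborel (\<lambda>\<omega>. B t \<omega> - B s \<omega>)
         (\<lambda>z. ennreal (\<Prod>i\<in>UNIV. normal_density 0 (sqrt (t - s)) (z $ i)))) \<and>
    (\<forall>(n::nat) (\<tau>::nat \<Rightarrow> real). 0 \<le> \<tau> 0 \<and> strict_mono_on {..n} \<tau> \<longrightarrow>
       prob_space.indep_vars M (\<lambda>_. borel) (\<lambda>i \<omega>. B (\<tau> (Suc i)) \<omega> - B (\<tau> i) \<omega>) {..<n}) \<and>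
    (AE \<omega> in M. continuous_on {0..} (\<lambda>t. B t \<omega>))"

definition rescaled :: "(real \<Rightarrow> 'w \<Rightarrow> real^'k) \<Rightarrow> real \<Rightarrow> real \<Rightarrow> 'w \<Rightarrow> real^'k" where
  "rescaled B \<epsilon> t \<omega> = (1 / sqrt \<epsilon>) *\<^sub>R B (\<epsilon> * t) \<omega>"

definition loglog :: "real \<Rightarrow> real" where
  "loglog \<epsilon> = ln (ln (1 / \<epsilon>))"

text \<open>
  \<open>additive_solution V \<beta> W x g\<close>: on \<open>[0,1]\<close>, \<open>g\<close> is the maximal solution in \<open>V\<close> of
  \<open>dg\<^sub>t = \<beta>(g\<^sub>t) dt + dW\<^sub>t\<close>, \<open>g\<^sub>0 = x\<close>.  The stochastic integral of a constant matrix against \<open>B\<close> is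
  the matrix times \<open>B\<close>, so for additive noise the stochastic equation is this integral equation,
  read path by path.  Maximality is part of membership in the path space: before \<open>g\<close> is at
  \<open>\<Delta>\<close> it must have left every compact subset of \<open>V\<close>.
\<close>

definition additive_solution ::
    "(real^'d) set \<Rightarrow> (real^'d \<Rightarrow> real^'d) \<Rightarrow> (real \<Rightarrow> real^'d) \<Rightarrow> real^'d
      \<Rightarrow> (real \<Rightarrow> (real^'d) option) \<Rightarrow> bool" where
  "additive_solution V \<beta> W x g \<longleftrightarrow>
    g \<in> path_space_from 1 V x \<and>
    (\<forall>t\<in>{0..1}. ereal t < exit_time 1 g \<longrightarrow>
       the (g t) = x + (LINT s:{0..t}|lborel. \<beta> (the (g s))) + W t)"


section \<open>Assumptions on the coefficients\<close>

text \<open>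
  Lipschitz on compact subsets; the library's \<^const>\<open>local_lipschitz\<close> is the variant with
  neighbourhoods.
\<close>

definition locally_lipschitz_on :: "'a::metric_space set \<Rightarrow> ('a \<Rightarrow> 'b::metric_space) \<Rightarrow> bool" where
  "locally_lipschitz_on U f \<longleftrightarrow> (\<forall>K. compact K \<and> K \<subseteq> U \<longrightarrow> (\<exists>C. C-lipschitz_on K f))"

definition coefficient_assumption ::
    "real \<Rightarrow> (real^'d) set \<Rightarrow> (real^'d \<Rightarrow> real^'d) \<Rightarrow> (real^'d \<Rightarrow> real^'k^'d)
      \<Rightarrow> (real \<Rightarrow> (real^'d) set) \<Rightarrow> (real \<Rightarrow> real^'d \<Rightarrow> real^'d) \<Rightarrow> (real \<Rightarrow> real^'d \<Rightarrow> real^'k^'d) \<Rightarrow> bool" where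
  "coefficient_assumption eps_star U_star b \<sigma> U b\<^sub>\<epsilon> \<sigma>\<^sub>\<epsilon> \<longleftrightarrow>
    eps_star > 0 \<and> U_star \<noteq> {} \<and> open U_star \<and>
    locally_lipschitz_on U_star b \<and> locally_lipschitz_on U_star \<sigma> \<and>
    (\<forall>\<epsilon>\<in>{0<..eps_star}. open (U \<epsilon>) \<and> U_star \<subseteq> U \<epsilon> \<and>
       locally_lipschitz_on (U \<epsilon>) (b\<^sub>\<epsilon> \<epsilon>) \<and> locally_lipschitz_on (U \<epsilon>) (\<sigma>\<^sub>\<epsilon> \<epsilon>)) \<and>
    (\<forall>K. compact K \<and> K \<subseteq> U_star \<longrightarrow>
       uniform_limit K b\<^sub>\<epsilon> b (at_right 0) \<and> uniform_limit K \<sigma>\<^sub>\<epsilon> \<sigma> (at_right 0))"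


section \<open>The rate function and its unit sublevel set\<close>

text \<open>
  \<open>L2_derivative f f'\<close>: on \<open>[0,1]\<close>, \<open>f\<close> is continuous with weak derivative \<open>f' \<in> L\<^sup>2\<close>;
  \<open>f'\<close> is determined by \<open>f\<close> up to a null set.
\<close>

definition L2_derivative :: "(real \<Rightarrow> real^'k) \<Rightarrow> (real \<Rightarrow> real^'k) \<Rightarrow> bool" where
  "L2_derivative f f' \<longleftrightarrow>
    continuous_on {0..1} f \<and>
    set_borel_measurable lborel {0..1} f' \<and>
    set_integrable lborel {0..1} (\<lambda>s. (norm (f' s))\<^sup>2) \<and>
    (\<forall>t\<in>{0..1}. f t = f 0 + (LINT s:{0..t}|lborel. f' s))"

text \<open>
  \<open>skeleton_solution U b \<sigma> x f' g\<close>: \<open>g\<close> is the solution \<open>S\<^sub>x(f)\<close> of the controlled equation, for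
  a control \<open>f\<close> with derivative \<open>f'\<close>.
\<close>

definition skeleton_solution ::
    "(real^'d) set \<Rightarrow> (real^'d \<Rightarrow> real^'d) \<Rightarrow> (real^'d \<Rightarrow> real^'k^'d) \<Rightarrow> real^'d
      \<Rightarrow> (real \<Rightarrow> real^'k) \<Rightarrow> (real \<Rightarrow> (real^'d) option) \<Rightarrow> bool" where
  "skeleton_solution U b \<sigma> x f' g \<longleftrightarrow>
    g \<in> path_space_from 1 U x \<and>
    (\<forall>t\<in>{0..1}. ereal t < exit_time 1 g \<longrightarrow>
       the (g t) = x + (LINT s:{0..t}|lborel. b (the (g s)) + \<sigma> (the (g s)) *v f' s))"

definition rate ::
    "(real^'d) set \<Rightarrow> (real^'d \<Rightarrow> real^'d) \<Rightarrow> (real^'d \<Rightarrow> real^'k^'d)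
      \<Rightarrow> (real \<Rightarrow> (real^'d) option) \<Rightarrow> ereal" where
  "rate U b \<sigma> g =
    Inf {ereal (1 / 2 * (LINT t:{0..1}|lborel. (norm (f' t))\<^sup>2)) | f f'.
      L2_derivative f f' \<and> skeleton_solution U b \<sigma> (the (g 0)) f' g}"

definition limit_set ::
    "(real^'d) set \<Rightarrow> (real^'d \<Rightarrow> real^'d) \<Rightarrow> (real^'d \<Rightarrow> real^'k^'d) \<Rightarrow> real^'d
      \<Rightarrow> (real \<Rightarrow> (real^'d) option) set" where
  "limit_set U b \<sigma> x = {g \<in> path_space_from 1 U x. rate U b \<sigma> g \<le> 1}"


section \<open>The assumption on the family of solutions\<close>

text \<open>
  The clause \<^prop>\<open>c ^ j \<le> eps_star\<close> says that \<open>y\<close> is defined at all parameters that occur.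
\<close>

definition family_assumption ::
    "'w measure \<Rightarrow> real \<Rightarrow> (real^'d) set \<Rightarrow> real^'d \<Rightarrow> (real^'d) set \<Rightarrow> real
      \<Rightarrow> (real \<Rightarrow> 'w \<Rightarrow> real \<Rightarrow> (real^'d) option) \<Rightarrow> bool" where
  "family_assumption M eps_star U_star x L t_star y \<longleftrightarrow>
    (\<forall>\<delta>>0. \<exists>c\<^sub>0\<in>{0<..<1}. \<forall>c\<in>{c\<^sub>0<..<1}.
       \<exists>J \<in> measurable M (count_space (UNIV::enat set)).
         (AE \<omega> in M. J \<omega> < \<infinity>) \<and>
         (\<forall>\<omega>\<in>space M. \<forall>j. enat j \<ge> J \<omega> \<longrightarrow> c ^ j \<le> eps_star \<and>
            (\<forall>\<epsilon>\<in>{c ^ (j + 1)..c ^ j}.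
               (\<forall>t\<in>{0..t_star}. y \<epsilon> \<omega> t \<in> Some ` L) \<and>
               path_dist t_star t_star (y (c ^ j) \<omega>) (y \<epsilon> \<omega>) < ereal \<delta>))) \<and>
    (AE \<omega> in M. continuous_map (top_of_set {0<..<eps_star})
       (subtopology (path_topology t_star U_star) (path_space_from t_star U_star x)) (\<lambda>\<epsilon>. y \<epsilon> \<omega>))"

end

theory Submission
  imports Defs "HOL-Complex_Analysis.Great_Picard" "HOL-Real_Asymp.Real_Asymp"
begin

text \<open>
  Write \<open>X\<^sup>\<epsilon>\<^sub>t = B\<^bsub>\<epsilon> t\<^esub> / sqrt (\<epsilon> log log (1/\<epsilon>))\<close>.  As the noise is additive, \<open>y\<^sup>\<epsilon>\<close> solves the ordinary integral
  equation with drift \<open>b\<^sub>\<epsilon>\<close> driven by \<open>\<sigma>\<^sub>\<epsilon> X\<^sup>\<epsilon>\<close>, path by path.  Everything about \<open>y\<^sup>\<epsilon>\<close> is therefore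
  deterministic once enough is known about \<open>X\<^sup>\<epsilon>\<close>, and by Gronwall's inequality \<open>y\<^sup>\<epsilon>\<close> depends
  continuously on the drift and on the driving path as long as it stays in a compact set.

  The probabilistic input is the upper half of Strassen's law of the iterated logarithm along
  \<open>\<epsilon> = c\<^sup>j\<close>.  For a partition of \<open>[0,1]\<close> into \<open>n\<close> intervals, the energy of the piecewise linear
  interpolation of \<open>X\<^sup>\<epsilon>\<close> is a sum of squares of independent Gaussian variables divided by
  \<open>log log (1/\<epsilon>)\<close>; its exponential moments show that it exceeds \<open>1 + \<eta>\<close> with a probability that is
  summable over \<open>j\<close>.  In the same way, with summable exceptional probability, all dyadic increments
  of \<open>X\<^sup>\<epsilon>\<close> are bounded by a geometric sequence, and chaining turns this into a deterministic
  modulus of continuity.  By Borel-Cantelli, almost surely only finitely many \<open>j\<close> are exceptional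
  (\<open>exceptional_events_finitely_often\<close>).

  That \<open>y\<^sup>\<epsilon>\<close> stays in \<open>L\<close> is a compactness statement (\<open>exists_uniform_confinement\<close>).  If it failed
  for arbitrarily small \<open>\<epsilon>\<close> and arbitrarily fine partitions, then by Arzela-Ascoli some driving paths
  would converge uniformly to a function \<open>f\<close> all of whose dyadic energies are at most \<open>1\<close>.  The slopes
  of the dyadic interpolations of \<open>f\<close> form an \<open>L\<^sup>2\<close>-bounded martingale, so \<open>f\<close> has a derivative in
  \<open>L\<^sup>2\<close> with energy at most \<open>1\<close> (\<open>L2_derivative_of_bounded_energy\<close>), and the skeleton solution \<open>g\<close>
  driven by \<open>f\<close> belongs to the limit set.  By hypothesis \<open>g\<close> stays in the interior of \<open>L\<close> up to \<open>t\<^sub>*\<close>, and so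
  do all solutions that are close to it: a contradiction.  To know that \<open>g\<close> exists as an element of the path
  space, a maximal solution is constructed (\<open>maximal_solution_exists\<close>).

  For \<open>\<epsilon>\<close> between \<open>c\<^bsup>j+1\<^esup>\<close> and \<open>c\<^sup>j\<close>, Brownian scaling writes \<open>X\<^sup>\<epsilon>\<close> as \<open>X\<close> at \<open>c\<^sup>j\<close> run at a speed in \<open>[c,1]\<close>
  and multiplied by a factor near \<open>1\<close>, so the modulus of continuity bounds the difference by
  any prescribed number if \<open>c\<close> is close to \<open>1\<close> and \<open>j\<close> is large
  (\<open>strassen_path_between_powers\<close>); Gronwall's inequality transfers this to the solutions.  Continuity
  in \<open>\<epsilon>\<close> is the same stability argument, applied on a compact neighbourhood of an initial piece of a
  single path (\<open>killed_solutions_converge\<close>).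
\<close>

section \<open>Comparison of solutions\<close>

text \<open>
  The function \<open>s \<mapsto> exp (- C s) (a + C \<integral>\<^sub>0\<^sup>s \<phi>)\<close> is nonincreasing.
\<close>

lemma gronwall:
  fixes \<phi> :: "real \<Rightarrow> real"
  assumes cont: "continuous_on {0..T} \<phi>"
    and le: "\<And>t. t \<in> {0..T} \<Longrightarrow> \<phi> t \<le> a + C * integral {0..t} \<phi>"
    and C: "0 \<le> C" and t: "t \<in> {0..T}"
  shows "\<phi> t \<le> a * exp (C * t)"
proof -
  define G where "G s = exp (- C * s) * (a + C * integral {0..s} \<phi>)" for s
  have "continuous_on {0..T} (\<lambda>s. integral {0..s} \<phi>)"
    by (intro indefinite_integral_continuous_1 integrable_continuous_real cont)
  then have G_cont: "continuous_on {0..t} G"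
    unfolding G_def using t by (intro continuous_intros) (auto intro: continuous_on_subset)
  have "G t \<le> G 0"
  proof (rule DERIV_nonpos_imp_decreasing_open[OF _ _ G_cont])
    show "0 \<le> t" using t by auto
    fix s assume s: "0 < s" "s < t"
    have "((\<lambda>s. integral {0..s} \<phi>) has_real_derivative \<phi> s) (at s within {0..T})"
      using s t by (intro integral_has_real_derivative cont) auto
    moreover have "at s within {0..T} = at s"
      using s t by (intro at_within_Icc_at) auto
    ultimately have "((\<lambda>s. integral {0..s} \<phi>) has_real_derivative \<phi> s) (at s)" by simp
    then have "(G has_real_derivative
        exp (- C * s) * C * (\<phi> s - (a + C * integral {0..s} \<phi>))) (at s)"
      unfolding G_def by (auto intro!: derivative_eq_intros simp: algebra_simps)
    moreover have "exp (- C * s) * C * (\<phi> s - (a + C * integral {0..s} \<phi>)) \<le> 0"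
      using le[of s] s t C by (intro mult_nonneg_nonpos) auto
    ultimately show "\<exists>y. (G has_real_derivative y) (at s) \<and> y \<le> 0" by blast
  qed
  then have "exp (- C * t) * (a + C * integral {0..t} \<phi>) \<le> a"
    by (simp add: G_def)
  then have "exp (C * t) * (exp (- C * t) * (a + C * integral {0..t} \<phi>)) \<le> exp (C * t) * a"
    by (intro mult_left_mono) auto
  then have "a + C * integral {0..t} \<phi> \<le> a * exp (C * t)"
    by (simp add: mult.assoc[symmetric] exp_add[symmetric] mult.commute)
  with le[OF t] show ?thesis by linarith
qed

text \<open>
  Both drifts are measured against one Lipschitz function \<open>b\<close>: the drifts \<open>b\<^sub>\<epsilon>\<close> are each Lipschitz on
  \<open>K\<close>, but their constants need not be bounded as \<open>\<epsilon>\<close> varies.  Taking \<open>b\<close> equal to both drifts gives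
  uniqueness, and taking it equal to one of them gives stability.
\<close>

lemma solution_comparison:
  fixes y1 y2 :: "real \<Rightarrow> 'a::euclidean_space"
  assumes cont: "continuous_on {0..T} y1" "continuous_on {0..T} y2"
    and in_K: "y1 ` {0..T} \<subseteq> K" "y2 ` {0..T} \<subseteq> K"
    and lip: "C-lipschitz_on K b"
    and cont_drift: "continuous_on K \<beta>1" "continuous_on K \<beta>2"
    and drift: "\<And>z. z \<in> K \<Longrightarrow> norm (\<beta>1 z - b z) \<le> a1" "\<And>z. z \<in> K \<Longrightarrow> norm (\<beta>2 z - b z) \<le> a2"
    and noise: "\<And>t. t \<in> {0..T} \<Longrightarrow> norm (W1 t - W2 t) \<le> w"
    and eq1: "\<And>t. t \<in> {0..T} \<Longrightarrow> y1 t = x + integral {0..t} (\<lambda>s. \<beta>1 (y1 s)) + W1 t"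
    and eq2: "\<And>t. t \<in> {0..T} \<Longrightarrow> y2 t = x + integral {0..t} (\<lambda>s. \<beta>2 (y2 s)) + W2 t"
    and T: "T \<le> 1" and t: "t \<in> {0..T}"
  shows "norm (y1 t - y2 t) \<le> (a1 + a2 + w) * exp C"
proof -
  have C: "0 \<le> C" using lip by (rule lipschitz_on_nonneg)
  have y1_in: "y1 s \<in> K" "y2 s \<in> K" if "s \<in> {0..T}" for s using in_K that by auto
  have pos: "0 \<le> a1 + a2 + w"
    using drift(1)[OF y1_in(1)[OF t]] drift(2)[OF y1_in(1)[OF t]] noise[OF t]
      norm_ge_zero[of "\<beta>1 (y1 t) - b (y1 t)"] norm_ge_zero[of "\<beta>2 (y1 t) - b (y1 t)"]
      norm_ge_zero[of "W1 t - W2 t"] by linarith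
  define \<phi> where "\<phi> s = norm (y1 s - y2 s)" for s
  have \<phi>_cont: "continuous_on {0..T} \<phi>"
    unfolding \<phi>_def by (intro continuous_intros cont)
  have le: "\<phi> s \<le> (a1 + a2 + w) + C * integral {0..s} \<phi>" if s: "s \<in> {0..T}" for s
  proof -
    have int1: "(\<lambda>r. \<beta>1 (y1 r)) integrable_on {0..s}" and int2: "(\<lambda>r. \<beta>2 (y2 r)) integrable_on {0..s}"
      using s in_K
      by (auto intro!: integrable_continuous_real continuous_on_compose2[OF cont_drift(1)]
          continuous_on_compose2[OF cont_drift(2)] continuous_on_subset[OF cont(1)]
          continuous_on_subset[OF cont(2)])
    have \<phi>_int: "\<phi> integrable_on {0..s}"
      using s by (auto intro!: integrable_continuous_real continuous_on_subset[OF \<phi>_cont])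
    have "norm (integral {0..s} (\<lambda>r. \<beta>1 (y1 r) - \<beta>2 (y2 r)))
        \<le> integral {0..s} (\<lambda>r. (a1 + a2) + C * \<phi> r)"
    proof (rule integral_norm_bound_integral)
      show "(\<lambda>r. \<beta>1 (y1 r) - \<beta>2 (y2 r)) integrable_on {0..s}"
        by (intro integrable_diff int1 int2)
      show "(\<lambda>r. a1 + a2 + C * \<phi> r) integrable_on {0..s}"
        using s by (intro integrable_continuous_real continuous_intros continuous_on_subset[OF \<phi>_cont]) auto
      fix r assume "r \<in> {0..s}"
      then have r: "r \<in> {0..T}" using s by auto
      have "norm (b (y1 r) - b (y2 r)) \<le> C * \<phi> r"
        using lipschitz_onD[OF lip y1_in[OF r]] by (simp add: dist_norm \<phi>_def)
      moreover have "norm (\<beta>1 (y1 r) - \<beta>2 (y2 r)) \<le> norm (\<beta>1 (y1 r) - b (y1 r)) +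
          norm (b (y1 r) - b (y2 r)) + norm (\<beta>2 (y2 r) - b (y2 r))"
        using norm_triangle_ineq4[of "(\<beta>1 (y1 r) - b (y1 r)) + (b (y1 r) - b (y2 r))" "\<beta>2 (y2 r) - b (y2 r)"]
          norm_triangle_ineq[of "\<beta>1 (y1 r) - b (y1 r)" "b (y1 r) - b (y2 r)"] by simp
      ultimately show "norm (\<beta>1 (y1 r) - \<beta>2 (y2 r)) \<le> a1 + a2 + C * \<phi> r"
        using drift(1)[OF y1_in(1)[OF r]] drift(2)[OF y1_in(2)[OF r]] by linarith
    qed
    also have "\<dots> = (a1 + a2) * s + C * integral {0..s} \<phi>"
    proof -
      have "(\<lambda>r. C * \<phi> r) integrable_on {0..s}"
        using s by (intro integrable_continuous_real continuous_intros continuous_on_subset[OF \<phi>_cont]) auto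
      then show ?thesis using s by (subst integral_add) auto
    qed
    also have "\<dots> \<le> (a1 + a2) + C * integral {0..s} \<phi>"
    proof -
      have "0 \<le> a1 + a2"
        using drift(1)[OF y1_in(1)[OF s]] drift(2)[OF y1_in(1)[OF s]]
          norm_ge_zero[of "\<beta>1 (y1 s) - b (y1 s)"] norm_ge_zero[of "\<beta>2 (y1 s) - b (y1 s)"] by linarith
      then have "(a1 + a2) * s \<le> (a1 + a2) * 1" using s T by (intro mult_left_mono) auto
      then show ?thesis by simp
    qed
    finally have "norm (integral {0..s} (\<lambda>r. \<beta>1 (y1 r) - \<beta>2 (y2 r))) \<le> a1 + a2 + C * integral {0..s} \<phi>" .
    moreover have "y1 s - y2 s = integral {0..s} (\<lambda>r. \<beta>1 (y1 r) - \<beta>2 (y2 r)) + (W1 s - W2 s)"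
      by (subst integral_diff[OF int1 int2]) (simp add: eq1[OF s] eq2[OF s])
    then have "\<phi> s \<le> norm (integral {0..s} (\<lambda>r. \<beta>1 (y1 r) - \<beta>2 (y2 r))) + norm (W1 s - W2 s)"
      unfolding \<phi>_def by (simp only: norm_triangle_ineq)
    ultimately show ?thesis using noise[OF s] by linarith
  qed
  have "\<phi> t \<le> (a1 + a2 + w) * exp (C * t)"
    by (rule gronwall[OF \<phi>_cont le C t])
  also have "\<dots> \<le> (a1 + a2 + w) * exp C"
    using t T C pos by (intro mult_left_mono) (auto intro: mult_left_le)
  finally show ?thesis by (simp add: \<phi>_def)
qed


section \<open>Paths with a cemetery point\<close>

lemma path_space_None_mono:
  assumes "g \<in> path_space t V" "0 \<le> u" "u \<le> s" "s \<le> t" "g s \<noteq> None"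
  shows "g u \<noteq> None"
proof -
  have "\<forall>s\<in>{0..t}. \<forall>u\<in>{s..t}. g s = None \<longrightarrow> g u = None"
    using assms(1) unfolding path_space_def by blast
  from this[rule_format, of u s] show ?thesis using assms(2-5) by fastforce
qed

lemma path_space_continuous_map:
  assumes "g \<in> path_space t V"
  shows "continuous_map (top_of_set {0..t}) (Alexandroff_compactification (top_of_set V)) g"
  using assms unfolding path_space_def by blast

text \<open>
  The topology of the compactification enters through two families of sets only: images of open
  sets are open and images of compact sets are closed.  The converse \<open>path_spaceI\<close> below says that
  these two families suffice.
\<close>

lemma path_space_closed_compl_open:
  assumes g: "g \<in> path_space t V" and W: "open W" "W \<subseteq> V"
  shows "closed {s \<in> {0..t}. g s \<notin> Some ` W}"
proof -
  have "openin (Alexandroff_compactification (top_of_set V)) (Some ` W)"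
    using W by (simp add: open_subset)
  then have "openin (top_of_set {0..t}) {s \<in> topspace (top_of_set {0..t}). g s \<in> Some ` W}"
    by (rule openin_continuous_map_preimage[OF path_space_continuous_map[OF g]])
  then have "closedin (top_of_set {0..t}) ({0..t} - {s \<in> {0..t}. g s \<in> Some ` W})"
    by (simp add: closedin_diff)
  moreover have "{0..t} - {s \<in> {0..t}. g s \<in> Some ` W} = {s \<in> {0..t}. g s \<notin> Some ` W}" by blast
  ultimately have "closedin (top_of_set {0..t}) {s \<in> {0..t}. g s \<notin> Some ` W}" by simp
  then show ?thesis by (rule closedin_closed_trans) simp
qed

lemma path_space_closed_compact:
  assumes g: "g \<in> path_space t V" and K: "compact K" "K \<subseteq> V"
  shows "closed {s \<in> {0..t}. g s \<in> Some ` K}"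
proof -
  have "closedin (Alexandroff_compactification (top_of_set V)) (Some ` K)"
    using K by (simp add: compactin_subtopology closed_subset compact_imp_closed)
  then have "closedin (top_of_set {0..t}) {s \<in> topspace (top_of_set {0..t}). g s \<in> Some ` K}"
    by (rule closedin_continuous_map_preimage[OF path_space_continuous_map[OF g]])
  then have "closedin (top_of_set {0..t}) {s \<in> {0..t}. g s \<in> Some ` K}" by simp
  then show ?thesis by (rule closedin_closed_trans) simp
qed

lemma path_space_values:
  assumes "g \<in> path_space t V" "s \<in> {0..t}" "g s \<noteq> None"
  shows "the (g s) \<in> V"
proof -
  have "g ` {0..t} \<subseteq> insert None (Some ` V)"
    using continuous_map_image_subset_topspace[OF path_space_continuous_map[OF assms(1)]] by simp
  then have "g s \<in> insert None (Some ` V)" using assms(2) by blast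
  then show ?thesis using assms(3) by auto
qed

lemma path_space_continuous_on:
  assumes g: "g \<in> path_space t V" and S: "S \<subseteq> {0..t}" "\<And>s. s \<in> S \<Longrightarrow> g s \<noteq> None" and V: "open V"
  shows "continuous_on S (\<lambda>s. the (g s))"
  unfolding continuous_on_open_invariant
proof (intro allI impI)
  fix W :: "(real^'a) set" assume W: "open W"
  have "open (- {s \<in> {0..t}. g s \<notin> Some ` (W \<inter> V)})"
    using W V by (intro open_Compl path_space_closed_compl_open[OF g]) auto
  moreover have "- {s \<in> {0..t}. g s \<notin> Some ` (W \<inter> V)} \<inter> S = (\<lambda>s. the (g s)) -` W \<inter> S"
  proof -
    have "g s \<in> Some ` (W \<inter> V) \<longleftrightarrow> the (g s) \<in> W" if "s \<in> S" for s
      using path_space_values[OF g, of s] S(1) S(2)[OF that] that by (cases "g s") auto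
    then show ?thesis using S by auto
  qed
  ultimately show "\<exists>A. open A \<and> A \<inter> S = (\<lambda>s. the (g s)) -` W \<inter> S" by blast
qed

lemma path_spaceI:
  fixes V :: "(real^'m) set"
  assumes ext: "g \<in> extensional {0..t}"
    and val: "\<And>s. s \<in> {0..t} \<Longrightarrow> g s \<in> insert None (Some ` V)"
    and mono: "\<And>s u. \<lbrakk>0 \<le> s; s \<le> u; u \<le> t; g u \<noteq> None\<rbrakk> \<Longrightarrow> g s \<noteq> None"
    and opn: "\<And>W. \<lbrakk>open W; W \<subseteq> V\<rbrakk> \<Longrightarrow> openin (top_of_set {0..t}) {s \<in> {0..t}. g s \<in> Some ` W}"
    and cpt: "\<And>K. \<lbrakk>compact K; K \<subseteq> V\<rbrakk> \<Longrightarrow> closed {s \<in> {0..t}. g s \<in> Some ` K}"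
    and V: "open V"
  shows "g \<in> path_space t V"
proof -
  have "continuous_map (top_of_set {0..t}) (Alexandroff_compactification (top_of_set V)) g"
    unfolding continuous_map_def
  proof (intro conjI allI impI)
    show "g \<in> topspace (top_of_set {0..t}) \<rightarrow> topspace (Alexandroff_compactification (top_of_set V))"
      using val by auto
    fix W assume "openin (Alexandroff_compactification (top_of_set V)) W"
    then consider W' where "openin (top_of_set V) W'" "W = Some ` W'"
      | K where "compact K" "K \<subseteq> V" "W = insert None (Some ` (V - K))"
      unfolding openin_Alexandroff_compactification by (auto simp: compactin_subtopology)
    then show "openin (top_of_set {0..t}) {s \<in> topspace (top_of_set {0..t}). g s \<in> W}"
    proof cases
      case 1
      then have "open W'" "W' \<subseteq> V" using V by (auto simp: openin_open_eq)
      with opn 1 show ?thesis by simp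
    next
      case 2
      have "{s \<in> {0..t}. g s \<in> W} = {0..t} \<inter> (- {s \<in> {0..t}. g s \<in> Some ` K})"
        using val 2 by fastforce
      with cpt[OF 2(1,2)] show ?thesis by (auto simp: openin_open)
    qed
  qed
  moreover have "\<forall>s\<in>{0..t}. \<forall>u\<in>{s..t}. g s = None \<longrightarrow> g u = None"
    using mono by (metis atLeastAtMost_iff)
  ultimately show ?thesis using ext unfolding path_space_def by blast
qed

lemma closed_subset_Icc_compact:
  fixes Z :: "real set"
  assumes "closed Z" "Z \<subseteq> {a..b}"
  shows "compact Z"
proof -
  have "compact (Z \<inter> {a..b})" using assms(1) by (intro closed_Int_compact) auto
  moreover have "Z \<inter> {a..b} = Z" using assms(2) by blast
  ultimately show ?thesis by simp
qed

text \<open>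
  The set of times at which the path is at \<open>\<Delta>\<close> is closed, so the infimum defining the exit time is
  attained unless it is \<open>\<infinity>\<close>.
\<close>

lemma less_exit_time_iff:
  assumes g: "g \<in> path_space t V" and V: "open V" and s: "s \<in> {0..t}"
  shows "ereal s < exit_time t g \<longleftrightarrow> g s \<noteq> None"
proof
  assume less: "ereal s < exit_time t g"
  show "g s \<noteq> None"
  proof
    assume "g s = None"
    then have "exit_time t g \<le> ereal s"
      unfolding exit_time_def using s by (intro Inf_lower) auto
    with less show False by simp
  qed
next
  assume s': "g s \<noteq> None"
  define Z where "Z = {u \<in> {0..t}. g u = None}"
  have "{u \<in> {0..t}. g u \<notin> Some ` V} = Z"
  proof -
    have "g u \<notin> Some ` V \<longleftrightarrow> g u = None" if "u \<in> {0..t}" for u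
      using path_space_values[OF g that] by (cases "g u") auto
    then show ?thesis unfolding Z_def by blast
  qed
  then have "closed Z" using path_space_closed_compl_open[OF g V] by simp
  then have Z: "compact Z"
    by (rule closed_subset_Icc_compact[of _ 0 t]) (auto simp: Z_def)
  show "ereal s < exit_time t g"
  proof (cases "Z = {}")
    case True
    then have "exit_time t g = \<infinity>" unfolding exit_time_def Z_def[symmetric] by (simp add: top_ereal_def)
    then show ?thesis by simp
  next
    case False
    with Z obtain m where m: "m \<in> Z" "\<And>u. u \<in> Z \<Longrightarrow> m \<le> u"
      by (meson compact_attains_inf)
    have "s < m"
      using m(1) s' s path_space_None_mono[OF g, of m s] by (force simp: Z_def not_less)
    moreover have "ereal m \<le> exit_time t g"
      unfolding exit_time_def Z_def[symmetric] using m(2) by (intro Inf_greatest) auto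
    ultimately show ?thesis by (meson ereal_less(1) less_ereal.simps(1) order_less_le_trans)
  qed
qed

text \<open>
  At the exit time \<open>\<tau>\<close> from \<open>U\<close> the path is outside \<open>U\<close>, hence outside every compact subset of \<open>U\<close>;
  just before \<open>\<tau>\<close> it has therefore left any given one, which is continuity at \<open>\<Delta>\<close> of the killed path.
\<close>

lemma killed_path_in_path_space:
  assumes g: "g \<in> path_space 1 V" and U: "open U" "U \<subseteq> V" and V: "open V" and t: "0 \<le> t" "t \<le> 1"
  shows "killed_path t U g \<in> path_space t U"
proof -
  let ?k = "killed_path t U g"
  have k_eq: "?k s = (if \<forall>u\<in>{0..s}. g u \<in> Some ` U then g s else None)" if "s \<in> {0..t}" for s
    using that by (simp add: killed_path_def)
  define Z where "Z = {s \<in> {0..1}. g s \<notin> Some ` U}"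
  have Z: "closed Z" unfolding Z_def by (rule path_space_closed_compl_open[OF g U])
  \<comment> \<open>\<open>\<tau>\<close> is the exit time, or a time after \<open>t\<close> if there is no exit.\<close>
  obtain \<tau> where \<tau>: "\<And>s. s \<in> {0..1} \<Longrightarrow> (\<forall>u\<in>{0..s}. g u \<in> Some ` U) \<longleftrightarrow> s < \<tau>"
    "\<tau> \<le> 1 \<Longrightarrow> g \<tau> \<notin> Some ` U" "0 \<le> \<tau>"
  proof (cases "Z = {}")
    case True
    then have "\<And>s. s \<in> {0..1} \<Longrightarrow> g s \<in> Some ` U" by (auto simp: Z_def)
    then show ?thesis by (intro that[of 2]) auto
  next
    case False
    have "compact Z" by (rule closed_subset_Icc_compact[OF Z, of 0 1]) (auto simp: Z_def)
    with False obtain m where m: "m \<in> Z" "\<And>u. u \<in> Z \<Longrightarrow> m \<le> u"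
      by (meson compact_attains_inf)
    show ?thesis
    proof (rule that[of m])
      fix s :: real assume s: "s \<in> {0..1}"
      show "(\<forall>u\<in>{0..s}. g u \<in> Some ` U) \<longleftrightarrow> s < m"
      proof
        assume "\<forall>u\<in>{0..s}. g u \<in> Some ` U"
        then show "s < m" using m(1) unfolding Z_def by (metis (no_types, lifting) atLeastAtMost_iff mem_Collect_eq not_le)
      next
        assume "s < m"
        then show "\<forall>u\<in>{0..s}. g u \<in> Some ` U" using m(2) s unfolding Z_def by fastforce
      qed
    qed (use m(1) in \<open>auto simp: Z_def\<close>)
  qed
  have k_eq': "?k s = (if s < \<tau> then g s else None)" if "s \<in> {0..t}" for s
    using k_eq[OF that] \<tau>(1)[of s] that t by auto
  have k_in: "g s \<in> Some ` U" if "s \<in> {0..t}" "s < \<tau>" for s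
    using \<tau>(1)[of s] that t by auto
  have k_Some: "?k s \<in> Some ` X \<longleftrightarrow> s < \<tau> \<and> g s \<in> Some ` X" if "s \<in> {0..t}" for s X
    by (simp add: k_eq'[OF that] image_iff)
  have sub: "s \<in> {0..1}" if "s \<in> {0..t}" for s using that t by auto
  show ?thesis
  proof (rule path_spaceI[OF _ _ _ _ _ U(1)])
    show "?k \<in> extensional {0..t}" by (simp add: killed_path_def)
    show "?k s \<in> insert None (Some ` U)" if "s \<in> {0..t}" for s
      using k_eq'[OF that] k_in[OF that] by auto
    show "?k s \<noteq> None" if su: "0 \<le> s" "s \<le> u" "u \<le> t" "?k u \<noteq> None" for s u
    proof -
      have "u < \<tau>" using k_eq'[of u] su by (auto split: if_splits)
      then show ?thesis using k_eq'[of s] k_in[of s] su by auto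
    qed
    show "openin (top_of_set {0..t}) {s \<in> {0..t}. ?k s \<in> Some ` W}" if W: "open W" "W \<subseteq> U" for W
    proof -
      have "{s \<in> {0..t}. ?k s \<in> Some ` W} = {0..t} \<inter> ({..<\<tau>} \<inter> - {s \<in> {0..1}. g s \<notin> Some ` W})"
        using k_Some sub by blast
      moreover have "open ({..<\<tau>} \<inter> - {s \<in> {0..1}. g s \<notin> Some ` W})"
        using W U by (intro open_Int open_Compl path_space_closed_compl_open[OF g]) auto
      ultimately show ?thesis by (auto simp: openin_open)
    qed
    show "closed {s \<in> {0..t}. ?k s \<in> Some ` K}" if K: "compact K" "K \<subseteq> U" for K
    proof -
      have "{s \<in> {0..t}. ?k s \<in> Some ` K} = {0..t} \<inter> {..\<tau>} \<inter> {s \<in> {0..1}. g s \<in> Some ` K}"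
      proof -
        have "s < \<tau> \<longleftrightarrow> s \<le> \<tau>" if s: "s \<in> {0..t}" "g s \<in> Some ` K" for s
        proof -
          have "g s \<in> Some ` U" using s(2) K(2) by blast
          then have "s \<noteq> \<tau>" using \<tau>(2) sub[OF s(1)] by auto
          then show ?thesis by auto
        qed
        then show ?thesis using k_Some sub by blast
      qed
      moreover have "closed {s \<in> {0..1}. g s \<in> Some ` K}"
        using path_space_closed_compact[OF g K(1)] K U by auto
      ultimately show ?thesis by (simp add: closed_Int)
    qed
  qed
qed

lemma killed_path_eq_Some:
  assumes "g ` {0..s} \<subseteq> Some ` U" "0 \<le> s" "s \<le> t" "u \<in> {0..s}"
  shows "killed_path t U g u = g u"
proof -
  have "\<forall>v\<in>{0..u}. g v \<in> Some ` U" using assms by fastforce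
  then show ?thesis using assms unfolding killed_path_def by auto
qed

lemma additive_solution_integral_form:
  assumes sol: "additive_solution V \<beta> W x y" and V: "open V" and \<beta>: "continuous_on V \<beta>"
    and T: "T \<in> {0..1}" "y T \<noteq> None"
  shows "continuous_on {0..T} (\<lambda>s. the (y s))" "(\<lambda>s. the (y s)) ` {0..T} \<subseteq> V"
    and "\<And>t. t \<in> {0..T} \<Longrightarrow> the (y t) = x + integral {0..t} (\<lambda>s. \<beta> (the (y s))) + W t"
proof -
  have y: "y \<in> path_space 1 V" using sol unfolding additive_solution_def path_space_from_def by blast
  have def: "y s \<noteq> None" if "s \<in> {0..T}" for s
    using path_space_None_mono[OF y, of s T] that T by auto
  show cont: "continuous_on {0..T} (\<lambda>s. the (y s))"
    using T def by (intro path_space_continuous_on[OF y _ _ V]) auto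
  show val: "(\<lambda>s. the (y s)) ` {0..T} \<subseteq> V"
    using path_space_values[OF y] def T by force
  fix t assume t: "t \<in> {0..T}"
  then have "ereal t < exit_time 1 y" using less_exit_time_iff[OF y V, of t] def T by auto
  then have "the (y t) = x + (LINT s:{0..t}|lborel. \<beta> (the (y s))) + W t"
    using sol t T by (auto simp: additive_solution_def)
  also have "continuous_on {0..t} (\<lambda>s. \<beta> (the (y s)))"
    using t val by (intro continuous_on_compose2[OF \<beta>] continuous_on_subset[OF cont]) auto
  then have "(LINT s:{0..t}|lborel. \<beta> (the (y s))) = integral {0..t} (\<lambda>s. \<beta> (the (y s)))"
    by (intro set_borel_integral_eq_integral borel_integrable_atLeastAtMost')
  finally show "the (y t) = x + integral {0..t} (\<lambda>s. \<beta> (the (y s))) + W t" .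
qed

lemma locally_lipschitz_on_imp_continuous_on:
  fixes f :: "'a::euclidean_space \<Rightarrow> 'b::metric_space"
  assumes "locally_lipschitz_on U f" "open U"
  shows "continuous_on U f"
proof -
  have "isCont f x" if x: "x \<in> U" for x
  proof -
    obtain r where r: "r > 0" "cball x r \<subseteq> U" using assms(2) x open_contains_cball by blast
    then obtain C where "C-lipschitz_on (cball x r) f"
      using assms(1) unfolding locally_lipschitz_on_def by (meson compact_cball)
    then have "continuous_on (ball x r) f" 
      using continuous_on_subset[OF lipschitz_on_continuous_on] ball_subset_cball by blast
    then show ?thesis using r by (simp add: continuous_on_eq_continuous_at)
  qed
  then show ?thesis by (simp add: continuous_at_imp_continuous_on)
qed

text \<open>
  At the first time at which \<open>y\<close> is not in the interior of \<open>K\<close> it is still in \<open>K\<close>, because \<open>K\<close> is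
  closed in the compactification.  The comparison estimate then applies up to and including that
  time and places \<open>y\<close> in the tube around \<open>g\<close>, which lies in the interior of \<open>K\<close>: a contradiction.
\<close>

lemma additive_solution_stays_close:
  fixes b \<beta> :: "real^'d \<Rightarrow> real^'d"
  assumes sol: "additive_solution V \<beta> W x y" and V: "open V" and \<beta>: "continuous_on V \<beta>"
    and K: "compact K" "K \<subseteq> V" and lip: "C-lipschitz_on K b"
    and drift: "\<And>z. z \<in> K \<Longrightarrow> norm (\<beta> z - b z) \<le> a"
    and noise: "\<And>t. t \<in> {0..T} \<Longrightarrow> norm (W t - w t) \<le> a'"
    and g_cont: "continuous_on {0..T} g"
    and g_eq: "\<And>t. t \<in> {0..T} \<Longrightarrow> g t = x + integral {0..t} (\<lambda>s. b (g s)) + w t"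
    and T: "0 \<le> T" "T \<le> 1" and x: "x \<in> interior K"
    and tube: "\<And>t. t \<in> {0..T} \<Longrightarrow> cball (g t) \<rho> \<subseteq> interior K"
    and \<rho>: "(a + a') * exp C \<le> \<rho>" "0 \<le> \<rho>" and t: "t \<in> {0..T}"
  shows "y t \<in> Some ` interior K \<and> norm (the (y t) - g t) \<le> (a + a') * exp C"
proof -
  have y: "y \<in> path_space 1 V" "y 0 = Some x"
    using sol unfolding additive_solution_def path_space_from_def by blast+
  have close: "norm (the (y s) - g s) \<le> (a + a') * exp C"
    if r: "r \<in> {0..T}" "\<And>s. s \<in> {0..r} \<Longrightarrow> y s \<in> Some ` K" and s: "s \<in> {0..r}" for r s
  proof -
    have rT: "r \<in> {0..1}" "y r \<noteq> None" using r(1) r(2)[of r] T by auto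
    note form = additive_solution_integral_form[OF sol V \<beta> rT]
    have "norm (the (y s) - g s) \<le> (a + 0 + a') * exp C"
    proof (rule solution_comparison[OF form(1) _ _ _ lip _ _ drift _ noise form(3)])
      show "continuous_on {0..r} g" using r(1) by (intro continuous_on_subset[OF g_cont]) auto
      show "(\<lambda>s. the (y s)) ` {0..r} \<subseteq> K" using r(2) by force
      show "g ` {0..r} \<subseteq> K"
      proof
        fix z assume "z \<in> g ` {0..r}"
        then obtain u where u: "u \<in> {0..r}" "z = g u" by auto
        then have "z \<in> cball (g u) \<rho>" using \<rho>(2) by simp
        then show "z \<in> K" using tube[of u] u(1) r(1) interior_subset by fastforce
      qed
      show "continuous_on K \<beta>" using \<beta> K(2) by (rule continuous_on_subset)
      show "continuous_on K b" using lip by (rule lipschitz_on_continuous_on)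
      show "\<And>u. u \<in> {0..r} \<Longrightarrow> g u = x + integral {0..u} (\<lambda>s. b (g s)) + w u"
        using g_eq r(1) by auto
    qed (use r s T in auto)
    then show ?thesis by simp
  qed
  have stay: "y s \<in> Some ` interior K" if "s \<in> {0..T}" for s
  proof (rule ccontr)
    assume not: "y s \<notin> Some ` interior K"
    define Z where "Z = {s \<in> {0..1}. y s \<notin> Some ` interior K}"
    have cZ: "closed Z"
      unfolding Z_def using K interior_subset by (intro path_space_closed_compl_open[OF y(1)]) auto
    have "compact Z" by (rule closed_subset_Icc_compact[OF cZ, of 0 1]) (auto simp: Z_def)
    moreover have sZ: "s \<in> Z" using not that T by (auto simp: Z_def)
    ultimately obtain m where m: "m \<in> Z" "\<And>u. u \<in> Z \<Longrightarrow> m \<le> u"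
      by (metis compact_attains_inf empty_iff)
    have mT: "m \<in> {0..T}" "m \<le> s" using m(1) m(2)[OF sZ] that by (auto simp: Z_def)
    have "m \<noteq> 0" using m(1) y(2) x by (auto simp: Z_def)
    then have m0: "0 < m" using mT by auto
    have inK: "y u \<in> Some ` interior K" if "u \<in> {0..<m}" for u
      using m(2)[of u] that mT T by (force simp: Z_def)
    have "closed {s \<in> {0..1}. y s \<in> Some ` K}"
      by (rule path_space_closed_compact[OF y(1) K])
    moreover have "{0..<m} \<subseteq> {s \<in> {0..1}. y s \<in> Some ` K}"
      using inK mT T interior_subset by fastforce
    ultimately have "closure {0..<m} \<subseteq> {s \<in> {0..1}. y s \<in> Some ` K}"
      by (rule closure_minimal[rotated])
    then have inK': "y u \<in> Some ` K" if "u \<in> {0..m}" for u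
      using that m0 by auto
    have mm: "m \<in> {0..m}" using m0 by auto
    have "norm (the (y m) - g m) \<le> \<rho>"
      using close[OF mT(1) inK' mm] \<rho>(1) by linarith
    then have "the (y m) \<in> cball (g m) \<rho>" by (simp add: dist_norm norm_minus_commute)
    then have "the (y m) \<in> interior K" using tube[OF mT(1)] by auto
    moreover have "y m = Some (the (y m))" using inK'[OF mm] by auto
    ultimately have "y m \<in> Some ` interior K" by (metis imageI)
    with m(1) show False by (simp add: Z_def)
  qed
  have "y s \<in> Some ` K" if "s \<in> {0..T}" for s
    using stay[OF that] interior_subset by fastforce
  with close[of T t] stay[OF t] t T show ?thesis by auto
qed

section \<open>Existence of maximal solutions\<close>

lemma compact_neighbourhood:
  fixes K :: "'a::euclidean_space set"
  assumes K: "compact K" "K \<subseteq> U" and U: "open U"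
  obtains \<rho> N where "\<rho> > 0" "compact N" "N \<subseteq> U" "\<And>z. z \<in> K \<Longrightarrow> cball z \<rho> \<subseteq> N"
proof -
  obtain \<rho> where \<rho>: "\<rho> > 0" "(\<Union>z\<in>K. cball z \<rho>) \<subseteq> U"
    using compact_subset_open_imp_cball_epsilon_subset[OF K(1) U K(2)] by blast
  define N where "N = (\<Union>z\<in>K. cball z \<rho>)"
  have "N = {z + u | z u. z \<in> K \<and> u \<in> cball 0 \<rho>}"
  proof (intro set_eqI iffI)
    fix v assume "v \<in> N"
    then obtain z where "z \<in> K" "dist z v \<le> \<rho>" by (auto simp: N_def)
    then have "v = z + (v - z)" "z \<in> K" "v - z \<in> cball 0 \<rho>"
      by (auto simp: dist_norm norm_minus_commute)
    then show "v \<in> {z + u | z u. z \<in> K \<and> u \<in> cball 0 \<rho>}" by blast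
  next
    fix v assume "v \<in> {z + u | z u. z \<in> K \<and> u \<in> cball 0 \<rho>}"
    then obtain z u where "z \<in> K" "norm u \<le> \<rho>" "v = z + u" by auto
    then have "v \<in> cball z \<rho>" by (simp add: dist_norm)
    then show "v \<in> N" using \<open>z \<in> K\<close> unfolding N_def by blast
  qed
  then have N: "compact N" "N \<subseteq> U"
    using compact_sums[OF K(1) compact_cball[of 0 \<rho>]] \<rho> by (auto simp: N_def)
  show thesis by (rule that[OF \<rho>(1) N]) (auto simp: N_def)
qed

text \<open>
  The solution is a fixed point of a contraction of the functions with values in a ball around \<open>z\<close>.
  The point of the statement is that \<open>\<eta>\<close> depends on \<open>K\<close> only: a solution that is in \<open>K\<close> at some time
  survives for the time \<open>\<eta>\<close>, so a maximal solution that ends must leave every compact set.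
\<close>

lemma local_solution_uniform:
  fixes b :: "'a::euclidean_space \<Rightarrow> 'a" and w :: "real \<Rightarrow> 'a"
  assumes b: "locally_lipschitz_on U b" and U: "open U" and K: "compact K" "K \<subseteq> U"
    and w: "continuous_on {0..1} w"
  obtains \<eta> where "\<eta> > 0" "\<And>t z. \<lbrakk>t \<in> {0..1}; z \<in> K\<rbrakk> \<Longrightarrow>
    \<exists>v. continuous_on {t..min 1 (t + \<eta>)} v \<and> v ` {t..min 1 (t + \<eta>)} \<subseteq> U \<and>
      (\<forall>s\<in>{t..min 1 (t + \<eta>)}. v s = z + integral {t..s} (\<lambda>r. b (v r)) + (w s - w t))"
proof -
  obtain \<rho> N where \<rho>: "\<rho> > 0" and N: "compact N" "N \<subseteq> U"
    and tube: "\<And>z. z \<in> K \<Longrightarrow> cball z \<rho> \<subseteq> N"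
    using compact_neighbourhood[OF K U] by metis
  obtain C where C: "C-lipschitz_on N b" using b N unfolding locally_lipschitz_on_def by blast
  have C0: "0 \<le> C" using C by (rule lipschitz_on_nonneg)
  have b_cont: "continuous_on N b" using C by (rule lipschitz_on_continuous_on)
  have "bounded (b ` N)"
    using compact_continuous_image[OF b_cont N(1)] by (rule compact_imp_bounded)
  then obtain A where A: "A > 0" "\<And>z. z \<in> N \<Longrightarrow> norm (b z) \<le> A"
    unfolding bounded_pos by blast
  have "uniformly_continuous_on {0..1} w"
    using w by (rule compact_uniformly_continuous) simp
  then obtain d where d: "d > 0" "\<And>s s'. \<lbrakk>s \<in> {0..1}; s' \<in> {0..1}; dist s' s < d\<rbrakk> \<Longrightarrow> dist (w s') (w s) < \<rho> / 2"
    unfolding uniformly_continuous_on_def using \<rho> by (metis half_gt_zero)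
  \<comment> \<open>The drift and the noise each move the path by at most \<open>\<rho> / 2\<close>, and the contraction factor is \<open>1 / 2\<close>.\<close>
  define \<eta> where "\<eta> = min (d / 2) (min (\<rho> / (2 * A)) (1 / (2 * (C + 1))))"
  have \<eta>: "\<eta> > 0" "\<eta> < d" "A * \<eta> \<le> \<rho> / 2" "C * \<eta> \<le> 1 / 2"
  proof -
    show "\<eta> > 0" using d(1) \<rho> A(1) C0 by (simp add: \<eta>_def)
    show "\<eta> < d" using d(1) by (simp add: \<eta>_def min_less_iff_disj)
    have "A * \<eta> \<le> A * (\<rho> / (2 * A))" using A(1) by (intro mult_left_mono) (auto simp: \<eta>_def)
    then show "A * \<eta> \<le> \<rho> / 2" using A(1) by simp
    have "C * \<eta> \<le> C * (1 / (2 * (C + 1)))" using C0 by (intro mult_left_mono) (auto simp: \<eta>_def)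
    also have "\<dots> \<le> 1 / 2" using C0 by (simp add: field_simps)
    finally show "C * \<eta> \<le> 1 / 2" .
  qed
  show thesis
  proof (rule that[OF \<eta>(1)])
    fix t z assume t: "t \<in> {0..1::real}" and z: "z \<in> K"
    define t' where "t' = min 1 (t + \<eta>)"
    have t': "t \<le> t'" "t' \<le> 1" "t' - t \<le> \<eta>" using t \<eta>(1) by (auto simp: t'_def)
    \<comment> \<open>Freezing the time outside \<open>[t, t']\<close> allows the space of bounded continuous functions on the whole line.\<close>
    define c where "c s = max t (min t' s)" for s
    have c: "c s \<in> {t..t'}" for s using t' by (auto simp: c_def)
    have c_id: "c s = s" if "s \<in> {t..t'}" for s using that by (auto simp: c_def)
    have c01: "c s \<in> {0..1}" for s using c[of s] t t' by auto
    have c_cont: "continuous_on UNIV c" unfolding c_def by (intro continuous_intros)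
    define S where "S = PiC UNIV (\<lambda>_::real. cball z \<rho>)"
    have S_iff: "v \<in> S \<longleftrightarrow> (\<forall>s. apply_bcontfun v s \<in> cball z \<rho>)" for v
      by (simp add: S_def mem_PiC_iff Pi_iff)
    have S_N: "apply_bcontfun v s \<in> N" if "v \<in> S" for v s
      using that tube[OF z] by (auto simp: S_iff)
    have bv_cont: "continuous_on I (\<lambda>r. b (apply_bcontfun v r))" if "v \<in> S" for v I
      using S_N[OF that] by (intro continuous_on_compose2[OF b_cont]) auto
    define P where "P v s = z + integral {t..c s} (\<lambda>r. b (apply_bcontfun v r)) + (w (c s) - w t)" for v s
    have P_close: "dist z (P v s) \<le> \<rho>" if v: "v \<in> S" for v s
    proof -
      have "norm (integral {t..c s} (\<lambda>r. b (apply_bcontfun v r))) \<le> A * (c s - t)"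
        using c[of s] A(2) S_N[OF v] by (intro integral_bound bv_cont v) auto
      also have "\<dots> \<le> A * \<eta>" using c[of s] t' A(1) by (intro mult_left_mono) auto
      finally have "norm (integral {t..c s} (\<lambda>r. b (apply_bcontfun v r))) \<le> \<rho> / 2" using \<eta>(3) by linarith
      moreover have "dist (w (c s)) (w t) < \<rho> / 2"
        using c[of s] t t' \<eta>(2) by (intro d(2)) (auto simp: dist_real_def)
      moreover have "dist z (P v s) = norm (integral {t..c s} (\<lambda>r. b (apply_bcontfun v r)) + (w (c s) - w t))"
        unfolding P_def dist_norm by (subst norm_minus_commute) (simp add: algebra_simps)
      ultimately show ?thesis
        using norm_triangle_ineq[of "integral {t..c s} (\<lambda>r. b (apply_bcontfun v r))" "w (c s) - w t"]
        by (simp add: dist_norm)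
    qed
    have P_bcont: "P v \<in> bcontfun" if v: "v \<in> S" for v
    proof -
      have "continuous_on {t..t'} (\<lambda>s. integral {t..s} (\<lambda>r. b (apply_bcontfun v r)))"
        by (intro indefinite_integral_continuous_1 integrable_continuous_real bv_cont v)
      then have "continuous_on UNIV (\<lambda>s. integral {t..c s} (\<lambda>r. b (apply_bcontfun v r)))"
        by (rule continuous_on_compose2[OF _ c_cont]) (use c in auto)
      moreover have "continuous_on UNIV (\<lambda>s. w (c s))"
        by (rule continuous_on_compose2[OF w c_cont]) (use c01 in blast)
      ultimately have "continuous_on UNIV (P v)" unfolding P_def by (intro continuous_intros)
      moreover have "bounded (range (P v))"
        by (rule bounded_subset[OF bounded_cball[of z \<rho>]]) (use P_close[OF v] in auto)
      ultimately show ?thesis by (simp add: bcontfun_def)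
    qed
    define \<Phi> where "\<Phi> v = Bcontfun (P v)" for v
    have \<Phi>: "apply_bcontfun (\<Phi> v) = P v" if "v \<in> S" for v
      unfolding \<Phi>_def using P_bcont[OF that] by (rule Bcontfun_inverse)
    have "\<exists>!v\<in>S. \<Phi> v = v"
    proof (rule Banach_fix[of _ "1 / 2", OF complete_eq_closed[THEN iffD2]])
      show "closed S" unfolding S_def by (intro closed_PiC) auto
      have "const_bcontfun z \<in> S" using \<rho> by (simp add: S_iff const_bcontfun.rep_eq)
      then show "S \<noteq> {}" by blast
      show "\<Phi> ` S \<subseteq> S" using P_close \<Phi> by (auto simp: S_iff)
      fix v1 v2 assume v: "v1 \<in> S" "v2 \<in> S"
      show "dist (\<Phi> v1) (\<Phi> v2) \<le> 1 / 2 * dist v1 v2"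
      proof (rule dist_bound)
        fix s
        have "dist (P v1 s) (P v2 s) = norm (integral {t..c s} (\<lambda>r. b (apply_bcontfun v1 r) - b (apply_bcontfun v2 r)))"
          by (subst integral_diff) (auto simp: P_def dist_norm intro!: integrable_continuous_real bv_cont v)
        also have "\<dots> \<le> C * dist v1 v2 * (c s - t)"
        proof (rule integral_bound)
          show "continuous_on {t..c s} (\<lambda>r. b (apply_bcontfun v1 r) - b (apply_bcontfun v2 r))"
            by (intro continuous_intros bv_cont v)
          fix r
          have "norm (b (apply_bcontfun v1 r) - b (apply_bcontfun v2 r)) \<le> C * dist (apply_bcontfun v1 r) (apply_bcontfun v2 r)"
            using lipschitz_onD[OF C S_N[OF v(1)] S_N[OF v(2)]] by (simp add: dist_norm)
          also have "\<dots> \<le> C * dist v1 v2" using C0 by (intro mult_left_mono dist_bounded) 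
          finally show "norm (b (apply_bcontfun v1 r) - b (apply_bcontfun v2 r)) \<le> C * dist v1 v2" .
        qed (use c in auto)
        also have "\<dots> \<le> C * dist v1 v2 * \<eta>"
          using c[of s] t' C0 by (intro mult_left_mono) auto
        also have "\<dots> = (C * \<eta>) * dist v1 v2" by simp
        also have "\<dots> \<le> 1 / 2 * dist v1 v2" using \<eta>(4) by (intro mult_right_mono) auto
        finally show "dist (apply_bcontfun (\<Phi> v1) s) (apply_bcontfun (\<Phi> v2) s) \<le> 1 / 2 * dist v1 v2"
          by (simp add: \<Phi> v)
      qed
    qed auto
    then obtain v where v: "v \<in> S" "\<Phi> v = v" by blast
    have "apply_bcontfun v s = z + integral {t..s} (\<lambda>r. b (apply_bcontfun v r)) + (w s - w t)"
      if "s \<in> {t..t'}" for s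
      using \<Phi>[OF v(1)] v(2) c_id[OF that] by (metis P_def)
    moreover have "apply_bcontfun v ` {t..t'} \<subseteq> U" using S_N[OF v(1)] N(2) by auto
    ultimately show "\<exists>v. continuous_on {t..min 1 (t + \<eta>)} v \<and> v ` {t..min 1 (t + \<eta>)} \<subseteq> U \<and>
      (\<forall>s\<in>{t..min 1 (t + \<eta>)}. v s = z + integral {t..s} (\<lambda>r. b (v r)) + (w s - w t))"
      unfolding t'_def[symmetric] by (intro exI[of _ "apply_bcontfun v"]) auto
  qed
qed

text \<open>
  By uniqueness all solutions on intervals \<open>[0,t]\<close> are restrictions of one function \<open>g\<close> on their
  union \<open>D\<close>.  By \<open>local_solution_uniform\<close>, \<open>D\<close> is open in \<open>[0,1]\<close>, and \<open>g\<close> avoids each compact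
  set near the end of \<open>D\<close>; this makes \<open>g\<close>, sent to \<open>\<Delta>\<close> outside \<open>D\<close>, continuous.
\<close>

lemma maximal_solution_exists:
  fixes b :: "real^'d \<Rightarrow> real^'d" and w :: "real \<Rightarrow> real^'d"
  assumes b: "locally_lipschitz_on U b" and U: "open U" and x: "x \<in> U"
    and w: "continuous_on {0..1} w" "w 0 = 0"
  obtains g where "additive_solution U b w x g"
proof -
  define Sol where "Sol t h \<longleftrightarrow> continuous_on {0..t} h \<and> h ` {0..t} \<subseteq> U \<and>
    (\<forall>s\<in>{0..t}. h s = x + integral {0..s} (\<lambda>r. b (h r)) + w s)" for t h
  have b_cont: "continuous_on U b" using b U by (rule locally_lipschitz_on_imp_continuous_on)
  have Sol_mono: "Sol s h" if "Sol t h" "s \<le> t" for s t h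
    using that unfolding Sol_def by (auto intro: continuous_on_subset)
  have unique: "h1 s = h2 s" if h: "Sol t h1" "Sol t h2" and s: "s \<in> {0..t}" and t: "t \<le> 1" for h1 h2 t s
  proof -
    define K where "K = h1 ` {0..t} \<union> h2 ` {0..t}"
    have "continuous_on {0..t} h1" "continuous_on {0..t} h2" using h unfolding Sol_def by blast+
    then have "compact K" unfolding K_def by (intro compact_Un compact_continuous_image compact_Icc)
    have "K \<subseteq> U" using h unfolding K_def Sol_def by blast
    then obtain C where C: "C-lipschitz_on K b"
      using b \<open>compact K\<close> unfolding locally_lipschitz_on_def by blast
    have bK: "continuous_on K b" using b_cont \<open>K \<subseteq> U\<close> by (rule continuous_on_subset)
    have "norm (h1 s - h2 s) \<le> (0 + 0 + 0) * exp C"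
      by (rule solution_comparison[OF _ _ _ _ C bK bK _ _ _ _ _ t s, where ?W1.0 = w and ?W2.0 = w and x = x])
        (use h in \<open>auto simp: Sol_def K_def\<close>)
    then show ?thesis by simp
  qed
  define D where "D = {t. 0 \<le> t \<and> t \<le> 1 \<and> (\<exists>h. Sol t h)}"
  define g where "g = (\<lambda>t\<in>{0..1}. if t \<in> D then Some ((SOME h. Sol t h) t) else None)"
  have D_down: "s \<in> D" if "t \<in> D" "0 \<le> s" "s \<le> t" for s t
    using that Sol_mono unfolding D_def by fastforce
  have zero: "0 \<in> D"
    unfolding D_def Sol_def using x w by (auto intro!: exI[of _ "\<lambda>_. x"])
  have g_Sol: "g s = Some (h s)" if h: "Sol t h" and s: "0 \<le> s" "s \<le> t" "t \<le> 1" for h s t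
  proof -
    have "Sol s h" using Sol_mono h s by blast
    then have "Sol s (SOME h. Sol s h)" by (rule someI[of "Sol s"])
    then have "(SOME h. Sol s h) s = h s" using unique[OF _ \<open>Sol s h\<close>] s by auto
    moreover have "s \<in> D" using s \<open>Sol s h\<close> unfolding D_def by auto
    ultimately show ?thesis using s unfolding g_def by auto
  qed
  have g_None: "g s = None" if "s \<notin> D" "s \<in> {0..1}" for s using that by (simp add: g_def)
  have D_iff: "s \<in> D \<longleftrightarrow> g s \<noteq> None" if "s \<in> {0..1}" for s
    using that by (auto simp: g_def)
  define hh where "hh t = (SOME h. Sol t h)" for t
  have hh: "Sol t (hh t)" if "t \<in> D" for t
    using that someI_ex[of "Sol t"] unfolding D_def hh_def by blast
  \<comment> \<open>From a point of a given compact set the solution continues for a uniformly positive time.\<close>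
  have extend: "\<exists>\<eta>>0. \<forall>t\<in>D. g t \<in> Some ` K \<longrightarrow> min 1 (t + \<eta>) \<in> D"
    if K: "compact K" "K \<subseteq> U" for K
  proof -
    obtain \<eta> where \<eta>: "\<eta> > 0" "\<And>t z. \<lbrakk>t \<in> {0..1}; z \<in> K\<rbrakk> \<Longrightarrow>
      \<exists>v. continuous_on {t..min 1 (t + \<eta>)} v \<and> v ` {t..min 1 (t + \<eta>)} \<subseteq> U \<and>
      (\<forall>s\<in>{t..min 1 (t + \<eta>)}. v s = z + integral {t..s} (\<lambda>r. b (v r)) + (w s - w t))"
      using local_solution_uniform[OF b U K w(1)] by blast
    have "min 1 (t + \<eta>) \<in> D" if t: "t \<in> D" "g t \<in> Some ` K" for t
    proof -
      define h where "h = hh t"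
      have h: "Sol t h" using hh t(1) unfolding h_def by blast
      have t01: "t \<in> {0..1}" using t(1) by (auto simp: D_def)
      have "g t = Some (h t)" using g_Sol[OF h] t01 by auto
      then have "h t \<in> K" using t(2) by auto
      then obtain v where v: "continuous_on {t..min 1 (t + \<eta>)} v" "v ` {t..min 1 (t + \<eta>)} \<subseteq> U"
        "\<And>s. s \<in> {t..min 1 (t + \<eta>)} \<Longrightarrow> v s = h t + integral {t..s} (\<lambda>r. b (v r)) + (w s - w t)"
        using \<eta>(2)[OF t01] by blast
      define t' where "t' = min 1 (t + \<eta>)"
      have t': "t \<le> t'" "t' \<le> 1" "0 \<le> t" using t01 \<eta>(1) by (auto simp: t'_def)
      note v = v[folded t'_def]
      have vt: "v t = h t" using v(3)[of t] t' by simp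
      define h' where "h' s = (if s \<le> t then h s else v s)" for s
      have h'_v: "h' s = v s" if "s \<in> {t..t'}" for s using that vt by (auto simp: h'_def)
      have cont: "continuous_on {0..t'} h'"
      proof -
        have "continuous_on ({0..t} \<union> {t..t'}) h'"
          unfolding h'_def
        proof (rule continuous_on_If)
          show "continuous_on {0..t} h" using h unfolding Sol_def by blast
          show "continuous_on {t..t'} v" by (rule v(1))
          show "h s = v s" if "s \<in> {t..t'}" "s \<le> t" for s
          proof -
            have "s = t" using that by auto
            then show ?thesis using vt by simp
          qed
        qed auto
        moreover have "{0..t} \<union> {t..t'} = {0..t'}" using t' by auto
        ultimately show ?thesis by simp
      qed
      have val: "h' ` {0..t'} \<subseteq> U"
      proof
        fix z assume "z \<in> h' ` {0..t'}"
        then obtain s where s: "s \<in> {0..t'}" "z = h' s" by auto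
        then show "z \<in> U" using h v(2) unfolding h'_def Sol_def
          by (cases "s \<le> t") auto
      qed
      have "h' s = x + integral {0..s} (\<lambda>r. b (h' r)) + w s" if s: "s \<in> {0..t'}" for s
      proof (cases "s \<le> t")
        case True
        have "integral {0..s} (\<lambda>r. b (h' r)) = integral {0..s} (\<lambda>r. b (h r))"
          using True by (intro integral_cong) (auto simp: h'_def)
        then show ?thesis using True s h by (auto simp: Sol_def h'_def)
      next
        case False
        have "(\<lambda>r. b (h' r)) integrable_on {0..s}"
          using val s by (intro integrable_continuous_real continuous_on_compose2[OF b_cont]
            continuous_on_subset[OF cont]) auto
        then have "integral {0..s} (\<lambda>r. b (h' r)) = integral {0..t} (\<lambda>r. b (h' r)) + integral {t..s} (\<lambda>r. b (h' r))"
          using False t' by (intro Henstock_Kurzweil_Integration.integral_combine[symmetric]) auto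
        also have "integral {0..t} (\<lambda>r. b (h' r)) = integral {0..t} (\<lambda>r. b (h r))"
          by (intro integral_cong) (auto simp: h'_def)
        also have "integral {t..s} (\<lambda>r. b (h' r)) = integral {t..s} (\<lambda>r. b (v r))"
          using s by (intro integral_cong) (auto simp: h'_v)
        finally have "x + integral {0..s} (\<lambda>r. b (h' r)) + w s = (x + integral {0..t} (\<lambda>r. b (h r)) + w t)
            + integral {t..s} (\<lambda>r. b (v r)) + (w s - w t)" by simp
        also have "x + integral {0..t} (\<lambda>r. b (h r)) + w t = h t"
          using h t' unfolding Sol_def by auto
        also have "h t + integral {t..s} (\<lambda>r. b (v r)) + (w s - w t) = v s"
          using v(3)[of s] s False by auto
        also have "v s = h' s" using False by (simp add: h'_def)
        finally show ?thesis by simp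
      qed
      with cont val have "Sol t' h'" unfolding Sol_def by blast
      then show ?thesis using t' unfolding D_def t'_def[symmetric] by auto
    qed
    with \<eta>(1) show ?thesis by blast
  qed
  have g_val: "g s \<in> insert None (Some ` U)" if "s \<in> {0..1}" for s
  proof (cases "s \<in> D")
    case True
    then have "g s = Some (hh s s)" "hh s s \<in> U" using g_Sol[OF hh[OF True], of s] hh[OF True] that
      by (auto simp: Sol_def)
    then show ?thesis by auto
  qed (use g_None that in auto)
  \<comment> \<open>\<open>D\<close> is open in \<open>[0,1]\<close>: near each of its points, \<open>g\<close> is given by one solution that reaches further.\<close>
  have continues: "\<exists>t\<in>D. s \<le> t \<and> (s < t \<or> t = 1)" if s: "s \<in> D" for s
  proof -
    have s01: "s \<in> {0..1}" using s by (auto simp: D_def)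
    obtain z where z: "g s = Some z" "z \<in> U" using g_val[OF s01] D_iff[OF s01] s by auto
    obtain \<eta> where "\<eta> > 0" "min 1 (s + \<eta>) \<in> D" using extend[of "{z}"] z s by auto
    then show ?thesis using s01 by (intro bexI[of _ "min 1 (s + \<eta>)"]) auto
  qed
  have g_path: "g \<in> path_space 1 U"
  proof (rule path_spaceI[OF _ g_val _ _ _ U])
    show "g \<in> extensional {0..1}" by (simp add: g_def)
    show "g s \<noteq> None" if "0 \<le> s" "s \<le> u" "u \<le> 1" "g u \<noteq> None" for s u
      using D_down[of u s] D_iff[of u] D_iff[of s] that by auto
    show "openin (top_of_set {0..1}) {s \<in> {0..1}. g s \<in> Some ` W}" if W: "open W" "W \<subseteq> U" for W
    proof (subst openin_subopen, intro ballI)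
      fix s assume "s \<in> {s \<in> {0..1}. g s \<in> Some ` W}"
      then have s: "s \<in> {0..1}" "g s \<in> Some ` W" by auto
      then have "s \<in> D" using D_iff by auto
      then obtain t where t: "t \<in> D" "s \<le> t" "s < t \<or> t = 1" using continues by blast
      have h: "Sol t (hh t)" using hh t(1) by blast
      have t1: "0 \<le> t" "t \<le> 1" using t(1) by (auto simp: D_def)
      obtain A where A: "open A" "A \<inter> {0..t} = hh t -` W \<inter> {0..t}"
        using h W(1) unfolding Sol_def continuous_on_open_invariant by blast
      define A' where "A' = A \<inter> (if t = 1 then UNIV else {..<t})"
      have oA: "open A'" unfolding A'_def using A(1) by auto
      have gA: "g u = Some (hh t u)" if "u \<in> {0..t}" for u
        using g_Sol[OF h] that t1 by auto
      have "s \<in> A'"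
      proof -
        have st: "s \<in> {0..t}" using s(1) t(2) by simp
        then have "hh t s \<in> W" using s(2) gA[OF st] by auto
        then have "s \<in> A" using A(2) st by blast
        then show ?thesis using t(3) unfolding A'_def by auto
      qed
      moreover have "{0..1} \<inter> A' \<subseteq> {s \<in> {0..1}. g s \<in> Some ` W}"
      proof
        fix u assume u: "u \<in> {0..1} \<inter> A'"
        then have u': "u \<in> {0..t}" "u \<in> A" by (auto simp: A'_def split: if_splits)
        then have "hh t u \<in> W" using A(2) by blast
        then have "g u \<in> Some ` W" unfolding gA[OF u'(1)] by (rule imageI)
        then show "u \<in> {s \<in> {0..1}. g s \<in> Some ` W}" using u by blast
      qed
      ultimately show "\<exists>T. openin (top_of_set {0..1}) T \<and> s \<in> T \<and> T \<subseteq> {s \<in> {0..1}. g s \<in> Some ` W}"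
        using s(1) openin_open_Int[OF oA, of "{0..1}"] by blast
    qed
    show "closed {s \<in> {0..1}. g s \<in> Some ` K}" if K: "compact K" "K \<subseteq> U" for K
      unfolding closed_sequential_limits
    proof (intro allI impI, elim conjE)
      fix u s assume u: "\<forall>n. u n \<in> {s \<in> {0..1}. g s \<in> Some ` K}" and lim: "u \<longlonglongrightarrow> s"
      have s01: "s \<in> {0..1}" using u lim closed_sequentially[of "{0..1}" u s] by auto
      obtain \<eta> where \<eta>: "\<eta> > 0" "\<And>t. \<lbrakk>t \<in> D; g t \<in> Some ` K\<rbrakk> \<Longrightarrow> min 1 (t + \<eta>) \<in> D"
        using extend[OF K] by blast
      have uD: "u n \<in> D" for n using u D_iff by fastforce
      obtain n where "\<bar>u n - s\<bar> < \<eta>"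
        using LIMSEQ_D[OF lim \<eta>(1)] by auto
      then have sle: "s \<le> min 1 (u n + \<eta>)" using s01 by auto
      define t where "t = min 1 (u n + \<eta>)"
      have tD: "t \<in> D" unfolding t_def using \<eta>(2) uD u by blast
      then have sD: "s \<in> D" using D_down sle s01 by (auto simp: t_def)
      obtain t2 where t2: "t2 \<in> D" "s \<le> t2" "s < t2 \<or> t2 = 1" using continues[OF sD] by blast
      have h: "Sol t2 (hh t2)" using hh t2(1) by blast
      have t21: "0 \<le> t2" "t2 \<le> 1" using t2(1) by (auto simp: D_def)
      have ev: "eventually (\<lambda>n. u n \<in> {0..t2}) sequentially"
      proof (cases "t2 = 1")
        case True then show ?thesis using u by (intro always_eventually) auto
      next
        case False
        then have "eventually (\<lambda>n. u n < t2) sequentially" using t2 order_tendstoD(2)[OF lim] by blast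
        then show ?thesis by eventually_elim (use u in auto)
      qed
      have "(\<lambda>n. hh t2 (u n)) \<longlonglongrightarrow> hh t2 s"
        by (rule continuous_on_tendsto_compose[of "{0..t2}" "hh t2", OF _ lim _ ev])
          (use h s01 t2 in \<open>auto simp: Sol_def\<close>)
      moreover have "eventually (\<lambda>n. hh t2 (u n) \<in> K) sequentially"
        using ev
      proof eventually_elim
        case (elim n)
        have "g (u n) = Some (hh t2 (u n))" using g_Sol[OF h, of "u n"] elim t21 by auto
        moreover have "g (u n) \<in> Some ` K" using u by blast
        ultimately show ?case by auto
      qed
      ultimately have "hh t2 s \<in> K"
        using Lim_in_closed_set[of K] compact_imp_closed[OF K(1)] by fastforce
      moreover have "g s = Some (hh t2 s)" using g_Sol[OF h, of s] s01 t2 t21 by auto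
      ultimately show "s \<in> {s \<in> {0..1}. g s \<in> Some ` K}" using s01 by auto
    qed
  qed auto
  have "additive_solution U b w x g"
    unfolding additive_solution_def
  proof (intro conjI ballI impI)
    have "Sol 0 (hh 0)" using hh zero by blast
    then have "hh 0 0 = x" "g 0 = Some (hh 0 0)"
      using g_Sol[of 0 "hh 0" 0] w(2) by (auto simp: Sol_def)
    then show "g \<in> path_space_from 1 U x" using g_path by (simp add: path_space_from_def)
    fix t assume t: "t \<in> {0..1::real}" "ereal t < exit_time 1 g"
    then have "t \<in> D" using less_exit_time_iff[OF g_path U t(1)] D_iff by auto
    then have h: "Sol t (hh t)" by (rule hh)
    have gt: "the (g s) = hh t s" if "s \<in> {0..t}" for s
      using g_Sol[OF h, of s] that t by auto
    have "continuous_on {0..t} (\<lambda>s. b (hh t s))"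
      using h unfolding Sol_def by (intro continuous_on_compose2[OF b_cont]) auto
    then have "set_integrable lborel {0..t} (\<lambda>s. b (hh t s))"
      by (rule borel_integrable_atLeastAtMost')
    then have "(LINT s:{0..t}|lborel. b (hh t s)) = integral {0..t} (\<lambda>s. b (hh t s))"
      by (rule set_borel_integral_eq_integral)
    moreover have "(LINT s:{0..t}|lborel. b (the (g s))) = (LINT s:{0..t}|lborel. b (hh t s))"
      using gt by (intro set_lebesgue_integral_cong) auto
    moreover have "hh t t = x + integral {0..t} (\<lambda>s. b (hh t s)) + w t"
      using h t(1) unfolding Sol_def by auto
    ultimately show "the (g t) = x + (LINT s:{0..t}|lborel. b (the (g s))) + w t"
      using gt[of t] t(1) by auto
  qed
  then show thesis by (rule that)
qed

section \<open>Moduli of continuity by dyadic chaining\<close>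

lemma dyadic_floor:
  fixes t :: real
  assumes t: "t \<in> {0..1}"
  shows "real (nat \<lfloor>2 ^ l * t\<rfloor>) \<le> 2 ^ l * t" "2 ^ l * t < real (nat \<lfloor>2 ^ l * t\<rfloor>) + 1"
    and "nat \<lfloor>2 ^ l * t\<rfloor> \<le> 2 ^ l" "real (nat \<lfloor>2 ^ l * t\<rfloor>) / 2 ^ l \<in> {0..1}"
    and "(\<lambda>l. real (nat \<lfloor>2 ^ l * t\<rfloor>) / 2 ^ l) \<longlonglongrightarrow> t"
proof -
  have floor: "real (nat \<lfloor>2 ^ l * t\<rfloor>) \<le> 2 ^ l * t" "2 ^ l * t < real (nat \<lfloor>2 ^ l * t\<rfloor>) + 1" for l
  proof -
    have "0 \<le> 2 ^ l * t" using t by auto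
    then show "real (nat \<lfloor>2 ^ l * t\<rfloor>) \<le> 2 ^ l * t" "2 ^ l * t < real (nat \<lfloor>2 ^ l * t\<rfloor>) + 1" by linarith+
  qed
  show "real (nat \<lfloor>2 ^ l * t\<rfloor>) \<le> 2 ^ l * t" "2 ^ l * t < real (nat \<lfloor>2 ^ l * t\<rfloor>) + 1" by (rule floor)+
  have "2 ^ l * t \<le> 2 ^ l" using t mult_left_le[of t "2 ^ l :: real"] by simp
  with floor(1)[of l] have le: "real (nat \<lfloor>2 ^ l * t\<rfloor>) \<le> (2::real) ^ l" by linarith
  then show "nat \<lfloor>2 ^ l * t\<rfloor> \<le> 2 ^ l" by (metis of_nat_le_iff of_nat_numeral of_nat_power)
  from le show "real (nat \<lfloor>2 ^ l * t\<rfloor>) / 2 ^ l \<in> {0..1}" by simp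
  have "norm (real (nat \<lfloor>2 ^ p * t\<rfloor>) / 2 ^ p - t) \<le> (1 / 2) ^ p" for p
  proof -
    have "\<bar>real (nat \<lfloor>2 ^ p * t\<rfloor>) - 2 ^ p * t\<bar> \<le> 1" using floor[of p] by linarith
    then have "\<bar>real (nat \<lfloor>2 ^ p * t\<rfloor>) - 2 ^ p * t\<bar> / 2 ^ p \<le> 1 / 2 ^ p" by (intro divide_right_mono) auto
    moreover have "real (nat \<lfloor>2 ^ p * t\<rfloor>) / 2 ^ p - t = (real (nat \<lfloor>2 ^ p * t\<rfloor>) - 2 ^ p * t) / 2 ^ p"
      by (simp add: field_simps)
    ultimately show ?thesis by (simp add: power_divide)
  qed
  then have "(\<lambda>p. real (nat \<lfloor>2 ^ p * t\<rfloor>) / 2 ^ p - t) \<longlonglongrightarrow> 0"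
    by (intro Lim_null_comparison[OF _ LIMSEQ_power_zero[of "1 / 2 :: real"]]) auto
  then show "(\<lambda>l. real (nat \<lfloor>2 ^ l * t\<rfloor>) / 2 ^ l) \<longlonglongrightarrow> t" by (simp add: LIM_zero_iff)
qed

text \<open>
  Chaining: going from the level-\<open>m\<close> dyadic point below \<open>t\<close> to \<open>t\<close> itself takes at most one step on each
  finer level, at a total cost of \<open>A \<Sum>\<^bsub>l > m\<^esub> (3/4)\<^sup>l = 3 A (3/4)\<^sup>m\<close>.  Two points at distance at most
  \<open>2\<^bsup>-m\<^esup>\<close> are joined by two such chains and at most one step on level \<open>m\<close>.
\<close>

lemma dyadic_increments_imp_modulus:
  fixes X :: "real \<Rightarrow> 'a::real_normed_vector"
  assumes cont: "continuous_on {0..1} X" and A: "0 \<le> A"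
    and incr: "\<And>m i. i < 2 ^ m \<Longrightarrow> norm (X ((real i + 1) / 2 ^ m) - X (real i / 2 ^ m)) \<le> A * (3 / 4) ^ m"
    and st: "s \<in> {0..1}" "t \<in> {0..1}" "\<bar>s - t\<bar> \<le> 1 / 2 ^ m"
  shows "norm (X s - X t) \<le> 7 * A * (3 / 4) ^ m"
proof -
  define k where "k l t = nat \<lfloor>2 ^ l * t\<rfloor>" for l and t :: real
  define d where "d l t = real (k l t) / 2 ^ l" for l t
  note k = dyadic_floor(1-3)[folded k_def]
  note d01 = dyadic_floor(4)[folded k_def, folded d_def]
  have step: "norm (X (d (Suc l) t) - X (d l t)) \<le> A * (3 / 4) ^ Suc l" if t: "t \<in> {0..1}" for l t
  proof -
    have "real (2 * k l t) < real (k (Suc l) t) + 1" "real (k (Suc l) t) < real (2 * k l t + 2)"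
      using k(1,2)[OF t, of l] k(1,2)[OF t, of "Suc l"] by auto
    then have "2 * k l t < k (Suc l) t + 1" "k (Suc l) t < 2 * k l t + 2" by linarith+
    then consider "k (Suc l) t = 2 * k l t" | "k (Suc l) t = 2 * k l t + 1" by linarith
    then show ?thesis
    proof cases
      case 1
      then have "d (Suc l) t = d l t" by (simp add: d_def)
      then show ?thesis using A by simp
    next
      case 2
      then have "d (Suc l) t = (real (2 * k l t) + 1) / 2 ^ Suc l" "d l t = real (2 * k l t) / 2 ^ Suc l"
        by (simp_all add: d_def)
      moreover have "2 * k l t < 2 ^ Suc l" using k(3)[OF t, of "Suc l"] 2 by linarith
      ultimately show ?thesis using incr[of "2 * k l t" "Suc l"] by simp
    qed
  qed
  have chain: "norm (X (d (l + n) t) - X (d l t)) \<le> 3 * A * (3 / 4) ^ l - 3 * A * (3 / 4) ^ (l + n)"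
    if t: "t \<in> {0..1}" for l n t
  proof (induction n)
    case (Suc n)
    have "norm (X (d (l + Suc n) t) - X (d l t))
        \<le> norm (X (d (Suc (l + n)) t) - X (d (l + n) t)) + norm (X (d (l + n) t) - X (d l t))"
      using norm_triangle_ineq[of "X (d (Suc (l + n)) t) - X (d (l + n) t)" "X (d (l + n) t) - X (d l t)"]
      by simp
    also have "\<dots> \<le> A * (3 / 4) ^ Suc (l + n) + (3 * A * (3 / 4) ^ l - 3 * A * (3 / 4) ^ (l + n))"
      by (intro add_mono step t Suc.IH)
    also have "\<dots> = 3 * A * (3 / 4) ^ l - 3 * A * (3 / 4) ^ (l + Suc n)" by simp
    finally show ?case .
  qed simp
  have approx: "norm (X t - X (d l t)) \<le> 3 * A * (3 / 4) ^ l" if t: "t \<in> {0..1}" for l t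
  proof -
    have lim: "(\<lambda>n. d (l + n) t) \<longlonglongrightarrow> t"
      using LIMSEQ_ignore_initial_segment[OF dyadic_floor(5)[OF t], of l] by (simp add: d_def k_def add.commute)
    have "(\<lambda>n. X (d (l + n) t)) \<longlonglongrightarrow> X t"
      by (rule continuous_on_tendsto_compose[OF cont lim t]) (use d01 t in auto)
    then have "(\<lambda>n. norm (X (d (l + n) t) - X (d l t))) \<longlonglongrightarrow> norm (X t - X (d l t))"
      by (intro tendsto_intros)
    then show ?thesis
    proof (rule LIMSEQ_le_const2, intro exI allI impI)
      fix n
      have "0 \<le> 3 * A * (3 / 4) ^ (l + n)" using A by simp
      then show "norm (X (d (l + n) t) - X (d l t)) \<le> 3 * A * (3 / 4) ^ l" using chain[OF t, of l n] by linarith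
    qed
  qed
  have neighbours: "norm (X (d m s) - X (d m t)) \<le> A * (3 / 4) ^ m"
  proof -
    have "\<bar>2 ^ m * s - 2 ^ m * t\<bar> \<le> 1"
    proof -
      have "\<bar>2 ^ m * s - 2 ^ m * t\<bar> = 2 ^ m * \<bar>s - t\<bar>"
        by (simp add: abs_mult flip: right_diff_distrib)
      then show ?thesis using st(3) by (simp add: field_simps)
    qed
    then have "\<bar>real (k m s) - real (k m t)\<bar> < 2"
      using k(1,2)[OF st(1), of m] k(1,2)[OF st(2), of m] by linarith
    then consider "k m s = k m t" | "k m s = k m t + 1" | "k m t = k m s + 1" by linarith
    then show ?thesis
    proof cases
      case 1 then show ?thesis using A by (simp add: d_def)
    next
      case 2
      then have "k m t < 2 ^ m" using k(3)[OF st(1), of m] by linarith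
      from incr[OF this] 2 show ?thesis by (simp add: d_def add.commute)
    next
      case 3
      then have "k m s < 2 ^ m" using k(3)[OF st(2), of m] by linarith
      from incr[OF this] 3 show ?thesis by (simp add: d_def add.commute norm_minus_commute)
    qed
  qed
  have "X s - X t = (X s - X (d m s)) + (X (d m s) - X (d m t)) - (X t - X (d m t))" by simp
  then have "norm (X s - X t) \<le> norm (X s - X (d m s)) + norm (X (d m s) - X (d m t)) + norm (X t - X (d m t))"
    using norm_triangle_ineq4[of "(X s - X (d m s)) + (X (d m s) - X (d m t))" "X t - X (d m t)"]
      norm_triangle_ineq[of "X s - X (d m s)" "X (d m s) - X (d m t)"] by simp
  also have "\<dots> \<le> 3 * A * (3 / 4) ^ m + A * (3 / 4) ^ m + 3 * A * (3 / 4) ^ m"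
    by (intro add_mono approx neighbours st)
  finally show ?thesis by simp
qed

section \<open>Functions of bounded dyadic energy\<close>

text \<open>
  Indexing by a floor, rather than as a sum of indicators, makes the passage to a refined partition
  a mere integer division of the index.
\<close>

definition step_function :: "nat \<Rightarrow> (nat \<Rightarrow> 'a::real_vector) \<Rightarrow> real \<Rightarrow> 'a" where
  "step_function n G s = (if s \<in> {0..<1} then G (nat \<lfloor>real n * s\<rfloor>) else 0)"

lemma step_index:
  assumes "0 < n" "0 \<le> s"
  shows "nat \<lfloor>real n * s\<rfloor> = i \<longleftrightarrow> s \<in> {real i / real n..<(real i + 1) / real n}"
proof -
  have "0 \<le> real n * s" using assms by simp
  then have "nat \<lfloor>real n * s\<rfloor> = i \<longleftrightarrow> \<lfloor>real n * s\<rfloor> = int i" by linarith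
  also have "\<dots> \<longleftrightarrow> real i \<le> real n * s \<and> real n * s < real i + 1"
    by (simp add: floor_eq_iff)
  also have "\<dots> \<longleftrightarrow> s \<in> {real i / real n..<(real i + 1) / real n}"
    using assms by (auto simp: field_simps)
  finally show ?thesis .
qed

lemma step_function_sum:
  assumes n: "0 < n"
  shows "step_function n G s = (\<Sum>i<n. indicator {real i / real n..<(real i + 1) / real n} s *\<^sub>R G i)"
proof (cases "s \<in> {0..<1}")
  case True
  define j where "j = nat \<lfloor>real n * s\<rfloor>"
  have "\<lfloor>real n * s\<rfloor> < int n"
    using True n by (simp add: floor_less_iff)
  then have j: "j < n" using n by (auto simp: j_def)
  have "(\<Sum>i<n. indicator {real i / real n..<(real i + 1) / real n} s *\<^sub>R G i) = (\<Sum>i<n. if j = i then G i else 0)"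
    using True step_index[OF n, of s] by (intro sum.cong) (auto simp: j_def indicator_def)
  also have "\<dots> = G j" using j by (simp add: sum.delta')
  finally show ?thesis using True by (simp add: step_function_def j_def)
next
  case False
  have "s \<notin> {real i / real n..<(real i + 1) / real n}" if "i < n" for i
  proof
    assume s: "s \<in> {real i / real n..<(real i + 1) / real n}"
    have "0 \<le> real i / real n" by simp
    then have "0 \<le> s" using s by (simp add: order_trans[of 0 "real i / real n" s])
    moreover have "(real i + 1) / real n \<le> 1" using that n by (simp add: field_simps)
    then have "s < 1" using s by auto
    ultimately show False using False by simp
  qed
  then show ?thesis using False by (auto simp: step_function_def)
qed

lemma has_bochner_integral_step_function:
  fixes G :: "nat \<Rightarrow> 'a::{banach, second_countable_topology}"
  assumes n: "0 < n"
  shows "has_bochner_integral lborel (step_function n G) ((1 / real n) *\<^sub>R (\<Sum>i<n. G i))"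
proof -
  have "has_bochner_integral lborel (\<lambda>s. indicator {real i / real n..<(real i + 1) / real n} s *\<^sub>R G i)
      ((1 / real n) *\<^sub>R G i)" for i
  proof -
    have "measure lborel {real i / real n..<(real i + 1) / real n} = 1 / real n"
      using n by (subst measure_lborel_Ico) (auto simp: field_simps)
    moreover have "emeasure lborel {real i / real n..<(real i + 1) / real n} < \<infinity>"
      using n by (subst emeasure_lborel_Ico) (auto simp: field_simps)
    ultimately have "has_bochner_integral lborel (indicator {real i / real n..<(real i + 1) / real n} :: real \<Rightarrow> real) (1 / real n)"
      using has_bochner_integral_real_indicator[of "{real i / real n..<(real i + 1) / real n}" lborel] by simp
    then show ?thesis by (rule has_bochner_integral_scaleR_left)
  qed
  then have "has_bochner_integral lborel (\<lambda>s. \<Sum>i<n. indicator {real i / real n..<(real i + 1) / real n} s *\<^sub>R G i)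
      (\<Sum>i<n. (1 / real n) *\<^sub>R G i)"
    by (intro has_bochner_integral_sum) auto
  moreover have "(\<lambda>s. \<Sum>i<n. indicator {real i / real n..<(real i + 1) / real n} s *\<^sub>R G i) = step_function n G"
    by (intro ext) (rule step_function_sum[OF n, symmetric])
  ultimately show ?thesis by (simp add: scaleR_right.sum)
qed

lemma step_function_refine:
  assumes n: "0 < n" and m: "0 < m"
  shows "step_function n G = step_function (n * m) (\<lambda>i. G (i div m))"
proof
  fix s
  show "step_function n G s = step_function (n * m) (\<lambda>i. G (i div m)) s"
  proof (cases "s \<in> {0..<1}")
    case True
    have "\<lfloor>real n * s\<rfloor> = \<lfloor>(real (n * m) * s) / real_of_int (int m)\<rfloor>" using m by simp
    also have "\<dots> = \<lfloor>real (n * m) * s\<rfloor> div int m" by (rule floor_divide_real_eq_div) simp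
    finally have "nat \<lfloor>real n * s\<rfloor> = nat \<lfloor>real (n * m) * s\<rfloor> div m"
      by (metis nat_div_distrib' nat_int of_nat_0_le_iff)
    then show ?thesis using True by (simp add: step_function_def)
  qed (auto simp: step_function_def)
qed

definition increment :: "nat \<Rightarrow> (real \<Rightarrow> 'a::real_vector) \<Rightarrow> nat \<Rightarrow> 'a" where
  "increment n f i = f ((real i + 1) / real n) - f (real i / real n)"

text \<open>
  This is \<open>1/2 \<integral> \<bar>f\<^sub>n'\<bar>\<^sup>2\<close> for the piecewise linear interpolation \<open>f\<^sub>n\<close> of \<open>f\<close> at the multiples of \<open>1/n\<close>.
\<close>

definition step_energy :: "nat \<Rightarrow> (real \<Rightarrow> 'a::real_inner) \<Rightarrow> real" where
  "step_energy n f = real n / 2 * (\<Sum>i<n. (norm (increment n f i))\<^sup>2)"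

text \<open>The derivative of the piecewise linear interpolation of \<open>f\<close> at the multiples of \<open>1/n\<close>.\<close>

definition slope :: "nat \<Rightarrow> (real \<Rightarrow> 'a::real_vector) \<Rightarrow> real \<Rightarrow> 'a" where
  "slope n f = step_function n (\<lambda>i. real n *\<^sub>R increment n f i)"

lemma sum_increment_lessThan: "(\<Sum>i<j. increment n f i) = f (real j / real n) - f 0"
  by (induction j) (simp_all add: increment_def add.commute)

lemma sum_increment_block:
  assumes m: "0 < m"
  shows "(\<Sum>i=j * m..<j * m + m. increment (n * m) f i) = increment n f j"
proof -
  have "(\<Sum>i=j * m..<j * m + l. increment (n * m) f i)
      = f (real (j * m + l) / real (n * m)) - f (real (j * m) / real (n * m))" for l
    by (induction l) (simp_all add: increment_def add.commute add.left_commute)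
  from this[of m] have "(\<Sum>i=j * m..<j * m + m. increment (n * m) f i)
      = f (real (j * m + m) / real (n * m)) - f (real (j * m) / real (n * m))" .
  also have "real (j * m + m) / real (n * m) = (real j + 1) / real n"
  proof -
    have "real (j * m + m) = (real j + 1) * real m" by (simp add: algebra_simps)
    then show ?thesis using m by simp
  qed
  also have "real (j * m) / real (n * m) = real j / real n" using m by simp
  finally show ?thesis by (simp add: increment_def)
qed

text \<open>
  The mean of the fine slopes over a coarse interval is the coarse slope, so the difference of the
  two slopes is orthogonal to the coarse one and the identity is Pythagoras' theorem.
\<close>

lemma slope_difference_square:
  fixes f :: "real \<Rightarrow> 'a::{real_inner, banach, second_countable_topology}"
  assumes n: "0 < n" and m: "0 < m"
  shows "has_bochner_integral lborel (\<lambda>s. (norm (slope (n * m) f s - slope n f s))\<^sup>2)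
      (2 * (step_energy (n * m) f - step_energy n f))"
    and "has_bochner_integral lborel (\<lambda>s. norm (slope (n * m) f s - slope n f s))
      (1 / real (n * m) * (\<Sum>i<n * m. norm (real (n * m) *\<^sub>R increment (n * m) f i - real n *\<^sub>R increment n f (i div m))))"
proof -
  define N where "N = n * m"
  have N: "0 < N" using n m by (simp add: N_def)
  define a where "a i = increment N f i" for i
  define c where "c j = increment n f j" for j
  define G where "G i = real N *\<^sub>R a i - real n *\<^sub>R c (i div m)" for i
  have diff: "slope N f s - slope n f s = step_function N G s" for s
    unfolding slope_def step_function_refine[OF n m, folded N_def]
    by (simp add: step_function_def G_def a_def c_def)
  have "has_bochner_integral lborel (step_function N (\<lambda>i. norm (G i))) ((1 / real N) *\<^sub>R (\<Sum>i<N. norm (G i)))"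
    by (rule has_bochner_integral_step_function[OF N])
  moreover have "step_function N (\<lambda>i. norm (G i)) = (\<lambda>s. norm (slope N f s - slope n f s))"
    by (auto simp: diff step_function_def)
  ultimately show "has_bochner_integral lborel (\<lambda>s. norm (slope (n * m) f s - slope n f s))
      (1 / real (n * m) * (\<Sum>i<n * m. norm (real (n * m) *\<^sub>R increment (n * m) f i - real n *\<^sub>R increment n f (i div m))))"
    by (simp add: N_def G_def a_def c_def)
  have "has_bochner_integral lborel (step_function N (\<lambda>i. (norm (G i))\<^sup>2)) ((1 / real N) *\<^sub>R (\<Sum>i<N. (norm (G i))\<^sup>2))"
    by (rule has_bochner_integral_step_function[OF N])
  moreover have "step_function N (\<lambda>i. (norm (G i))\<^sup>2) = (\<lambda>s. (norm (slope N f s - slope n f s))\<^sup>2)"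
    by (auto simp: diff step_function_def)
  moreover have "(1 / real N) *\<^sub>R (\<Sum>i<N. (norm (G i))\<^sup>2) = 2 * (step_energy N f - step_energy n f)"
  proof -
    have blocks: "(\<Sum>i<N. F i) = (\<Sum>j<n. \<Sum>i=j * m..<j * m + m. F i)" for F :: "nat \<Rightarrow> real"
      unfolding N_def by (rule sum.nat_group[symmetric])
    have div: "i div m = j" if "i \<in> {j * m..<j * m + m}" for i j
      using that by (intro div_nat_eqI) (auto simp: mult.commute)
    have "(\<Sum>i<N. (norm (G i))\<^sup>2) = (\<Sum>i<N. (real N)\<^sup>2 * (norm (a i))\<^sup>2 - 2 * real N * real n * (a i \<bullet> c (i div m))
        + (real n)\<^sup>2 * (norm (c (i div m)))\<^sup>2)"
      unfolding G_def power2_norm_eq_inner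
      by (intro sum.cong refl)
        (simp add: inner_diff_left inner_diff_right inner_commute power2_eq_square algebra_simps)
    also have "\<dots> = (real N)\<^sup>2 * (\<Sum>i<N. (norm (a i))\<^sup>2) - 2 * real N * real n * (\<Sum>i<N. a i \<bullet> c (i div m))
        + (real n)\<^sup>2 * (\<Sum>i<N. (norm (c (i div m)))\<^sup>2)"
      by (simp add: sum.distrib sum_subtractf sum_distrib_left)
    also have "(\<Sum>i<N. a i \<bullet> c (i div m)) = (\<Sum>j<n. (norm (c j))\<^sup>2)"
    proof -
      have "(\<Sum>i=j * m..<j * m + m. a i \<bullet> c (i div m)) = (norm (c j))\<^sup>2" for j
      proof -
        have "(\<Sum>i=j * m..<j * m + m. a i \<bullet> c (i div m)) = (\<Sum>i=j * m..<j * m + m. a i \<bullet> c j)"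
          by (intro sum.cong refl) (simp add: div)
        also have "\<dots> = (\<Sum>i=j * m..<j * m + m. a i) \<bullet> c j" by (simp add: inner_sum_left)
        also have "(\<Sum>i=j * m..<j * m + m. a i) = c j"
          unfolding a_def N_def c_def by (rule sum_increment_block[OF m])
        finally show ?thesis by (simp add: power2_norm_eq_inner)
      qed
      then show ?thesis by (simp add: blocks)
    qed
    also have "(\<Sum>i<N. (norm (c (i div m)))\<^sup>2) = real m * (\<Sum>j<n. (norm (c j))\<^sup>2)"
    proof -
      have "(\<Sum>i=j * m..<j * m + m. (norm (c (i div m)))\<^sup>2) = real m * (norm (c j))\<^sup>2" for j
      proof -
        have "(\<Sum>i=j * m..<j * m + m. (norm (c (i div m)))\<^sup>2) = (\<Sum>i=j * m..<j * m + m. (norm (c j))\<^sup>2)"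
          by (intro sum.cong refl) (simp add: div)
        then show ?thesis by simp
      qed
      then show ?thesis by (simp add: blocks sum_distrib_left)
    qed
    finally have "(\<Sum>i<N. (norm (G i))\<^sup>2) = (real N)\<^sup>2 * (\<Sum>i<N. (norm (a i))\<^sup>2) - real N * real n * (\<Sum>j<n. (norm (c j))\<^sup>2)"
      by (simp add: N_def power2_eq_square algebra_simps)
    then have "(1 / real N) *\<^sub>R (\<Sum>i<N. (norm (G i))\<^sup>2) = real N * (\<Sum>i<N. (norm (a i))\<^sup>2) - real n * (\<Sum>j<n. (norm (c j))\<^sup>2)"
      using N by (simp add: power2_eq_square field_simps)
    then show ?thesis by (simp add: step_energy_def a_def c_def algebra_simps)
  qed
  ultimately show "has_bochner_integral lborel (\<lambda>s. (norm (slope (n * m) f s - slope n f s))\<^sup>2)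
      (2 * (step_energy (n * m) f - step_energy n f))" by (simp add: N_def)
qed

lemma step_energy_refine:
  fixes f :: "real \<Rightarrow> 'a::{real_inner, banach, second_countable_topology}"
  assumes n: "0 < n" and m: "0 < m"
  shows "step_energy n f \<le> step_energy (n * m) f"
proof -
  have "0 \<le> 2 * (step_energy (n * m) f - step_energy n f)"
    using has_bochner_integral_integral_eq[OF slope_difference_square(1)[OF n m, of f], symmetric] by simp
  then show ?thesis by simp
qed

lemma has_bochner_integral_slope_square:
  fixes f :: "real \<Rightarrow> 'a::{real_inner, banach, second_countable_topology}"
  assumes n: "0 < n"
  shows "has_bochner_integral lborel (\<lambda>s. (norm (slope n f s))\<^sup>2) (2 * step_energy n f)"
proof -
  have "has_bochner_integral lborel (step_function n (\<lambda>i. (norm (real n *\<^sub>R increment n f i))\<^sup>2))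
      ((1 / real n) *\<^sub>R (\<Sum>i<n. (norm (real n *\<^sub>R increment n f i))\<^sup>2))"
    by (rule has_bochner_integral_step_function[OF n])
  moreover have "step_function n (\<lambda>i. (norm (real n *\<^sub>R increment n f i))\<^sup>2) = (\<lambda>s. (norm (slope n f s))\<^sup>2)"
    by (auto simp: slope_def step_function_def)
  moreover have "(1 / real n) *\<^sub>R (\<Sum>i<n. (norm (real n *\<^sub>R increment n f i))\<^sup>2) = 2 * step_energy n f"
    using n by (simp add: step_energy_def power_mult_distrib power2_eq_square sum_distrib_left mult_ac)
  ultimately show ?thesis by simp
qed

lemma slope_difference_L1:
  fixes f :: "real \<Rightarrow> 'a::{real_inner, banach, second_countable_topology}"
  assumes n: "0 < n" and m: "0 < m"
  shows "(LINT s|lborel. norm (slope (n * m) f s - slope n f s))\<^sup>2 \<le> 2 * (step_energy (n * m) f - step_energy n f)"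
proof -
  define G where "G i = norm (real (n * m) *\<^sub>R increment (n * m) f i - real n *\<^sub>R increment n f (i div m))" for i
  have N: "0 < n * m" using n m by simp
  have "(LINT s|lborel. norm (slope (n * m) f s - slope n f s)) = 1 / real (n * m) * (\<Sum>i<n * m. G i)"
    unfolding G_def using slope_difference_square(2)[OF n m] by (rule has_bochner_integral_integral_eq)
  then have "(LINT s|lborel. norm (slope (n * m) f s - slope n f s))\<^sup>2 = (1 / real (n * m))\<^sup>2 * (\<Sum>i<n * m. G i)\<^sup>2"
    by (simp add: power_mult_distrib power_divide)
  also have "\<dots> \<le> (1 / real (n * m))\<^sup>2 * ((\<Sum>i<n * m. (G i)\<^sup>2) * real (n * m))"
    using sum_squared_le_sum_of_squares[of G "{..<n * m}"] by (intro mult_left_mono) auto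
  also have "\<dots> = 1 / real (n * m) * (\<Sum>i<n * m. (G i)\<^sup>2)"
    using N by (simp add: power2_eq_square)
  also have "\<dots> = 2 * (step_energy (n * m) f - step_energy n f)"
  proof -
    have "has_bochner_integral lborel (step_function (n * m) (\<lambda>i. (G i)\<^sup>2)) ((1 / real (n * m)) *\<^sub>R (\<Sum>i<n * m. (G i)\<^sup>2))"
      by (rule has_bochner_integral_step_function[OF N])
    moreover have "step_function (n * m) (\<lambda>i. (G i)\<^sup>2) = (\<lambda>s. (norm (slope (n * m) f s - slope n f s))\<^sup>2)"
      unfolding slope_def step_function_refine[OF n m] by (auto simp: step_function_def G_def)
    ultimately show ?thesis
      using has_bochner_integral_eq[OF _ slope_difference_square(1)[OF n m, of f]] by simp
  qed
  finally show ?thesis .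
qed

lemma integral_slope_initial:
  fixes f :: "real \<Rightarrow> 'a::{real_inner, banach, second_countable_topology}"
  assumes n: "0 < n" and j: "j \<le> n"
  shows "has_bochner_integral lborel (\<lambda>s. indicator {0..real j / real n} s *\<^sub>R slope n f s) (f (real j / real n) - f 0)"
proof -
  have "has_bochner_integral lborel (step_function n (\<lambda>i. if i < j then real n *\<^sub>R increment n f i else 0))
      ((1 / real n) *\<^sub>R (\<Sum>i<n. if i < j then real n *\<^sub>R increment n f i else 0))"
    by (rule has_bochner_integral_step_function[OF n])
  moreover have "(1 / real n) *\<^sub>R (\<Sum>i<n. if i < j then real n *\<^sub>R increment n f i else 0) = f (real j / real n) - f 0"
  proof -
    have "(\<Sum>i<n. if i < j then real n *\<^sub>R increment n f i else 0) = (\<Sum>i\<in>{..<n} \<inter> {i. i < j}. real n *\<^sub>R increment n f i)"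
      by (subst sum.inter_restrict) auto
    also have "{..<n} \<inter> {i. i < j} = {..<j}" using j by auto
    finally show ?thesis using n by (simp add: sum_increment_lessThan flip: scaleR_right.sum)
  qed
  ultimately have "has_bochner_integral lborel (step_function n (\<lambda>i. if i < j then real n *\<^sub>R increment n f i else 0))
      (f (real j / real n) - f 0)" by simp
  moreover have "AE s in lborel. step_function n (\<lambda>i. if i < j then real n *\<^sub>R increment n f i else 0) s =
      indicator {0..real j / real n} s *\<^sub>R slope n f s"
  proof -
    have eq: "step_function n (\<lambda>i. if i < j then real n *\<^sub>R increment n f i else 0) s =
      indicator {0..real j / real n} s *\<^sub>R slope n f s" if "s \<noteq> real j / real n" for s
    proof (cases "s \<in> {0..<1}")
      case True
      then have "0 \<le> real n * s" by simp
      then have "nat \<lfloor>real n * s\<rfloor> < j \<longleftrightarrow> real n * s < real j" by linarith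
      also have "\<dots> \<longleftrightarrow> s \<in> {0..real j / real n}"
        using True n that by (auto simp: field_simps order_le_less)
      finally show ?thesis using True by (auto simp: slope_def step_function_def)
    next
      case False
      then show ?thesis by (simp only: slope_def step_function_def if_False scaleR_zero_right)
    qed
    show ?thesis using AE_lborel_singleton[of "real j / real n"] by eventually_elim (rule eq)
  qed
  moreover have "(\<lambda>s. indicator {0..real j / real n} s *\<^sub>R slope n f s) \<in> borel_measurable lborel"
    using has_bochner_integral_step_function[OF n, of "\<lambda>i. real n *\<^sub>R increment n f i"]
    by (auto simp: slope_def dest: borel_measurable_has_bochner_integral)
  ultimately show ?thesis
    by (subst has_bochner_integral_cong_AE[symmetric]) (auto dest: borel_measurable_has_bochner_integral)
qed

lemma step_energy_nonneg: "0 \<le> step_energy n f"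
  by (simp add: step_energy_def sum_nonneg)

lemma bounded_mono_fast_subseq:
  fixes e :: "nat \<Rightarrow> real"
  assumes mono: "incseq e" and bound: "\<And>p. e p \<le> E"
  obtains r where "strict_mono r" "\<And>k q. r k \<le> q \<Longrightarrow> e q - e (r k) < (1 / 4) ^ k"
proof -
  obtain L where L: "e \<longlonglongrightarrow> L" "\<And>p. e p \<le> L"
    using incseq_convergent[OF mono] bound by metis
  have "\<exists>N. \<forall>q\<ge>N. L - e q < (1 / 4) ^ k" for k
  proof -
    have "eventually (\<lambda>q. L - (1 / 4) ^ k < e q) sequentially"
      using L(1) by (rule order_tendstoD) simp
    then show ?thesis unfolding eventually_sequentially by (auto simp: algebra_simps)
  qed
  then obtain N where N: "\<And>k q. N k \<le> q \<Longrightarrow> L - e q < (1 / 4) ^ k" by metis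
  define r where "r k = k + (\<Sum>i\<le>k. N i)" for k
  show thesis
  proof (rule that[of r])
    show "strict_mono r" by (rule strict_monoI_Suc) (simp add: r_def)
    fix k q assume q: "r k \<le> q"
    have "N k \<le> (\<Sum>i\<le>k. N i)" by (rule member_le_sum) auto
    then have "L - e (r k) < (1 / 4) ^ k" by (intro N) (simp add: r_def)
    then show "e q - e (r k) < (1 / 4) ^ k" using L(2)[of q] by linarith
  qed
qed

text \<open>
  The dyadic energies increase to a finite limit, so by \<open>slope_difference_L1\<close> the dyadic slopes are
  Cauchy in \<open>L\<^sup>1\<close>, and along a fast subsequence they converge almost everywhere to some \<open>f'\<close>.  Their integrals
  over \<open>[0,t]\<close> are the increments of \<open>f\<close> if \<open>t\<close> is dyadic, hence \<open>f'\<close> is the derivative of \<open>f\<close>;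
  Fatou's lemma bounds its energy.
\<close>

lemma L2_derivative_of_bounded_energy:
  fixes f :: "real \<Rightarrow> real^'k"
  assumes cont: "continuous_on {0..1} f" and E: "\<And>p. step_energy (2 ^ p) f \<le> E"
  obtains f' where "L2_derivative f f'" "1 / 2 * (LINT s:{0..1}|lborel. (norm (f' s))\<^sup>2) \<le> E"
proof -
  define e where "e p = step_energy (2 ^ p) f" for p
  have "incseq e"
    unfolding e_def by (intro incseq_SucI) (use step_energy_refine[of "2 ^ n" 2 f for n] in \<open>simp add: mult.commute\<close>)
  then obtain r where r: "strict_mono r" "\<And>k q. r k \<le> q \<Longrightarrow> e q - e (r k) < (1 / 4) ^ k"
    using bounded_mono_fast_subseq[of e E] E unfolding e_def by metis
  define g where "g k = slope (2 ^ r k) f" for k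
  define D where "D k s = g (Suc k) s - g k s" for k s
  have pow: "(2::nat) ^ r (Suc k) = 2 ^ r k * 2 ^ (r (Suc k) - r k)" for k
    using strict_monoD[OF r(1), of k "Suc k"] by (simp flip: power_add)
  have g_int: "integrable lborel (g k)" for k
    unfolding g_def slope_def using has_bochner_integral_step_function by (rule integrable.intros) simp
  have D_int: "integrable lborel (D k)" for k
    unfolding D_def by (intro Bochner_Integration.integrable_diff g_int)
  have D_L1: "(LINT s|lborel. norm (D k s)) \<le> 2 * (1 / 2) ^ k" for k
  proof (rule power2_le_imp_le)
    have "(LINT s|lborel. norm (D k s))\<^sup>2 \<le> 2 * (e (r (Suc k)) - e (r k))"
      unfolding D_def g_def e_def pow by (rule slope_difference_L1) auto
    also have "\<dots> \<le> 2 * (1 / 4) ^ k"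
      using r(2)[of k "r (Suc k)"] strict_monoD[OF r(1), of k "Suc k"] by simp
    also have "\<dots> \<le> (2 * (1 / 2) ^ k)\<^sup>2"
    proof -
      have "((1 / 2 :: real) ^ k)\<^sup>2 = (1 / 4) ^ k"
        by (simp add: power2_eq_square flip: power_mult_distrib)
      then show ?thesis by (simp add: power_mult_distrib)
    qed
    finally show "(LINT s|lborel. norm (D k s))\<^sup>2 \<le> (2 * (1 / 2) ^ k)\<^sup>2" .
  qed simp
  have D_L1_summable: "summable (\<lambda>k. LINT s|lborel. norm (D k s))"
  proof (rule summable_comparison_test')
    show "summable (\<lambda>k. 2 * (1 / 2 :: real) ^ k)" by (intro summable_mult summable_geometric) simp
    show "\<And>k. 0 \<le> k \<Longrightarrow> norm (LINT s|lborel. norm (D k s)) \<le> 2 * (1 / 2) ^ k" using D_L1 by simp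
  qed
  have [measurable]: "D k \<in> borel_measurable lborel" "g k \<in> borel_measurable lborel" for k
    using D_int g_int by auto
  have AE_summable: "AE s in lborel. summable (\<lambda>k. norm (D k s))"
  proof -
    have "(\<integral>\<^sup>+s. (\<Sum>k. ennreal (norm (D k s))) \<partial>lborel) = (\<Sum>k. \<integral>\<^sup>+s. ennreal (norm (D k s)) \<partial>lborel)"
      by (rule nn_integral_suminf) simp
    also have "\<dots> = (\<Sum>k. ennreal (LINT s|lborel. norm (D k s)))"
      by (intro suminf_cong nn_integral_eq_integral integrable_norm D_int) simp
    also have "\<dots> = ennreal (\<Sum>k. LINT s|lborel. norm (D k s))"
      by (rule suminf_ennreal2[OF _ D_L1_summable]) simp
    finally have "(\<integral>\<^sup>+s. (\<Sum>k. ennreal (norm (D k s))) \<partial>lborel) \<noteq> \<infinity>" by simp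
    then have "AE s in lborel. (\<Sum>k. ennreal (norm (D k s))) \<noteq> \<infinity>"
      by (intro nn_integral_noteq_infinite) auto
    then show ?thesis by eventually_elim (auto intro: summable_suminf_not_top)
  qed
  define f' where "f' s = g 0 s + (\<Sum>k. D k s)" for s
  have telescope: "(\<Sum>k<n. D k s) = g n s - g 0 s" for n s
    unfolding D_def by (rule sum_lessThan_telescope)
  have f'_int: "integrable lborel f'"
    unfolding f'_def by (intro Bochner_Integration.integrable_add g_int integrable_suminf D_int AE_summable D_L1_summable)
  then have [measurable]: "f' \<in> borel_measurable lborel" by auto
  have f'_lim: "AE s in lborel. (\<lambda>n. g n s) \<longlonglongrightarrow> f' s"
    using AE_summable
  proof eventually_elim
    case (elim s)
    then have "(\<lambda>n. \<Sum>k<n. D k s) \<longlonglongrightarrow> (\<Sum>k. D k s)"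
      by (rule summable_LIMSEQ[OF summable_norm_cancel])
    then have "(\<lambda>n. g 0 s + (\<Sum>k<n. D k s)) \<longlonglongrightarrow> f' s"
      unfolding f'_def by (intro tendsto_intros)
    then show ?case by (simp add: telescope)
  qed
  have conv: "(\<lambda>n. LINT s:{0..t}|lborel. g n s) \<longlonglongrightarrow> (LINT s:{0..t}|lborel. f' s)" for t
  proof -
    let ?D = "\<lambda>k s. indicator {0..t} s *\<^sub>R D k s"
    have D'_int: "integrable lborel (?D k)" for k
      by (intro integrable_mult_indicator D_int) simp
    have le: "norm (?D k s) \<le> norm (D k s)" for k s by (simp add: indicator_def)
    have "AE s in lborel. summable (\<lambda>k. norm (?D k s))"
      using AE_summable by eventually_elim (rule summable_comparison_test', use le in auto)
    moreover have "summable (\<lambda>k. LINT s|lborel. norm (?D k s))"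
    proof (rule summable_comparison_test'[OF D_L1_summable])
      show "norm (LINT s|lborel. norm (?D k s)) \<le> (LINT s|lborel. norm (D k s))" for k
      proof -
        have "(LINT s|lborel. norm (?D k s)) \<le> (LINT s|lborel. norm (D k s))"
          by (intro integral_mono integrable_norm D'_int D_int le)
        moreover have "0 \<le> (LINT s|lborel. norm (?D k s))"
          by (rule Bochner_Integration.integral_nonneg) simp
        ultimately show ?thesis by (simp only: real_norm_def abs_of_nonneg)
      qed
    qed
    ultimately have "(\<lambda>k. LINT s|lborel. ?D k s) sums (LINT s|lborel. (\<Sum>k. ?D k s))"
      using D'_int by (intro sums_integral)
    then have "(\<lambda>n. \<Sum>k<n. LINT s|lborel. ?D k s) \<longlonglongrightarrow> (LINT s|lborel. (\<Sum>k. ?D k s))"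
      by (simp add: sums_def)
    moreover have "(\<Sum>k<n. LINT s|lborel. ?D k s) = (LINT s:{0..t}|lborel. g n s) - (LINT s:{0..t}|lborel. g 0 s)" for n
    proof -
      have "(LINT s|lborel. ?D k s) = (LINT s:{0..t}|lborel. g (Suc k) s) - (LINT s:{0..t}|lborel. g k s)" for k
        unfolding D_def set_lebesgue_integral_def scaleR_diff_right
        by (intro Bochner_Integration.integral_diff integrable_mult_indicator g_int) auto
      then show ?thesis
        using sum_lessThan_telescope[of "\<lambda>k. LINT s:{0..t}|lborel. g k s" n] by simp
    qed
    moreover have "(LINT s|lborel. (\<Sum>k. ?D k s)) = (LINT s:{0..t}|lborel. f' s) - (LINT s:{0..t}|lborel. g 0 s)"
    proof -
      have "(\<Sum>k. ?D k s) = indicator {0..t} s *\<^sub>R f' s - indicator {0..t} s *\<^sub>R g 0 s" for s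
        by (simp add: f'_def indicator_def)
      then show ?thesis
        unfolding set_lebesgue_integral_def
        by (simp, intro Bochner_Integration.integral_diff integrable_mult_indicator g_int f'_int) auto
    qed
    ultimately have "(\<lambda>n. (LINT s:{0..t}|lborel. g n s) - (LINT s:{0..t}|lborel. g 0 s)) \<longlonglongrightarrow>
        (LINT s:{0..t}|lborel. f' s) - (LINT s:{0..t}|lborel. g 0 s)" by simp
    from tendsto_add[OF this tendsto_const[of "LINT s:{0..t}|lborel. g 0 s"]] show ?thesis by simp
  qed
  have dyadic: "(LINT s:{0..real j / 2 ^ p}|lborel. f' s) = f (real j / 2 ^ p) - f 0" if j: "j \<le> 2 ^ p" for j p
  proof (rule LIMSEQ_unique[OF conv])
    have "(LINT s:{0..real j / 2 ^ p}|lborel. g n s) = f (real j / 2 ^ p) - f 0" if n: "p \<le> n" for n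
    proof -
      have rn: "p \<le> r n" using n seq_suble[OF r(1), of n] by linarith
      define i where "i = j * 2 ^ (r n - p)"
      have "i \<le> 2 ^ p * 2 ^ (r n - p)" unfolding i_def using j by (intro mult_right_mono) auto
      also have "\<dots> = 2 ^ r n" using rn by (simp flip: power_add)
      finally have "i \<le> 2 ^ r n" .
      moreover have "real i / real (2 ^ r n) = real j / 2 ^ p"
      proof -
        have "(2::real) ^ r n = 2 ^ p * 2 ^ (r n - p)" using rn by (simp flip: power_add)
        then show ?thesis by (simp add: i_def)
      qed
      ultimately show ?thesis
        using has_bochner_integral_integral_eq[OF integral_slope_initial[of "2 ^ r n" i f]]
        by (simp add: set_lebesgue_integral_def g_def)
    qed
    then have "eventually (\<lambda>n. (LINT s:{0..real j / 2 ^ p}|lborel. g n s) = f (real j / 2 ^ p) - f 0) sequentially"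
      by (auto simp: eventually_sequentially)
    then show "(\<lambda>n. LINT s:{0..real j / 2 ^ p}|lborel. g n s) \<longlonglongrightarrow> f (real j / 2 ^ p) - f 0"
      by (rule tendsto_eventually)
  qed
  have f'_set_int: "set_integrable lborel {0..t} f'" for t
    unfolding set_integrable_def by (intro integrable_mult_indicator f'_int) simp
  have F_cont: "continuous_on {0..1} (\<lambda>t. LINT s:{0..t}|lborel. f' s)"
  proof -
    have "continuous_on {0..1} (\<lambda>t. integral {0..t} f')"
      by (intro indefinite_integral_continuous_1 set_borel_integral_eq_integral(1) f'_set_int)
    then show ?thesis using set_borel_integral_eq_integral(2)[OF f'_set_int] by simp
  qed
  have primitive: "f t = f 0 + (LINT s:{0..t}|lborel. f' s)" if t: "t \<in> {0..1}" for t
  proof -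
    define q where "q p = real (nat \<lfloor>2 ^ p * t\<rfloor>) / 2 ^ p" for p
    note q01 = dyadic_floor(4)[OF t, folded q_def]
    have q: "q \<longlonglongrightarrow> t" unfolding q_def by (rule dyadic_floor(5)[OF t])
    have "(\<lambda>p. f (q p) - f 0) \<longlonglongrightarrow> f t - f 0"
      by (intro tendsto_intros continuous_on_tendsto_compose[OF cont q t]) (use q01 in auto)
    moreover have "(\<lambda>p. LINT s:{0..q p}|lborel. f' s) \<longlonglongrightarrow> (LINT s:{0..t}|lborel. f' s)"
      by (intro continuous_on_tendsto_compose[OF F_cont q t]) (use q01 in auto)
    moreover have "(LINT s:{0..q p}|lborel. f' s) = f (q p) - f 0" for p
      unfolding q_def using dyadic[OF dyadic_floor(3)[OF t]] by simp
    ultimately have "f t - f 0 = (LINT s:{0..t}|lborel. f' s)"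
      by (simp add: LIMSEQ_unique)
    then show ?thesis by (simp add: algebra_simps)
  qed
  have E0: "0 \<le> E" using E[of 0] step_energy_nonneg[of "2 ^ 0" f] by linarith
  \<comment> \<open>Almost everywhere, \<open>\<bar>f'\<bar>\<^sup>2\<close> is the lower limit of the squared slopes, whose integrals are at most \<open>2 E\<close>.\<close>
  have sq: "(\<integral>\<^sup>+s. ennreal ((norm (f' s))\<^sup>2) \<partial>lborel) \<le> ennreal (2 * E)"
  proof -
    have "(\<integral>\<^sup>+s. ennreal ((norm (f' s))\<^sup>2) \<partial>lborel) = (\<integral>\<^sup>+s. liminf (\<lambda>n. ennreal ((norm (g n s))\<^sup>2)) \<partial>lborel)"
      using f'_lim
    proof (intro nn_integral_cong_AE, eventually_elim)
      case (elim s)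
      then have "(\<lambda>n. ennreal ((norm (g n s))\<^sup>2)) \<longlonglongrightarrow> ennreal ((norm (f' s))\<^sup>2)"
        by (intro tendsto_intros)
      then show ?case by (rule lim_imp_Liminf[OF sequentially_bot, symmetric])
    qed
    also have "\<dots> \<le> liminf (\<lambda>n. \<integral>\<^sup>+s. ennreal ((norm (g n s))\<^sup>2) \<partial>lborel)"
      by (rule nn_integral_liminf) simp
    also have "\<dots> \<le> liminf (\<lambda>n::nat. ennreal (2 * E))"
    proof (intro Liminf_mono always_eventually allI)
      fix n
      note hb = has_bochner_integral_slope_square[of "2 ^ r n" f]
      have "(\<integral>\<^sup>+s. ennreal ((norm (g n s))\<^sup>2) \<partial>lborel) = ennreal (2 * step_energy (2 ^ r n) f)"
        using hb unfolding g_def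
        by (subst nn_integral_eq_integral) (auto simp: has_bochner_integral_iff)
      then show "(\<integral>\<^sup>+s. ennreal ((norm (g n s))\<^sup>2) \<partial>lborel) \<le> ennreal (2 * E)"
        using E[of "r n"] by (simp add: ennreal_leI)
    qed
    also have "\<dots> = ennreal (2 * E)" by (simp add: Liminf_const)
    finally show ?thesis .
  qed
  have sq_int: "integrable lborel (\<lambda>s. (norm (f' s))\<^sup>2)"
    using sq by (intro integrableI_nonneg) (auto intro: order_le_less_trans)
  have "(LINT s:{0..1}|lborel. (norm (f' s))\<^sup>2) \<le> (LINT s|lborel. (norm (f' s))\<^sup>2)"
    unfolding set_lebesgue_integral_def
    by (intro integral_mono integrable_mult_indicator sq_int) (auto simp: indicator_def)
  also have "\<dots> \<le> 2 * E"
  proof -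
    have "ennreal (LINT s|lborel. (norm (f' s))\<^sup>2) \<le> ennreal (2 * E)"
      using sq nn_integral_eq_integral[OF sq_int] by simp
    then show ?thesis using E0 by (subst (asm) ennreal_le_iff) auto
  qed
  finally have "1 / 2 * (LINT s:{0..1}|lborel. (norm (f' s))\<^sup>2) \<le> E" by simp
  moreover have "L2_derivative f f'"
    unfolding L2_derivative_def
  proof (intro conjI ballI)
    show "set_borel_measurable lborel {0..1} f'" unfolding set_borel_measurable_def by measurable
    show "set_integrable lborel {0..1} (\<lambda>s. (norm (f' s))\<^sup>2)"
      unfolding set_integrable_def by (intro integrable_mult_indicator sq_int) simp
    show "continuous_on {0..1} f" by (rule cont)
    show "f t = f 0 + (LINT s:{0..t}|lborel. f' s)" if "t \<in> {0..1}" for t using that by (rule primitive)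
  qed
  ultimately show thesis by (intro that)
qed

section \<open>Exponential moments of Brownian increments\<close>

text \<open>
  Up to the factor \<open>1 / sqrt (1 - \<theta>)\<close>, the integrand is the normal density of variance \<open>\<tau>\<^sup>2 / (1 - \<theta>)\<close>.
\<close>

lemma nn_integral_normal_exp_square:
  assumes \<tau>: "0 < \<tau>" and \<theta>: "0 \<le> \<theta>" "\<theta> < 1"
  shows "(\<integral>\<^sup>+z. ennreal (normal_density 0 \<tau> z * exp (\<theta> * (z\<^sup>2 / (2 * \<tau>\<^sup>2)))) \<partial>lborel) = ennreal (1 / sqrt (1 - \<theta>))"
proof -
  define \<tau>' where "\<tau>' = \<tau> / sqrt (1 - \<theta>)"
  have \<tau>': "0 < \<tau>'" "\<tau>'\<^sup>2 = \<tau>\<^sup>2 / (1 - \<theta>)" using \<tau> \<theta> by (auto simp: \<tau>'_def power_divide)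
  have "normal_density 0 \<tau> z * exp (\<theta> * (z\<^sup>2 / (2 * \<tau>\<^sup>2))) = 1 / sqrt (1 - \<theta>) * normal_density 0 \<tau>' z" for z
  proof -
    have "sqrt (2 * pi * \<tau>'\<^sup>2) = sqrt (2 * pi * \<tau>\<^sup>2) / sqrt (1 - \<theta>)"
      by (simp add: \<tau>'(2) flip: real_sqrt_divide)
    moreover have "exp (- (z\<^sup>2) / (2 * \<tau>\<^sup>2)) * exp (\<theta> * (z\<^sup>2 / (2 * \<tau>\<^sup>2))) = exp (- (z\<^sup>2) / (2 * \<tau>'\<^sup>2))"
      using \<tau> \<theta> by (simp add: \<tau>'(2) field_simps flip: exp_add)
    ultimately show ?thesis using \<theta> \<tau> by (simp add: normal_density_def field_simps)
  qed
  then have "(\<integral>\<^sup>+z. ennreal (normal_density 0 \<tau> z * exp (\<theta> * (z\<^sup>2 / (2 * \<tau>\<^sup>2)))) \<partial>lborel)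
      = (\<integral>\<^sup>+z. ennreal (1 / sqrt (1 - \<theta>) * normal_density 0 \<tau>' z) \<partial>lborel)" by simp
  also have "\<dots> = ennreal (LINT z|lborel. 1 / sqrt (1 - \<theta>) * normal_density 0 \<tau>' z)"
    using \<tau>'(1) \<theta> by (intro nn_integral_eq_integral) auto
  also have "(LINT z|lborel. 1 / sqrt (1 - \<theta>) * normal_density 0 \<tau>' z) = 1 / sqrt (1 - \<theta>)"
    using \<tau>'(1) by (subst integral_mult_right_zero) simp
  finally show ?thesis .
qed

lemma nn_integral_vec_product:
  fixes h :: "real \<Rightarrow> ennreal"
  assumes [measurable]: "h \<in> borel_measurable borel"
  shows "(\<integral>\<^sup>+z. (\<Prod>i\<in>UNIV. h (z $ i)) \<partial>(lborel :: (real^'k) measure)) = (\<integral>\<^sup>+u. h u \<partial>lborel) ^ CARD('k)"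
proof -
  have Basis: "(Basis :: (real^'k) set) = (\<lambda>i. axis i 1) ` UNIV" by (auto simp: Basis_vec_def)
  have inj: "inj (\<lambda>i. axis i (1::real) :: real^'k)" by (auto simp: inj_on_def axis_eq_axis)
  have "(\<Prod>i\<in>UNIV. h (z $ i)) = (\<Prod>b\<in>Basis. h (z \<bullet> b))" for z :: "real^'k"
    unfolding Basis by (subst prod.reindex[OF inj]) (simp add: inner_axis)
  then have "(\<integral>\<^sup>+z. (\<Prod>i\<in>UNIV. h (z $ i)) \<partial>(lborel :: (real^'k) measure))
      = (\<integral>\<^sup>+z. (\<Prod>b\<in>Basis. h (z \<bullet> b)) \<partial>(lborel :: (real^'k) measure))" by simp
  also have "\<dots> = (\<Prod>b\<in>(Basis :: (real^'k) set). (\<integral>\<^sup>+u. h u \<partial>lborel))"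
    by (rule nn_integral_lborel_prod) auto
  also have "\<dots> = (\<integral>\<^sup>+u. h u \<partial>lborel) ^ CARD('k)" by simp
  finally show ?thesis .
qed

lemma brownian_prob_space: "standard_brownian_motion M B \<Longrightarrow> prob_space M"
  unfolding standard_brownian_motion_def by blast

lemma brownian_measurable: "standard_brownian_motion M B \<Longrightarrow> 0 \<le> t \<Longrightarrow> B t \<in> borel_measurable M"
  unfolding standard_brownian_motion_def by blast

lemma brownian_increment_exp_moment:
  fixes B :: "real \<Rightarrow> 'w \<Rightarrow> real^'k"
  assumes B: "standard_brownian_motion M B" and st: "0 \<le> s" "s < t" and \<theta>: "0 \<le> \<theta>" "\<theta> < 1"
  shows "(\<integral>\<^sup>+\<omega>. ennreal (exp (\<theta> * ((norm (B t \<omega> - B s \<omega>))\<^sup>2 / (2 * (t - s))))) \<partial>M) = ennreal ((1 / sqrt (1 - \<theta>)) ^ CARD('k))"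
proof -
  define \<tau> where "\<tau> = sqrt (t - s)"
  have \<tau>: "0 < \<tau>" "\<tau>\<^sup>2 = t - s" using st by (auto simp: \<tau>_def)
  have dist: "distributed M lborel (\<lambda>\<omega>. B t \<omega> - B s \<omega>)
         (\<lambda>z. ennreal (\<Prod>i\<in>UNIV. normal_density 0 \<tau> (z $ i)))"
    using B st unfolding standard_brownian_motion_def \<tau>_def by blast
  have "(\<integral>\<^sup>+\<omega>. ennreal (exp (\<theta> * ((norm (B t \<omega> - B s \<omega>))\<^sup>2 / (2 * (t - s))))) \<partial>M)
      = (\<integral>\<^sup>+z. ennreal (\<Prod>i\<in>UNIV. normal_density 0 \<tau> (z $ i)) * ennreal (exp (\<theta> * ((norm z)\<^sup>2 / (2 * (t - s))))) \<partial>(lborel :: (real^'k) measure))"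
    by (rule distributed_nn_integral[OF dist, of "\<lambda>z. ennreal (exp (\<theta> * ((norm z)\<^sup>2 / (2 * (t - s)))))", symmetric]) measurable
  also have "\<dots> = (\<integral>\<^sup>+z. (\<Prod>i\<in>UNIV. ennreal (normal_density 0 \<tau> (z $ i) * exp (\<theta> * ((z $ i)\<^sup>2 / (2 * \<tau>\<^sup>2))))) \<partial>(lborel :: (real^'k) measure))"
  proof (intro nn_integral_cong)
    fix z :: "real^'k"
    have "(norm z)\<^sup>2 = (\<Sum>i\<in>UNIV. (z $ i)\<^sup>2)"
      by (simp add: norm_vec_def L2_set_def sum_nonneg)
    then have "exp (\<theta> * ((norm z)\<^sup>2 / (2 * (t - s)))) = (\<Prod>i\<in>UNIV. exp (\<theta> * ((z $ i)\<^sup>2 / (2 * \<tau>\<^sup>2))))"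
      by (simp add: \<tau>(2) sum_divide_distrib sum_distrib_left flip: exp_sum)
    then show "ennreal (\<Prod>i\<in>UNIV. normal_density 0 \<tau> (z $ i)) * ennreal (exp (\<theta> * ((norm z)\<^sup>2 / (2 * (t - s)))))
        = (\<Prod>i\<in>UNIV. ennreal (normal_density 0 \<tau> (z $ i) * exp (\<theta> * ((z $ i)\<^sup>2 / (2 * \<tau>\<^sup>2)))))"
      by (simp add: prod_ennreal prod_nonneg prod.distrib flip: ennreal_mult)
  qed
  also have "\<dots> = (\<integral>\<^sup>+u. ennreal (normal_density 0 \<tau> u * exp (\<theta> * (u\<^sup>2 / (2 * \<tau>\<^sup>2)))) \<partial>lborel) ^ CARD('k)"
    by (rule nn_integral_vec_product) measurable
  also have "\<dots> = ennreal (1 / sqrt (1 - \<theta>)) ^ CARD('k)"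
    by (simp only: nn_integral_normal_exp_square[OF \<tau>(1) \<theta>])
  also have "\<dots> = ennreal ((1 / sqrt (1 - \<theta>)) ^ CARD('k))"
    using \<theta> by (intro ennreal_power) simp
  finally show ?thesis .
qed

lemma exp_moment_tail:
  assumes "prob_space M" and f: "f \<in> borel_measurable M" and \<theta>: "0 < \<theta>" and K: "0 \<le> K"
    and moment: "(\<integral>\<^sup>+\<omega>. ennreal (exp (\<theta> * f \<omega>)) \<partial>M) \<le> ennreal K"
  shows "measure M {\<omega> \<in> space M. a < f \<omega>} \<le> K * exp (- \<theta> * a)"
proof -
  interpret prob_space M by fact
  note f[measurable]
  have "emeasure M {\<omega> \<in> space M. a < f \<omega>} \<le> emeasure M {\<omega> \<in> space M. a \<le> f \<omega>}"
    by (intro emeasure_mono) auto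
  also have "\<dots> \<le> ennreal (exp (- \<theta> * a)) * (\<integral>\<^sup>+\<omega>. ennreal (exp (\<theta> * f \<omega>)) * indicator (space M) \<omega> \<partial>M)"
    using \<theta> by (intro Chernoff_ineq_nn_integral_ge) auto
  also have "(\<integral>\<^sup>+\<omega>. ennreal (exp (\<theta> * f \<omega>)) * indicator (space M) \<omega> \<partial>M) = (\<integral>\<^sup>+\<omega>. ennreal (exp (\<theta> * f \<omega>)) \<partial>M)"
    by (intro nn_integral_cong) simp
  also have "ennreal (exp (- \<theta> * a)) * \<dots> \<le> ennreal (exp (- \<theta> * a)) * ennreal K"
    by (intro mult_left_mono moment) simp
  also have "\<dots> = ennreal (K * exp (- \<theta> * a))"
    using K by (simp add: mult.commute flip: ennreal_mult)
  finally show ?thesis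
    using K by (simp add: emeasure_eq_measure)
qed

text \<open>
  Markov's inequality with \<open>\<theta> = 1/2\<close>; for single increments the size of the exponent is immaterial.
\<close>

lemma brownian_increment_tail:
  fixes B :: "real \<Rightarrow> 'w \<Rightarrow> real^'k"
  assumes B: "standard_brownian_motion M B" and st: "0 \<le> s" "s < t"
  shows "measure M {\<omega> \<in> space M. a < (norm (B t \<omega> - B s \<omega>))\<^sup>2 / (2 * (t - s))} \<le> sqrt 2 ^ CARD('k) * exp (- a / 2)"
proof -
  have [measurable]: "B s \<in> borel_measurable M" "B t \<in> borel_measurable M"
    using brownian_measurable[OF B] st by auto
  have "measure M {\<omega> \<in> space M. a < (norm (B t \<omega> - B s \<omega>))\<^sup>2 / (2 * (t - s))} \<le> sqrt 2 ^ CARD('k) * exp (- (1 / 2) * a)"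
  proof (rule exp_moment_tail[OF brownian_prob_space[OF B]])
    show "(\<lambda>\<omega>. (norm (B t \<omega> - B s \<omega>))\<^sup>2 / (2 * (t - s))) \<in> borel_measurable M"
      by measurable
    show "(\<integral>\<^sup>+\<omega>. ennreal (exp (1 / 2 * ((norm (B t \<omega> - B s \<omega>))\<^sup>2 / (2 * (t - s))))) \<partial>M) \<le> ennreal (sqrt 2 ^ CARD('k))"
      using brownian_increment_exp_moment[OF B st, of "1 / 2"] by (simp add: real_sqrt_divide)
  qed auto
  then show ?thesis by simp
qed

text \<open>
  Here \<open>\<theta>\<close> may be arbitrarily close to \<open>1\<close>, at the price of a larger constant.  This sharpness is
  what produces the exact unit bound on the energy in the limit set.
\<close>

lemma brownian_energy_tail:
  fixes B :: "real \<Rightarrow> 'w \<Rightarrow> real^'k"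
  assumes B: "standard_brownian_motion M B" and h: "0 < h" and \<theta>: "0 < \<theta>" "\<theta> < 1"
  shows "measure M {\<omega> \<in> space M. a < (\<Sum>i<n. (norm (B (h * real (Suc i)) \<omega> - B (h * real i) \<omega>))\<^sup>2 / (2 * h))}
    \<le> ((1 / sqrt (1 - \<theta>)) ^ CARD('k)) ^ n * exp (- \<theta> * a)"
proof -
  interpret prob_space M using B by (rule brownian_prob_space)
  have [measurable]: "B (h * real i) \<in> borel_measurable M" for i
    using brownian_measurable[OF B] h by simp
  define Y where "Y i \<omega> = (norm (B (h * real (Suc i)) \<omega> - B (h * real i) \<omega>))\<^sup>2 / (2 * h)" for i \<omega>
  have indep: "indep_vars (\<lambda>_. borel) (\<lambda>i \<omega>. B (h * real (Suc i)) \<omega> - B (h * real i) \<omega>) {..<n}"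
  proof -
    have "0 \<le> h * real 0 \<and> strict_mono_on {..n} (\<lambda>i. h * real i)"
      using h by (auto simp: strict_mono_on_def)
    moreover have "\<forall>n \<tau>. 0 \<le> \<tau> 0 \<and> strict_mono_on {..n} \<tau> \<longrightarrow>
       indep_vars (\<lambda>_. borel) (\<lambda>i \<omega>. B (\<tau> (Suc i)) \<omega> - B (\<tau> i) \<omega>) {..<n}"
      using B unfolding standard_brownian_motion_def by blast
    from this[rule_format, of "\<lambda>i. h * real i" n] calculation show ?thesis by simp
  qed
  have Y_meas: "(\<lambda>\<omega>. \<Sum>i<n. Y i \<omega>) \<in> borel_measurable M"
    unfolding Y_def by measurable
  have "measure M {\<omega> \<in> space M. a < (\<Sum>i<n. Y i \<omega>)} \<le> ((1 / sqrt (1 - \<theta>)) ^ CARD('k)) ^ n * exp (- \<theta> * a)"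
  proof (rule exp_moment_tail[OF prob_space_axioms Y_meas \<theta>(1)])
    have "(\<integral>\<^sup>+\<omega>. ennreal (exp (\<theta> * (\<Sum>i<n. Y i \<omega>))) \<partial>M) = (\<integral>\<^sup>+\<omega>. (\<Prod>i<n. ennreal (exp (\<theta> * Y i \<omega>))) \<partial>M)"
      by (intro nn_integral_cong) (simp add: sum_distrib_left exp_sum prod_ennreal)
    also have "\<dots> = (\<Prod>i<n. \<integral>\<^sup>+\<omega>. ennreal (exp (\<theta> * Y i \<omega>)) \<partial>M)"
      unfolding Y_def by (intro indep_vars_nn_integral indep_vars_compose2[OF indep]) auto
    also have "\<dots> = (\<Prod>i<n. ennreal ((1 / sqrt (1 - \<theta>)) ^ CARD('k)))"
    proof (intro prod.cong refl)
      fix i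
      show "(\<integral>\<^sup>+\<omega>. ennreal (exp (\<theta> * Y i \<omega>)) \<partial>M) = ennreal ((1 / sqrt (1 - \<theta>)) ^ CARD('k))"
        using brownian_increment_exp_moment[OF B, of "h * real i" "h * real (Suc i)" \<theta>] h \<theta>
        by (simp add: Y_def algebra_simps)
    qed
    also have "\<dots> = ennreal (((1 / sqrt (1 - \<theta>)) ^ CARD('k)) ^ n)"
      using \<theta> by (simp add: ennreal_power)
    finally show "(\<integral>\<^sup>+\<omega>. ennreal (exp (\<theta> * (\<Sum>i<n. Y i \<omega>))) \<partial>M) \<le> ennreal (((1 / sqrt (1 - \<theta>)) ^ CARD('k)) ^ n)"
      by simp
    show "0 \<le> ((1 / sqrt (1 - \<theta>)) ^ CARD('k)) ^ n" using \<theta> by simp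
  qed
  then show ?thesis by (simp add: Y_def)
qed

section \<open>Exceptional events for the rescaled Brownian path\<close>

text \<open>
  Strassen's normalisation \<open>B\<^bsub>\<epsilon> t\<^esub> / sqrt (\<epsilon> log log (1/\<epsilon>))\<close>; the noise of \<open>y\<^sup>\<epsilon>\<close> is \<open>\<sigma>\<^sub>\<epsilon>\<close> applied to it.
\<close>

definition strassen_path :: "(real \<Rightarrow> 'w \<Rightarrow> real^'k) \<Rightarrow> real \<Rightarrow> 'w \<Rightarrow> real \<Rightarrow> real^'k" where
  "strassen_path B \<epsilon> \<omega> t = (1 / sqrt (loglog \<epsilon>)) *\<^sub>R rescaled B \<epsilon> t \<omega>"

lemma norm_increment_strassen_path:
  assumes \<epsilon>: "0 < \<epsilon>" and r: "0 < loglog \<epsilon>" and n: "0 < n"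
  shows "(norm (increment n (strassen_path B \<epsilon> \<omega>) i))\<^sup>2 / (2 * (\<epsilon> / real n)) * (\<epsilon> * loglog \<epsilon>)
    = (norm (B (\<epsilon> / real n * real (Suc i)) \<omega> - B (\<epsilon> / real n * real i) \<omega>))\<^sup>2 / (2 * (\<epsilon> / real n))"
proof -
  have "increment n (strassen_path B \<epsilon> \<omega>) i = (1 / (sqrt (loglog \<epsilon>) * sqrt \<epsilon>)) *\<^sub>R
      (B (\<epsilon> / real n * real (Suc i)) \<omega> - B (\<epsilon> / real n * real i) \<omega>)"
    by (simp add: increment_def strassen_path_def rescaled_def scaleR_diff_right add.commute)
  then have "(norm (increment n (strassen_path B \<epsilon> \<omega>) i))\<^sup>2 =
      (norm (B (\<epsilon> / real n * real (Suc i)) \<omega> - B (\<epsilon> / real n * real i) \<omega>))\<^sup>2 / (loglog \<epsilon> * \<epsilon>)"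
    using \<epsilon> r by (simp add: power_mult_distrib power_divide del: of_nat_Suc)
  then show ?thesis using \<epsilon> r by (simp del: of_nat_Suc)
qed

text \<open>
  The bound \<open>8 (3/4)\<^sup>m\<close> is summable over the levels, as chaining requires, and it decays more slowly
  than the standard deviation \<open>2\<^bsup>-m/2\<^esup>\<close>, by a factor whose square is \<open>(9/8)\<^sup>m\<close>.  That growth
  compensates the number \<open>2\<^sup>m\<close> of increments on level \<open>m\<close>.
\<close>

definition exceptional_event ::
    "'w measure \<Rightarrow> (real \<Rightarrow> 'w \<Rightarrow> real^'k) \<Rightarrow> real \<Rightarrow> nat \<Rightarrow> real \<Rightarrow> 'w set" where
  "exceptional_event M B \<eta> n \<epsilon> =
    {\<omega> \<in> space M. 1 + \<eta> < step_energy n (strassen_path B \<epsilon> \<omega>)} \<union>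
    (\<Union>m. \<Union>i\<in>{..<2 ^ m}. {\<omega> \<in> space M. 8 * (3 / 4) ^ m < norm (increment (2 ^ m) (strassen_path B \<epsilon> \<omega>) i)})"

lemma strassen_path_measurable:
  assumes B: "standard_brownian_motion M B" and "0 \<le> \<epsilon>" "0 \<le> t"
  shows "(\<lambda>\<omega>. strassen_path B \<epsilon> \<omega> t) \<in> borel_measurable M"
proof -
  have [measurable]: "B (\<epsilon> * t) \<in> borel_measurable M" using assms by (intro brownian_measurable[OF B]) simp
  show ?thesis unfolding strassen_path_def rescaled_def by measurable
qed

lemma exceptional_event_pieces_measurable:
  assumes B: "standard_brownian_motion M B" and \<epsilon>: "0 \<le> \<epsilon>"
  shows "{\<omega> \<in> space M. 1 + \<eta> < step_energy n (strassen_path B \<epsilon> \<omega>)} \<in> sets M"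
    and "{\<omega> \<in> space M. a < norm (increment n (strassen_path B \<epsilon> \<omega>) i)} \<in> sets M"
proof -
  have [measurable]: "(\<lambda>\<omega>. increment n (strassen_path B \<epsilon> \<omega>) i) \<in> borel_measurable M" for n i
    unfolding increment_def
    by (intro borel_measurable_diff strassen_path_measurable[OF B \<epsilon>]) auto
  show "{\<omega> \<in> space M. 1 + \<eta> < step_energy n (strassen_path B \<epsilon> \<omega>)} \<in> sets M"
    unfolding step_energy_def by measurable
  show "{\<omega> \<in> space M. a < norm (increment n (strassen_path B \<epsilon> \<omega>) i)} \<in> sets M"
    by measurable
qed

lemma exceptional_event_measurable:
  assumes "standard_brownian_motion M B" "0 \<le> \<epsilon>"
  shows "exceptional_event M B \<eta> n \<epsilon> \<in> sets M"
  unfolding exceptional_event_def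
  using exceptional_event_pieces_measurable[OF assms] by (intro sets.Un sets.countable_UN sets.finite_UN) auto

text \<open>
  The parameter \<open>\<theta>\<close> is chosen with \<open>\<theta> (1 + \<eta>) = 1 + \<eta>/2\<close>, which still exceeds \<open>1\<close>.
\<close>

lemma strassen_energy_tail:
  fixes B :: "real \<Rightarrow> 'w \<Rightarrow> real^'k"
  assumes B: "standard_brownian_motion M B" and \<epsilon>: "0 < \<epsilon>" and r: "0 < loglog \<epsilon>" and n: "0 < n" and \<eta>: "0 < \<eta>"
  shows "measure M {\<omega> \<in> space M. 1 + \<eta> < step_energy n (strassen_path B \<epsilon> \<omega>)}
    \<le> ((1 / sqrt (1 - (1 + \<eta> / 2) / (1 + \<eta>))) ^ CARD('k)) ^ n * exp (- (1 + \<eta> / 2) * loglog \<epsilon>)"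
proof -
  define \<theta> where "\<theta> = (1 + \<eta> / 2) / (1 + \<eta>)"
  define h where "h = \<epsilon> / real n"
  have \<theta>: "0 < \<theta>" "\<theta> < 1" "\<theta> * (1 + \<eta>) = 1 + \<eta> / 2" using \<eta> by (auto simp: \<theta>_def)
  have h: "0 < h" using \<epsilon> n by (simp add: h_def)
  have "step_energy n (strassen_path B \<epsilon> \<omega>) * loglog \<epsilon> =
      (\<Sum>i<n. (norm (B (h * real (Suc i)) \<omega> - B (h * real i) \<omega>))\<^sup>2 / (2 * h))" for \<omega>
    unfolding h_def step_energy_def norm_increment_strassen_path[OF \<epsilon> r n, symmetric]
    using \<epsilon> n by (simp add: sum_distrib_left sum_distrib_right mult_ac)
  then have "1 + \<eta> < step_energy n (strassen_path B \<epsilon> \<omega>) \<longleftrightarrow>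
      (1 + \<eta>) * loglog \<epsilon> < (\<Sum>i<n. (norm (B (h * real (Suc i)) \<omega> - B (h * real i) \<omega>))\<^sup>2 / (2 * h))" for \<omega>
    using mult_less_cancel_right_pos[OF r, of "1 + \<eta>" "step_energy n (strassen_path B \<epsilon> \<omega>)"] by simp
  then have "measure M {\<omega> \<in> space M. 1 + \<eta> < step_energy n (strassen_path B \<epsilon> \<omega>)}
      = measure M {\<omega> \<in> space M. (1 + \<eta>) * loglog \<epsilon> < (\<Sum>i<n. (norm (B (h * real (Suc i)) \<omega> - B (h * real i) \<omega>))\<^sup>2 / (2 * h))}"
    by simp
  also have "\<dots> \<le> ((1 / sqrt (1 - \<theta>)) ^ CARD('k)) ^ n * exp (- \<theta> * ((1 + \<eta>) * loglog \<epsilon>))"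
    by (rule brownian_energy_tail[OF B h \<theta>(1,2)])
  also have "- \<theta> * ((1 + \<eta>) * loglog \<epsilon>) = - (1 + \<eta> / 2) * loglog \<epsilon>"
    using \<theta>(3) by (simp add: mult.assoc[symmetric])
  finally show ?thesis by (simp add: \<theta>_def)
qed

lemma strassen_increment_tail:
  fixes B :: "real \<Rightarrow> 'w \<Rightarrow> real^'k"
  assumes B: "standard_brownian_motion M B" and \<epsilon>: "0 < \<epsilon>" and r: "1 \<le> loglog \<epsilon>"
  shows "measure M {\<omega> \<in> space M. 8 * (3 / 4) ^ m < norm (increment (2 ^ m) (strassen_path B \<epsilon> \<omega>) i)}
    \<le> sqrt 2 ^ CARD('k) * exp (- 16 * loglog \<epsilon>) * (1 / 4) ^ m"
proof -
  define h where "h = \<epsilon> / real (2 ^ m)"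
  define Q where "Q \<omega> = (norm (B (h * real (Suc i)) \<omega> - B (h * real i) \<omega>))\<^sup>2 / (2 * h)" for \<omega>
  have h: "0 < h" using \<epsilon> by (simp add: h_def)
  have r0: "0 < loglog \<epsilon>" using r by simp
  have Q: "Q \<omega> = (norm (increment (2 ^ m) (strassen_path B \<epsilon> \<omega>) i))\<^sup>2 * (2 ^ m / 2 * loglog \<epsilon>)" for \<omega>
    unfolding Q_def h_def using norm_increment_strassen_path[OF \<epsilon> r0, of "2 ^ m" B \<omega> i, symmetric] \<epsilon>
    by (simp add: mult_ac)
  have "8 * (3 / 4) ^ m < norm (increment (2 ^ m) (strassen_path B \<epsilon> \<omega>) i) \<longleftrightarrow> 32 * (9 / 8) ^ m * loglog \<epsilon> < Q \<omega>" for \<omega>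
  proof -
    have "8 * (3 / 4) ^ m < norm (increment (2 ^ m) (strassen_path B \<epsilon> \<omega>) i) \<longleftrightarrow>
        (8 * (3 / 4) ^ m)\<^sup>2 < (norm (increment (2 ^ m) (strassen_path B \<epsilon> \<omega>) i))\<^sup>2"
      by (subst (1 2) not_le[symmetric], subst power_mono_iff) auto
    also have "\<dots> \<longleftrightarrow> (8 * (3 / 4) ^ m)\<^sup>2 * (2 ^ m / 2 * loglog \<epsilon>) < Q \<omega>"
      unfolding Q using r0 by (intro mult_less_cancel_right_pos[symmetric]) simp
    also have "(8 * (3 / 4) ^ m)\<^sup>2 * (2 ^ m / 2 * loglog \<epsilon>) = 32 * (9 / 8) ^ m * loglog \<epsilon>"
    proof -
      have "2 ^ m * ((3 / 4 :: real) ^ m)\<^sup>2 = (9 / 8) ^ m"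
        by (simp add: power2_eq_square flip: power_mult_distrib)
      then show ?thesis by (simp add: power_mult_distrib)
    qed
    finally show ?thesis .
  qed
  then have "measure M {\<omega> \<in> space M. 8 * (3 / 4) ^ m < norm (increment (2 ^ m) (strassen_path B \<epsilon> \<omega>) i)}
      = measure M {\<omega> \<in> space M. 32 * (9 / 8) ^ m * loglog \<epsilon> < Q \<omega>}" by simp
  also have "\<dots> \<le> sqrt 2 ^ CARD('k) * exp (- (32 * (9 / 8) ^ m * loglog \<epsilon>) / 2)"
    using brownian_increment_tail[OF B, of "h * real i" "h * real (Suc i)" "32 * (9 / 8) ^ m * loglog \<epsilon>"] h
    by (simp add: Q_def algebra_simps)
  also have "\<dots> \<le> sqrt 2 ^ CARD('k) * (exp (- 16 * loglog \<epsilon>) * (1 / 4) ^ m)"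
  proof (intro mult_left_mono)
    have "1 + real m * (1 / 8) \<le> (1 + 1 / 8 :: real) ^ m" by (rule Bernoulli_inequality) simp
    then have "(1 + real m / 8) * loglog \<epsilon> \<le> (9 / 8) ^ m * loglog \<epsilon>" using r by (intro mult_right_mono) auto
    moreover have "real m * 1 \<le> real m * loglog \<epsilon>" using r by (intro mult_left_mono) auto
    ultimately have "16 * loglog \<epsilon> + 2 * real m \<le> 16 * (9 / 8) ^ m * loglog \<epsilon>" by (simp add: algebra_simps)
    then have "exp (- (32 * (9 / 8) ^ m * loglog \<epsilon>) / 2) \<le> exp (- 16 * loglog \<epsilon> + real m * (- 2))"
      by (subst exp_le_cancel_iff) linarith
    \<comment> \<open>\<open>exp (- 2) < 1/4\<close> leaves a geometric series after summing over the \<open>2\<^sup>m\<close> increments of level \<open>m\<close>.\<close>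
    also have "\<dots> = exp (- 16 * loglog \<epsilon>) * exp (- 2) ^ m" by (simp only: exp_add exp_of_nat_mult)
    also have "\<dots> \<le> exp (- 16 * loglog \<epsilon>) * (1 / 4) ^ m"
    proof (intro mult_left_mono power_mono)
      have "(2::real) \<le> exp 1" using exp_ge_add_one_self[of 1] by simp
      then have "2 * 2 \<le> exp 1 * exp (1::real)" by (intro mult_mono) auto
      then have "4 \<le> exp (2::real)" by (simp flip: exp_add)
      then show "exp (- 2) \<le> (1 / 4 :: real)" by (simp add: exp_minus field_simps)
    qed auto
    finally show "exp (- (32 * (9 / 8) ^ m * loglog \<epsilon>) / 2) \<le> exp (- 16 * loglog \<epsilon>) * (1 / 4) ^ m" .
  qed simp
  finally show ?thesis by (simp add: mult.assoc)
qed

lemma exceptional_event_tail: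
  fixes B :: "real \<Rightarrow> 'w \<Rightarrow> real^'k"
  assumes B: "standard_brownian_motion M B" and n: "0 < n" and \<eta>: "0 < \<eta>" "\<eta> \<le> 1"
  obtains K where "0 \<le> K" "\<And>\<epsilon>. \<lbrakk>0 < \<epsilon>; 1 \<le> loglog \<epsilon>\<rbrakk> \<Longrightarrow>
    measure M (exceptional_event M B \<eta> n \<epsilon>) \<le> K * exp (- (1 + \<eta> / 2) * loglog \<epsilon>)"
proof -
  interpret prob_space M using B by (rule brownian_prob_space)
  define K1 where "K1 = ((1 / sqrt (1 - (1 + \<eta> / 2) / (1 + \<eta>))) ^ CARD('k)) ^ n"
  define K2 where "K2 = 2 * sqrt 2 ^ CARD('k)"
  have "0 \<le> 1 - (1 + \<eta> / 2) / (1 + \<eta>)" using \<eta> by (simp add: field_simps)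
  then have K: "0 \<le> K1" "0 \<le> K2" by (auto simp: K1_def K2_def)
  show thesis
  proof (rule that[of "K1 + K2"])
    show "0 \<le> K1 + K2" using K by simp
    fix \<epsilon> :: real assume \<epsilon>: "0 < \<epsilon>" and r: "1 \<le> loglog \<epsilon>"
    define A where "A = {\<omega> \<in> space M. 1 + \<eta> < step_energy n (strassen_path B \<epsilon> \<omega>)}"
    define D where "D m i = {\<omega> \<in> space M. 8 * (3 / 4) ^ m < norm (increment (2 ^ m) (strassen_path B \<epsilon> \<omega>) i)}" for m i
    have [measurable]: "A \<in> sets M" "D m i \<in> sets M" for m i
      unfolding A_def D_def using exceptional_event_pieces_measurable[OF B] \<epsilon> by auto
    let ?q = "sqrt 2 ^ CARD('k) * exp (- 16 * loglog \<epsilon>)"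
    have D_le: "measure M (\<Union>i\<in>{..<2 ^ m}. D m i) \<le> ?q * (1 / 2) ^ m" for m
    proof -
      have "measure M (\<Union>i\<in>{..<2 ^ m}. D m i) \<le> (\<Sum>i<2 ^ m. measure M (D m i))"
        by (intro finite_measure_subadditive_finite) auto
      also have "\<dots> \<le> (\<Sum>i<(2::nat) ^ m. ?q * (1 / 4) ^ m)"
        unfolding D_def using \<epsilon> r by (intro sum_mono strassen_increment_tail[OF B])
      also have "\<dots> = ?q * (2 ^ m * (1 / 4) ^ m)" by (simp add: mult_ac)
      also have "2 ^ m * (1 / 4 :: real) ^ m = (1 / 2) ^ m" by (simp flip: power_mult_distrib)
      finally show ?thesis .
    qed
    have geo: "summable (\<lambda>m. ?q * (1 / 2 :: real) ^ m)" by (intro summable_mult summable_geometric) simp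
    have sumD: "summable (\<lambda>m. measure M (\<Union>i\<in>{..<2 ^ m}. D m i))"
      by (rule summable_comparison_test'[OF geo]) (use D_le in simp)
    have "measure M (\<Union>m. \<Union>i\<in>{..<2 ^ m}. D m i) \<le> (\<Sum>m. measure M (\<Union>i\<in>{..<2 ^ m}. D m i))"
      by (intro finite_measure_subadditive_countably sumD) auto
    also have "\<dots> \<le> (\<Sum>m. ?q * (1 / 2) ^ m)" by (intro suminf_le D_le sumD geo)
    also have "\<dots> = ?q * 2" using suminf_geometric[of "1 / 2 :: real"] by (subst suminf_mult) (auto intro: summable_geometric)
    also have "\<dots> = K2 * exp (- 16 * loglog \<epsilon>)" by (simp add: K2_def)
    also have "\<dots> \<le> K2 * exp (- (1 + \<eta> / 2) * loglog \<epsilon>)"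
    proof -
      have "(1 + \<eta> / 2) * loglog \<epsilon> \<le> 16 * loglog \<epsilon>" using \<eta> r by (intro mult_right_mono) auto
      then have "- 16 * loglog \<epsilon> \<le> - (1 + \<eta> / 2) * loglog \<epsilon>" by linarith
      then show ?thesis using K(2) by (intro mult_left_mono exp_le_cancel_iff[THEN iffD2])
    qed
    finally have "measure M (\<Union>m. \<Union>i\<in>{..<2 ^ m}. D m i) \<le> K2 * exp (- (1 + \<eta> / 2) * loglog \<epsilon>)" .
    moreover have "measure M A \<le> K1 * exp (- (1 + \<eta> / 2) * loglog \<epsilon>)"
      unfolding A_def K1_def using r by (intro strassen_energy_tail[OF B \<epsilon> _ n \<eta>(1)]) simp
    moreover have "measure M (exceptional_event M B \<eta> n \<epsilon>) \<le> measure M A + measure M (\<Union>m. \<Union>i\<in>{..<2 ^ m}. D m i)"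
      unfolding exceptional_event_def A_def[symmetric] D_def[symmetric]
      by (intro measure_Un_le) auto
    ultimately show "measure M (exceptional_event M B \<eta> n \<epsilon>) \<le> (K1 + K2) * exp (- (1 + \<eta> / 2) * loglog \<epsilon>)"
      by (simp add: distrib_right)
  qed
qed

text \<open>
  With \<open>q = 1 + \<eta>/2\<close>, the tail bound at \<open>\<epsilon> = c\<^sup>j\<close> is a multiple of
  \<open>exp (- q log log (1/\<epsilon>)) = (j log (1/c))\<^bsup>-q\<^esup>\<close>, which is summable because \<open>q > 1\<close>.
\<close>

lemma exceptional_events_finitely_often:
  fixes B :: "real \<Rightarrow> 'w \<Rightarrow> real^'k"
  assumes B: "standard_brownian_motion M B" and n: "0 < n" and \<eta>: "0 < \<eta>" "\<eta> \<le> 1" and c: "0 < c" "c < 1"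
  shows "AE \<omega> in M. eventually (\<lambda>j. \<omega> \<notin> exceptional_event M B \<eta> n (c ^ j)) sequentially"
proof -
  interpret prob_space M using B by (rule brownian_prob_space)
  obtain K where K: "0 \<le> K" "\<And>\<epsilon>. \<lbrakk>0 < \<epsilon>; 1 \<le> loglog \<epsilon>\<rbrakk> \<Longrightarrow>
    measure M (exceptional_event M B \<eta> n \<epsilon>) \<le> K * exp (- (1 + \<eta> / 2) * loglog \<epsilon>)"
    using exceptional_event_tail[OF B n \<eta>] by blast
  define l where "l = ln (1 / c)"
  have l: "0 < l" using c by (simp add: l_def)
  define q where "q = 1 + \<eta> / 2"
  have loglog_c: "loglog (c ^ j) = ln (real j * l)" for j
    using c by (simp add: loglog_def l_def ln_realpow flip: power_one_over)
  have "summable (\<lambda>j. measure M (exceptional_event M B \<eta> n (c ^ j)))"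
  proof (rule summable_comparison_test_ev)
    show "summable (\<lambda>j. K * l powr (- q) * real j powr (- q))"
      using \<eta> by (intro summable_mult) (simp add: summable_real_powr_iff q_def)
    show "\<forall>\<^sub>F j in sequentially. norm (measure M (exceptional_event M B \<eta> n (c ^ j))) \<le> K * l powr (- q) * real j powr (- q)"
      using eventually_ge_at_top[of "nat \<lceil>exp 1 / l\<rceil>"]
    proof eventually_elim
      case (elim j)
      then have "exp 1 / l \<le> real j" by linarith
      then have "exp 1 \<le> real j * l" using l by (simp add: field_simps)
      then have pos: "0 < real j * l" and "1 \<le> ln (real j * l)"
        using order_less_le_trans[OF exp_gt_zero, of 1 "real j * l"] by (auto simp: ln_ge_iff)
      then have "measure M (exceptional_event M B \<eta> n (c ^ j)) \<le> K * exp (- q * ln (real j * l))"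
        using K(2)[of "c ^ j"] c by (simp add: loglog_c q_def)
      also have "exp (- q * ln (real j * l)) = (real j * l) powr (- q)" using pos l by (auto simp: powr_def zero_less_mult_iff)
      also have "\<dots> = l powr (- q) * real j powr (- q)" using l by (simp add: powr_mult mult.commute)
      finally show ?case by (simp add: mult.assoc)
    qed
  qed
  then have "AE \<omega> in M. eventually (\<lambda>j. \<omega> \<in> space M - exceptional_event M B \<eta> n (c ^ j)) sequentially"
    using c by (intro borel_cantelli_AE1 exceptional_event_measurable[OF B]) (auto simp: emeasure_eq_measure)
  then show ?thesis by eventually_elim (auto elim: eventually_mono)
qed

section \<open>Confinement by compactness\<close>

lemma norm_matrix_vector_mult_le:
  fixes A :: "real^'k^'d"
  shows "norm (A *v v) \<le> norm A * norm v"
proof -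
  have "norm (A *v v) = L2_set (\<lambda>i. \<bar>A $ i \<bullet> v\<bar>) UNIV"
    by (simp add: norm_vec_def matrix_vector_mul_component)
  also have "\<dots> \<le> L2_set (\<lambda>i. norm v * norm (A $ i)) UNIV"
    using Cauchy_Schwarz_ineq2[of "A $ i" v for i] by (intro L2_set_mono) (auto simp: mult.commute)
  also have "\<dots> = norm A * norm v"
    by (subst L2_set_right_distrib[symmetric]) (auto simp: norm_vec_def mult.commute)
  finally show ?thesis .
qed

lemma norm_matrix_vector_diff_le:
  fixes A A' :: "real^'k^'d"
  shows "norm (A *v v - A' *v v') \<le> norm (A - A') * norm v + norm A' * norm (v - v')"
proof -
  have "A *v v - A' *v v' = (A - A') *v v + A' *v (v - v')"
    by (simp add: matrix_vector_mult_diff_rdistrib matrix_vector_mult_diff_distrib)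
  also have "norm \<dots> \<le> norm ((A - A') *v v) + norm (A' *v (v - v'))" by (rule norm_triangle_ineq)
  also have "\<dots> \<le> norm (A - A') * norm v + norm A' * norm (v - v')"
    by (intro add_mono norm_matrix_vector_mult_le)
  finally show ?thesis .
qed

text \<open>
  The modulus that chaining gives for the bounds in \<open>exceptional_event\<close>: \<open>56 = 7 \<cdot> 8\<close>.
\<close>

definition dyadic_modulus :: "(real \<Rightarrow> 'a::real_normed_vector) \<Rightarrow> bool" where
  "dyadic_modulus X \<longleftrightarrow>
    (\<forall>m. \<forall>s\<in>{0..1}. \<forall>t\<in>{0..1}. \<bar>s - t\<bar> \<le> 1 / 2 ^ m \<longrightarrow> norm (X s - X t) \<le> 56 * (3 / 4) ^ m)"

lemma dyadic_modulusD:
  "\<lbrakk>dyadic_modulus X; s \<in> {0..1}; t \<in> {0..1}; \<bar>s - t\<bar> \<le> 1 / 2 ^ m\<rbrakk> \<Longrightarrow> norm (X s - X t) \<le> 56 * (3 / 4) ^ m"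
  unfolding dyadic_modulus_def by blast

lemma dyadic_modulus_bound:
  assumes "dyadic_modulus X" "X 0 = 0" "t \<in> {0..1}"
  shows "norm (X t) \<le> 56"
  using dyadic_modulusD[OF assms(1), of t 0 0] assms(2,3) by simp

lemma ex_three_quarter_power_less:
  assumes "0 < (e::real)"
  obtains m where "56 * (3 / 4) ^ m < e"
proof -
  have "0 < e / 56" using assms by simp
  then obtain m where "(3 / 4 :: real) ^ m < e / 56" using real_arch_pow_inv[of "e / 56" "3 / 4"] by auto
  then show thesis by (intro that[of m]) simp
qed

lemma constant_diffusion_limit:
  fixes \<sigma> :: "real^'d \<Rightarrow> real^'k^'d"
  assumes lim: "\<And>K. compact K \<and> K \<subseteq> U_star \<Longrightarrow> uniform_limit K (\<lambda>\<epsilon> _. \<sigma>\<^sub>\<epsilon> \<epsilon>) \<sigma> (at_right 0)"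
    and z: "z \<in> U_star"
  shows "(\<sigma>\<^sub>\<epsilon> \<longlongrightarrow> \<sigma> z) (at_right (0::real))"
  using tendsto_uniform_limitI[OF lim[of "{z}"], of z] z by simp

text \<open>
  Since \<open>\<sigma>\<close> is constant, the control term of the skeleton equation integrates to \<open>\<sigma>0 f\<close>, and the
  skeleton equation is the additive equation driven by \<open>\<sigma>0 f\<close>.
\<close>

lemma limit_set_from_bounded_energy:
  fixes b :: "real^'d \<Rightarrow> real^'d" and \<sigma> :: "real^'d \<Rightarrow> real^'k^'d"
  assumes b: "locally_lipschitz_on U b" and U: "open U" and x: "x \<in> U"
    and \<sigma>: "\<And>z. z \<in> U \<Longrightarrow> \<sigma> z = \<sigma>0"
    and f: "continuous_on {0..1} f" "f 0 = 0" and energy: "\<And>p. step_energy (2 ^ p) f \<le> 1"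
  obtains g where "additive_solution U b (\<lambda>t. \<sigma>0 *v f t) x g" "g \<in> limit_set U b \<sigma> x"
proof -
  obtain f' where f': "L2_derivative f f'" "1 / 2 * (LINT s:{0..1}|lborel. (norm (f' s))\<^sup>2) \<le> 1"
    using L2_derivative_of_bounded_energy[OF f(1) energy] by blast
  have "continuous_on {0..1} (\<lambda>t. \<sigma>0 *v f t)"
    by (intro continuous_on_compose2[OF matrix_vector_mult_linear_continuous_on f(1)]) auto
  moreover have "\<sigma>0 *v f 0 = 0" by (simp add: f(2))
  ultimately obtain g where g: "additive_solution U b (\<lambda>t. \<sigma>0 *v f t) x g"
    using maximal_solution_exists[OF b U x] by blast
  have g_path: "g \<in> path_space_from 1 U x" using g unfolding additive_solution_def by blast
  then have g_space: "g \<in> path_space 1 U" "g 0 = Some x" unfolding path_space_from_def by blast+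
  have b_cont: "continuous_on U b" using b U by (rule locally_lipschitz_on_imp_continuous_on)
  have f'_int: "set_integrable lborel {0..t} f'" if t: "t \<in> {0..1}" for t
  proof -
    have sq: "set_integrable lborel {0..1} (\<lambda>s. (norm (f' s))\<^sup>2)" "set_borel_measurable lborel {0..1} f'"
      using f'(1) unfolding L2_derivative_def by blast+
    have "set_integrable lborel {0..1} (\<lambda>s. 1 + (norm (f' s))\<^sup>2)"
      by (intro set_integral_add sq) (simp add: set_integrable_def)
    then have "set_integrable lborel {0..1} f'"
      unfolding set_integrable_def
    proof (rule Bochner_Integration.integrable_bound)
      show "(\<lambda>s. indicator {0..1} s *\<^sub>R f' s) \<in> borel_measurable lborel"
        using sq(2) unfolding set_borel_measurable_def .
      have "norm (f' s) \<le> 1 + (norm (f' s))\<^sup>2" for s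
        using sum_squares_ge_zero[of "norm (f' s) - 1" 0] norm_ge_zero[of "f' s"]
        by (simp add: power2_eq_square algebra_simps) (use zero_le_square[of "norm (f' s)"] in linarith)
      then show "AE s in lborel. norm (indicator {0..1} s *\<^sub>R f' s) \<le> norm (indicator {0..1} s *\<^sub>R (1 + (norm (f' s))\<^sup>2))"
        by (auto simp: indicator_def)
    qed
    then show ?thesis by (rule set_integrable_subset) (use t in auto)
  qed
  have "skeleton_solution U b \<sigma> x f' g"
    unfolding skeleton_solution_def
  proof (intro conjI ballI impI)
    show "g \<in> path_space_from 1 U x" by (rule g_path)
    fix t assume t: "t \<in> {0..1}" "ereal t < exit_time 1 g"
    then have def: "g t \<noteq> None" using less_exit_time_iff[OF g_space(1) U] by blast
    note form = additive_solution_integral_form[OF g U b_cont t(1) def]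
    have "continuous_on {0..t} (\<lambda>s. b (the (g s)))"
      by (intro continuous_on_compose2[OF b_cont form(1)] form(2))
    then have b_int: "set_integrable lborel {0..t} (\<lambda>s. b (the (g s)))"
      by (rule borel_integrable_atLeastAtMost')
    have \<sigma>_int: "set_integrable lborel {0..t} (\<lambda>s. \<sigma>0 *v f' s)"
      and \<sigma>_eq: "(LINT s:{0..t}|lborel. \<sigma>0 *v f' s) = \<sigma>0 *v (LINT s:{0..t}|lborel. f' s)"
    proof -
      have bl: "bounded_linear ((*v) \<sigma>0)" by simp
      have eq: "(\<lambda>s. indicator {0..t} s *\<^sub>R (\<sigma>0 *v f' s)) = (\<lambda>s. \<sigma>0 *v (indicator {0..t} s *\<^sub>R f' s))"
        by (auto simp: indicator_def)
      show "set_integrable lborel {0..t} (\<lambda>s. \<sigma>0 *v f' s)"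
        unfolding set_integrable_def eq
        by (rule integrable_bounded_linear[OF bl]) (use f'_int[OF t(1)] in \<open>simp add: set_integrable_def\<close>)
      show "(LINT s:{0..t}|lborel. \<sigma>0 *v f' s) = \<sigma>0 *v (LINT s:{0..t}|lborel. f' s)"
        unfolding set_lebesgue_integral_def eq
        by (rule integral_bounded_linear[OF bl]) (use f'_int[OF t(1)] in \<open>simp add: set_integrable_def\<close>)
    qed
    have "(LINT s:{0..t}|lborel. b (the (g s)) + \<sigma> (the (g s)) *v f' s) = (LINT s:{0..t}|lborel. b (the (g s)) + \<sigma>0 *v f' s)"
    proof (intro set_lebesgue_integral_cong ballI allI impI)
      fix s assume "s \<in> {0..t}"
      then have "the (g s) \<in> U" using form(2) by blast
      then show "b (the (g s)) + \<sigma> (the (g s)) *v f' s = b (the (g s)) + \<sigma>0 *v f' s" by (simp add: \<sigma>)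
    qed simp
    also have "\<dots> = (LINT s:{0..t}|lborel. b (the (g s))) + \<sigma>0 *v (LINT s:{0..t}|lborel. f' s)"
      by (subst set_integral_add(2)[OF b_int \<sigma>_int]) (simp add: \<sigma>_eq)
    also have "(LINT s:{0..t}|lborel. f' s) = f t"
      using f'(1) t(1) f(2) unfolding L2_derivative_def by auto
    finally have "(LINT s:{0..t}|lborel. b (the (g s)) + \<sigma> (the (g s)) *v f' s) = (LINT s:{0..t}|lborel. b (the (g s))) + \<sigma>0 *v f t" .
    moreover have "the (g t) = x + (LINT s:{0..t}|lborel. b (the (g s))) + \<sigma>0 *v f t"
      using g t unfolding additive_solution_def by blast
    ultimately show "the (g t) = x + (LINT s:{0..t}|lborel. b (the (g s)) + \<sigma> (the (g s)) *v f' s)"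
      by (simp add: add.assoc)
  qed
  then have "rate U b \<sigma> g \<le> ereal (1 / 2 * (LINT s:{0..1}|lborel. (norm (f' s))\<^sup>2))"
    unfolding rate_def using f'(1) g_space(2) by (intro Inf_lower) auto
  also have "\<dots> \<le> 1" using f'(2) by (simp add: one_ereal_def)
  finally have "g \<in> limit_set U b \<sigma> x" using g_path unfolding limit_set_def by blast
  with g show thesis by (rule that)
qed

text \<open>
  One number \<open>N\<close> controls the fineness of the partition, the excess energy, the distance of the
  driving path \<open>W\<close> from a regular path \<open>X\<close>, and \<open>\<epsilon>\<close>.  If no \<open>N\<close> works, a sequence of counterexamples has
  a subsequence whose regular paths converge uniformly to some \<open>f\<close>.  Refining a partition increases
  the energy, so each dyadic energy of \<open>f\<close> is at most \<open>1\<close>, and the solution driven by \<open>f\<close> lies in the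
  limit set.  It keeps a positive distance from the complement of \<open>L\<close>, which contradicts the
  exits of the nearby solutions.
\<close>

lemma exists_uniform_confinement:
  fixes b :: "real^'d \<Rightarrow> real^'d" and \<sigma> :: "real^'d \<Rightarrow> real^'k^'d"
  assumes coefficients: "coefficient_assumption eps_star U_star b \<sigma> U b\<^sub>\<epsilon> (\<lambda>\<epsilon> _. \<sigma>\<^sub>\<epsilon> \<epsilon>)"
    and L: "compact L" "L \<subseteq> U_star" "x \<in> interior L"
    and horizon: "t_star \<in> {0<..1}"
      "\<forall>g\<in>limit_set U_star b \<sigma> x. g ` {0..t_star} \<subseteq> Some ` interior L"
  obtains N :: nat where "\<And>X W \<epsilon> y t.
    \<lbrakk>continuous_on {0..1} X; X 0 = 0; dyadic_modulus X; step_energy (2 ^ N) X \<le> 1 + 1 / (real N + 1);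
     \<And>t. t \<in> {0..1} \<Longrightarrow> norm (W t - X t) \<le> 1 / (real N + 1);
     0 < \<epsilon>; \<epsilon> \<le> 1 / (real N + 1); \<epsilon> \<le> eps_star;
     additive_solution (U \<epsilon>) (b\<^sub>\<epsilon> \<epsilon>) (\<lambda>t. \<sigma>\<^sub>\<epsilon> \<epsilon> *v W t) x y; t \<in> {0..t_star}\<rbrakk>
    \<Longrightarrow> y t \<in> Some ` interior L"
proof -
  define good where "good N X W \<epsilon> y \<longleftrightarrow> continuous_on {0..1} X \<and> X 0 = 0 \<and> dyadic_modulus X \<and>
     step_energy (2 ^ N) X \<le> 1 + 1 / (real N + 1) \<and>
     (\<forall>t\<in>{0..1}. norm (W t - X t) \<le> 1 / (real N + 1)) \<and>
     0 < \<epsilon> \<and> \<epsilon> \<le> 1 / (real N + 1) \<and> \<epsilon> \<le> eps_star \<and>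
     additive_solution (U \<epsilon>) (b\<^sub>\<epsilon> \<epsilon>) (\<lambda>t. \<sigma>\<^sub>\<epsilon> \<epsilon> *v W t) x y" for N and X W :: "real \<Rightarrow> real^'k" and \<epsilon> y
  have U_star: "open U_star" and b_lip: "locally_lipschitz_on U_star b"
    using coefficients unfolding coefficient_assumption_def by blast+
  have U_eps: "open (U \<epsilon>)" "U_star \<subseteq> U \<epsilon>" "locally_lipschitz_on (U \<epsilon>) (b\<^sub>\<epsilon> \<epsilon>)" if "0 < \<epsilon>" "\<epsilon> \<le> eps_star" for \<epsilon>
    using coefficients that unfolding coefficient_assumption_def by auto
  have b_lim: "uniform_limit L b\<^sub>\<epsilon> b (at_right 0)"
    using coefficients L unfolding coefficient_assumption_def by blast
  have x: "x \<in> U_star" using L interior_subset by blast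
  have \<sigma>_lim: "(\<sigma>\<^sub>\<epsilon> \<longlongrightarrow> \<sigma> z) (at_right 0)" if "z \<in> U_star" for z
  proof (rule constant_diffusion_limit[OF _ that])
    show "uniform_limit K (\<lambda>\<epsilon> _. \<sigma>\<^sub>\<epsilon> \<epsilon>) \<sigma> (at_right 0)" if "compact K \<and> K \<subseteq> U_star" for K
      using coefficients that unfolding coefficient_assumption_def by blast
  qed
  define \<sigma>0 where "\<sigma>0 = \<sigma> x"
  have \<sigma>: "\<sigma> z = \<sigma>0" if "z \<in> U_star" for z
    unfolding \<sigma>0_def using tendsto_unique[OF _ \<sigma>_lim[OF that] \<sigma>_lim[OF x]] by simp
  have "\<exists>N. \<forall>X W \<epsilon> y. good N X W \<epsilon> y \<longrightarrow> (\<forall>t\<in>{0..t_star}. y t \<in> Some ` interior L)"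
  proof (rule ccontr)
    assume "\<not> ?thesis"
    then have "\<forall>N. \<exists>X W \<epsilon> y. good N X W \<epsilon> y \<and> \<not> (\<forall>t\<in>{0..t_star}. y t \<in> Some ` interior L)" by blast
    then obtain X W \<epsilon> y where good: "\<And>N. good N (X N) (W N) (\<epsilon> N) (y N)"
      and exits: "\<And>N. \<not> (\<forall>t\<in>{0..t_star}. y N t \<in> Some ` interior L)" by metis
    have X: "continuous_on {0..1} (X n)" "X n 0 = 0" "dyadic_modulus (X n)"
      "step_energy (2 ^ n) (X n) \<le> 1 + 1 / (real n + 1)" for n
      using good[of n] unfolding good_def by blast+
    have W: "norm (W n t - X n t) \<le> 1 / (real n + 1)" if "t \<in> {0..1}" for n t
      using good[of n] that unfolding good_def by blast
    have \<epsilon>: "0 < \<epsilon> n" "\<epsilon> n \<le> 1 / (real n + 1)" "\<epsilon> n \<le> eps_star" for n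
      using good[of n] unfolding good_def by blast+
    have y: "additive_solution (U (\<epsilon> n)) (b\<^sub>\<epsilon> (\<epsilon> n)) (\<lambda>t. \<sigma>\<^sub>\<epsilon> (\<epsilon> n) *v W n t) x (y n)" for n
      using good[of n] unfolding good_def by blast
    have equicont: "\<exists>d>0. \<forall>n s. s \<in> {0..1} \<and> norm (t - s) < d \<longrightarrow> norm (X n t - X n s) < e"
      if t: "t \<in> {0..1}" and e: "0 < e" for t e
    proof -
      obtain m where m: "56 * (3 / 4) ^ m < e" using ex_three_quarter_power_less[OF e] .
      have "norm (X n t - X n s) < e" if "s \<in> {0..1}" "norm (t - s) < 1 / 2 ^ m" for n s
        using dyadic_modulusD[OF X(3) t that(1), of m n] that(2) m by auto
      then show ?thesis by (intro exI[of _ "1 / 2 ^ m"]) auto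
    qed
    obtain f k where f: "continuous_on {0..1} f" and k: "strict_mono (k :: nat \<Rightarrow> nat)"
      and unif: "\<And>e. 0 < e \<Longrightarrow> \<exists>N. \<forall>n t. N \<le> n \<and> t \<in> {0..1} \<longrightarrow> norm (X (k n) t - f t) < e"
      by (rule Arzela_Ascoli[of "{0..1}" X 56, OF compact_Icc dyadic_modulus_bound[OF X(3) X(2)] equicont]) blast+
    have X_lim: "(\<lambda>n. X (k n) t) \<longlonglongrightarrow> f t" if "t \<in> {0..1}" for t
      using unif that by (intro LIMSEQ_I) blast
    have f0: "f 0 = 0" using LIMSEQ_unique[OF X_lim[of 0]] X(2) by simp
    have inv_lim: "(\<lambda>n. 1 / (real (k n) + 1)) \<longlonglongrightarrow> 0"
      using LIMSEQ_subseq_LIMSEQ[OF LIMSEQ_inverse_real_of_nat k]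
      by (simp add: o_def inverse_eq_divide add.commute)
    have energy: "step_energy (2 ^ p) f \<le> 1" for p
    proof (rule LIMSEQ_le)
      have "(\<lambda>n. increment (2 ^ p) (X (k n)) i) \<longlonglongrightarrow> increment (2 ^ p) f i" if "i < 2 ^ p" for i
      proof -
        have "real i + 1 \<le> 2 ^ p"
        proof -
          have "real (Suc i) \<le> real (2 ^ p)" using that by (simp only: of_nat_le_iff Suc_le_eq)
          then show ?thesis by simp
        qed
        then show ?thesis using that unfolding increment_def by (intro tendsto_diff X_lim) auto
      qed
      then show "(\<lambda>n. step_energy (2 ^ p) (X (k n))) \<longlonglongrightarrow> step_energy (2 ^ p) f"
        unfolding step_energy_def by (intro tendsto_intros) auto
      show "(\<lambda>n. 1 + 1 / (real (k n) + 1)) \<longlonglongrightarrow> 1"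
        using tendsto_add[OF tendsto_const[of 1] inv_lim] by simp
      show "\<exists>N. \<forall>n\<ge>N. step_energy (2 ^ p) (X (k n)) \<le> 1 + 1 / (real (k n) + 1)"
      proof (intro exI allI impI)
        fix n assume "p \<le> n"
        then have pk: "p \<le> k n" using seq_suble[OF k, of n] by linarith
        have "step_energy (2 ^ p) (X (k n)) \<le> step_energy (2 ^ p * 2 ^ (k n - p)) (X (k n))"
          by (rule step_energy_refine) auto
        also have "(2::nat) ^ p * 2 ^ (k n - p) = 2 ^ k n" using pk by (simp flip: power_add)
        finally show "step_energy (2 ^ p) (X (k n)) \<le> 1 + 1 / (real (k n) + 1)" using X(4)[of "k n"] by linarith
      qed
    qed
    obtain g where g: "additive_solution U_star b (\<lambda>t. \<sigma>0 *v f t) x g" "g \<in> limit_set U_star b \<sigma> x"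
      using limit_set_from_bounded_energy[where \<sigma> = \<sigma>, OF b_lip U_star x \<sigma> f f0 energy] by blast
    have g_in: "g t \<in> Some ` interior L" if "t \<in> {0..t_star}" for t
      using horizon(2) g(2) that by blast
    have t_star: "0 \<le> t_star" "t_star \<le> 1" using horizon(1) by auto
    have "t_star \<in> {0..1}" "g t_star \<noteq> None" using g_in[of t_star] t_star by auto
    note form = additive_solution_integral_form[OF g(1) U_star locally_lipschitz_on_imp_continuous_on[OF b_lip U_star] this]
    define G where "G t = the (g t)" for t
    have "compact (G ` {0..t_star})" unfolding G_def by (intro compact_continuous_image form(1) compact_Icc)
    moreover have "G ` {0..t_star} \<subseteq> interior L" using g_in by (fastforce simp: G_def)
    ultimately obtain \<rho> where \<rho>: "0 < \<rho>" "(\<Union>z\<in>G ` {0..t_star}. cball z \<rho>) \<subseteq> interior L"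
      using compact_subset_open_imp_cball_epsilon_subset[OF _ open_interior] by blast
    obtain C where C: "C-lipschitz_on L b" using b_lip L unfolding locally_lipschitz_on_def by blast
    define a where "a = \<rho> / (2 * exp C)"
    have a: "0 < a" "(a + a) * exp C \<le> \<rho>" using \<rho>(1) by (auto simp: a_def)
    have \<epsilon>_lim: "filterlim (\<lambda>n. \<epsilon> (k n)) (at_right 0) sequentially"
    proof (rule filterlim_at_withinI)
      show "(\<lambda>n. \<epsilon> (k n)) \<longlonglongrightarrow> 0"
        by (rule tendsto_sandwich[OF _ _ tendsto_const inv_lim]) (use \<epsilon> in \<open>auto intro: always_eventually order_less_imp_le\<close>)
    qed (use \<epsilon>(1) in \<open>auto simp: less_imp_neq[symmetric]\<close>)
    have drift: "\<forall>\<^sub>F n in sequentially. \<forall>z\<in>L. dist (b\<^sub>\<epsilon> (\<epsilon> (k n)) z) (b z) < a"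
      using filterlim_iff[THEN iffD1, OF \<epsilon>_lim] uniform_limitD[OF b_lim a(1)] by blast
    have \<sigma>k: "(\<lambda>n. \<sigma>\<^sub>\<epsilon> (\<epsilon> (k n))) \<longlonglongrightarrow> \<sigma>0"
      unfolding \<sigma>0_def by (rule filterlim_compose[OF \<sigma>_lim[OF x] \<epsilon>_lim])
    have noise: "\<forall>\<^sub>F n in sequentially. \<forall>t\<in>{0..1}. norm (\<sigma>\<^sub>\<epsilon> (\<epsilon> (k n)) *v W (k n) t - \<sigma>0 *v f t) \<le> a"
    proof -
      define s where "s = a / (2 * (norm \<sigma>0 + 1))"
      have pos: "0 < norm \<sigma>0 + 1" by (rule add_nonneg_pos) auto
      then have s: "0 < s" unfolding s_def using a(1) by (intro divide_pos_pos mult_pos_pos) auto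
      have "\<forall>\<^sub>F n in sequentially. norm (\<sigma>\<^sub>\<epsilon> (\<epsilon> (k n)) - \<sigma>0) < a / (2 * 57)"
        using tendstoD[OF \<sigma>k, of "a / (2 * 57)"] a(1) by (simp add: dist_norm)
      moreover have "\<forall>\<^sub>F n in sequentially. 1 / (real (k n) + 1) < s / 2"
        using order_tendstoD(2)[OF inv_lim, of "s / 2"] s by simp
      moreover have "\<forall>\<^sub>F n in sequentially. \<forall>t\<in>{0..1}. norm (X (k n) t - f t) < s / 2"
      proof -
        obtain N where "\<forall>n t. N \<le> n \<and> t \<in> {0..1} \<longrightarrow> norm (X (k n) t - f t) < s / 2"
          using unif[of "s / 2"] s by auto
        then show ?thesis unfolding eventually_sequentially by blast
      qed
      ultimately show ?thesis
      proof eventually_elim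
        case (elim n)
        show ?case
        proof
          fix t :: real assume t: "t \<in> {0..1}"
          have "norm (W (k n) t) \<le> norm (W (k n) t - X (k n) t) + norm (X (k n) t)"
            using norm_triangle_ineq[of "W (k n) t - X (k n) t" "X (k n) t"] by simp
          also have "\<dots> \<le> 1 + 56"
            using W[OF t, of "k n"] dyadic_modulus_bound[OF X(3) X(2) t, of "k n"]
            by (intro add_mono) (auto intro: order_trans)
          finally have W57: "norm (W (k n) t) \<le> 57" by simp
          have "norm (W (k n) t - f t) \<le> norm (W (k n) t - X (k n) t) + norm (X (k n) t - f t)"
            using norm_triangle_ineq[of "W (k n) t - X (k n) t" "X (k n) t - f t"] by simp
          also have "\<dots> \<le> s" using W[OF t, of "k n"] elim(2) elim(3) t by fastforce
          finally have Wf: "norm (W (k n) t - f t) \<le> s" .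
          have "norm (\<sigma>\<^sub>\<epsilon> (\<epsilon> (k n)) *v W (k n) t - \<sigma>0 *v f t)
              \<le> norm (\<sigma>\<^sub>\<epsilon> (\<epsilon> (k n)) - \<sigma>0) * norm (W (k n) t) + norm \<sigma>0 * norm (W (k n) t - f t)"
            by (rule norm_matrix_vector_diff_le)
          also have "\<dots> \<le> a / (2 * 57) * 57 + (norm \<sigma>0 + 1) * s"
            using elim(1) W57 Wf s a(1) by (intro add_mono mult_mono) auto
          also have "\<dots> = a"
          proof -
            have "norm \<sigma>0 + 1 \<noteq> 0" using pos by simp
            then show ?thesis by (simp add: s_def field_simps)
          qed
          finally show "norm (\<sigma>\<^sub>\<epsilon> (\<epsilon> (k n)) *v W (k n) t - \<sigma>0 *v f t) \<le> a" .
        qed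
      qed
    qed
    obtain n where n: "\<forall>z\<in>L. dist (b\<^sub>\<epsilon> (\<epsilon> (k n)) z) (b z) < a"
      "\<forall>t\<in>{0..1}. norm (\<sigma>\<^sub>\<epsilon> (\<epsilon> (k n)) *v W (k n) t - \<sigma>0 *v f t) \<le> a"
      using eventually_happens'[OF sequentially_bot eventually_conj[OF drift noise]] by blast
    have "y (k n) t \<in> Some ` interior L" if t: "t \<in> {0..t_star}" for t
    proof -
      let ?e = "\<epsilon> (k n)"
      note Ue = U_eps[OF \<epsilon>(1,3), of "k n"]
      have "y (k n) t \<in> Some ` interior L \<and> norm (the (y (k n) t) - G t) \<le> (a + a) * exp C"
      proof (rule additive_solution_stays_close[OF y Ue(1) locally_lipschitz_on_imp_continuous_on[OF Ue(3,1)] L(1) _ C])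
        show "L \<subseteq> U ?e" using L(2) Ue(2) by blast
        show "norm (b\<^sub>\<epsilon> ?e z - b z) \<le> a" if "z \<in> L" for z using n(1) that by (auto simp: dist_norm intro: order_less_imp_le)
        show "norm (\<sigma>\<^sub>\<epsilon> ?e *v W (k n) u - \<sigma>0 *v f u) \<le> a" if "u \<in> {0..t_star}" for u using n(2) that t_star by auto
        show "continuous_on {0..t_star} G" unfolding G_def by (rule form(1))
        show "G u = x + integral {0..u} (\<lambda>s. b (G s)) + \<sigma>0 *v f u" if "u \<in> {0..t_star}" for u
          unfolding G_def using form(3)[OF that] .
        show "cball (G u) \<rho> \<subseteq> interior L" if "u \<in> {0..t_star}" for u using \<rho>(2) that by blast
      qed (use t_star L(3) a \<rho>(1) t in auto)
      then show ?thesis by blast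
    qed
    then show False using exits by blast
  qed
  then obtain N where N: "\<And>X W \<epsilon> y. good N X W \<epsilon> y \<Longrightarrow> \<forall>t\<in>{0..t_star}. y t \<in> Some ` interior L" by blast
  show thesis
    by (rule that[of N]) (use N in \<open>unfold good_def, blast\<close>)
qed

section \<open>Between consecutive powers\<close>

lemma matrix_strassen_path:
  "(1 / sqrt (loglog \<epsilon>)) *\<^sub>R (A *v rescaled B \<epsilon> t \<omega>) = A *v strassen_path B \<epsilon> \<omega> t"
  by (simp add: strassen_path_def matrix_vector_mult_scaleR)

lemma loglog_antimono:
  assumes "0 < \<epsilon>" "\<epsilon> \<le> \<epsilon>'" "\<epsilon>' < 1"
  shows "loglog \<epsilon>' \<le> loglog \<epsilon>"
proof -
  have "0 < ln (1 / \<epsilon>')" using assms by simp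
  moreover have "ln (1 / \<epsilon>') \<le> ln (1 / \<epsilon>)" using assms by (simp add: frac_le)
  ultimately show ?thesis unfolding loglog_def by simp
qed

lemma abs_minus_one_le_abs_square_minus_one:
  fixes k :: real
  assumes "0 \<le> k"
  shows "\<bar>k - 1\<bar> \<le> \<bar>k\<^sup>2 - 1\<bar>"
proof -
  have "k\<^sup>2 - 1 = (k - 1) * (k + 1)" by (simp add: power2_eq_square algebra_simps)
  then have "\<bar>k\<^sup>2 - 1\<bar> = \<bar>k - 1\<bar> * (k + 1)" using assms by (simp add: abs_mult)
  moreover have "\<bar>k - 1\<bar> * 1 \<le> \<bar>k - 1\<bar> * (k + 1)" using assms by (intro mult_left_mono) auto
  ultimately show ?thesis by simp
qed

text \<open>
  With \<open>u = \<epsilon> / c\<^sup>j\<close>, the path at \<open>\<epsilon>\<close> is \<open>k X (u t)\<close>, where \<open>X\<close> is the path at \<open>c\<^sup>j\<close> and \<open>k\<^sup>2\<close> is \<open>1/u\<close> times a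
  quotient of iterated logarithms that tends to \<open>1\<close>.  The time change costs
  the modulus of \<open>X\<close> at \<open>1 - c\<close>, and the factor costs at most \<open>56 \<bar>k - 1\<bar>\<close>.  The constant \<open>c\<^sub>0\<close> depends on
  \<open>\<gamma>\<close> only, because the modulus is the same for all paths.
\<close>

lemma strassen_path_between_powers:
  assumes \<gamma>: "0 < (\<gamma>::real)"
  shows "\<exists>c\<^sub>0\<in>{0<..<1}. \<forall>c\<in>{c\<^sub>0<..<1}. \<exists>j0. \<forall>j\<ge>j0. \<forall>\<epsilon>\<in>{c ^ (j + 1)..c ^ j}.
    \<forall>B :: real \<Rightarrow> 'w \<Rightarrow> real^'k. \<forall>\<omega>. strassen_path B (c ^ j) \<omega> 0 = 0 \<and> dyadic_modulus (strassen_path B (c ^ j) \<omega>) \<longrightarrow>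
      (\<forall>t\<in>{0..1}. norm (strassen_path B \<epsilon> \<omega> t - strassen_path B (c ^ j) \<omega> t) \<le> \<gamma>)"
    (is "\<exists>c\<^sub>0\<in>_. \<forall>c\<in>_. ?P c")
proof -
  obtain m where m: "56 * (3 / 4 :: real) ^ m < \<gamma> / 2" using ex_three_quarter_power_less[of "\<gamma> / 2"] \<gamma> by auto
  define q where "q = \<gamma> / 112"
  have q: "0 < q" using \<gamma> by (simp add: q_def)
  define c\<^sub>0 where "c\<^sub>0 = max (1 / 2) (max (1 - 1 / 2 ^ m) (1 / (1 + q)))"
  show ?thesis
  proof (intro bexI[of _ c\<^sub>0] ballI)
    show "c\<^sub>0 \<in> {0<..<1}" using q by (auto simp: c\<^sub>0_def less_max_iff_disj)
    fix c assume "c \<in> {c\<^sub>0<..<1}"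
    then have c: "0 < c" "c < 1" "1 - c \<le> 1 / 2 ^ m" "1 / (1 + q) \<le> c" by (auto simp: c\<^sub>0_def)
    define l where "l = ln (1 / c)"
    have l: "0 < l" using c by (simp add: l_def)
    have loglog_c: "loglog (c ^ j) = ln (real j * l)" for j
      using c by (simp add: loglog_def l_def ln_realpow flip: power_one_over)
    have ratio: "(\<lambda>j. ln (real j * l) / ln (real (Suc j) * l)) \<longlonglongrightarrow> 1"
      using l by real_asymp
    have grow: "filterlim (\<lambda>j. ln (real j * l)) at_top sequentially"
      using l by real_asymp
    have "\<forall>\<^sub>F j in sequentially. 1 - q < ln (real j * l) / ln (real (Suc j) * l) \<and> 1 \<le> ln (real j * l) \<and> 1 \<le> j"
      using order_tendstoD(1)[OF ratio, of "1 - q"] grow q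
      by (intro eventually_conj eventually_ge_at_top) (auto simp: filterlim_at_top)
    then obtain j0 where j0: "\<And>j. j0 \<le> j \<Longrightarrow> 1 - q < ln (real j * l) / ln (real (Suc j) * l)"
      "\<And>j. j0 \<le> j \<Longrightarrow> 1 \<le> ln (real j * l)" "\<And>j. j0 \<le> j \<Longrightarrow> 1 \<le> j"
      unfolding eventually_sequentially by blast
    show "?P c"
    proof (intro exI[of _ j0] allI impI ballI, elim conjE)
      fix j \<epsilon> t and B :: "real \<Rightarrow> 'w \<Rightarrow> real^'k" and \<omega>
      assume j: "j0 \<le> j" and \<epsilon>: "\<epsilon> \<in> {c ^ (j + 1)..c ^ j}" and t: "t \<in> {0..1::real}"
        and X0: "strassen_path B (c ^ j) \<omega> 0 = 0" and X: "dyadic_modulus (strassen_path B (c ^ j) \<omega>)"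
      define X where "X = strassen_path B (c ^ j) \<omega>"
      define u where "u = \<epsilon> / c ^ j"
      have cj: "0 < c ^ j" "c ^ j < 1" "0 < c ^ (j + 1)" using c j0(3)[OF j] by (auto simp: power_less_one_iff)
      have \<epsilon>0: "0 < \<epsilon>" "\<epsilon> \<le> c ^ j" "\<epsilon> < 1" using \<epsilon> cj by auto
      have u: "c \<le> u" "u \<le> 1" using \<epsilon> cj by (auto simp: u_def field_simps)
      have rj: "1 \<le> loglog (c ^ j)" using j0(2)[OF j] by (simp add: loglog_c)
      have r\<epsilon>: "loglog (c ^ j) \<le> loglog \<epsilon>" by (rule loglog_antimono) (use \<epsilon>0 cj in auto)
      have rj1: "loglog \<epsilon> \<le> loglog (c ^ Suc j)" by (rule loglog_antimono) (use \<epsilon>0 \<epsilon> cj in auto)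
      define k where "k = sqrt (c ^ j * loglog (c ^ j)) / sqrt (\<epsilon> * loglog \<epsilon>)"
      have k0: "0 \<le> k" using \<epsilon>0 cj rj r\<epsilon> by (simp add: k_def)
      have k2: "k\<^sup>2 = (1 / u) * (loglog (c ^ j) / loglog \<epsilon>)"
        using \<epsilon>0 cj rj r\<epsilon> by (simp add: k_def u_def power_divide)
      have k_le: "k\<^sup>2 \<le> 1 + q"
      proof -
        have "k\<^sup>2 \<le> (1 / u) * 1" unfolding k2 using r\<epsilon> rj u c by (intro mult_left_mono) auto
        also have "\<dots> \<le> 1 / c" using u c by (simp add: frac_le)
        also have "\<dots> \<le> 1 + q" using c q by (simp add: field_simps)
        finally show ?thesis .
      qed
      have k_ge: "1 - q \<le> k\<^sup>2"
      proof -
        have "1 - q \<le> loglog (c ^ j) / loglog (c ^ Suc j)" using j0(1)[OF j] by (simp only: loglog_c)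
        also have "\<dots> \<le> loglog (c ^ j) / loglog \<epsilon>" using rj r\<epsilon> rj1 by (intro divide_left_mono) auto
        also have "\<dots> \<le> k\<^sup>2"
        proof -
          have "1 * (loglog (c ^ j) / loglog \<epsilon>) \<le> (1 / u) * (loglog (c ^ j) / loglog \<epsilon>)"
            using rj r\<epsilon> u c by (intro mult_right_mono) auto
          then show ?thesis by (simp add: k2)
        qed
        finally show ?thesis .
      qed
      have "\<bar>k - 1\<bar> \<le> \<bar>k\<^sup>2 - 1\<bar>" by (rule abs_minus_one_le_abs_square_minus_one[OF k0])
      then have k: "\<bar>k - 1\<bar> \<le> q" using k_le k_ge by linarith
      have ut: "u * t \<in> {0..1}" using u c t by (auto intro: mult_le_one)
      have scale: "strassen_path B \<epsilon> \<omega> t = k *\<^sub>R X (u * t)"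
      proof -
        have time: "c ^ j * (u * t) = \<epsilon> * t" using c(1) by (simp add: u_def)
        have factor: "k / (sqrt (loglog (c ^ j)) * sqrt (c ^ j)) = 1 / (sqrt (loglog \<epsilon>) * sqrt \<epsilon>)"
          using rj r\<epsilon> \<epsilon>0 c(1) by (simp add: k_def real_sqrt_mult field_simps)
        have "k *\<^sub>R X (u * t) = (k / (sqrt (loglog (c ^ j)) * sqrt (c ^ j))) *\<^sub>R B (c ^ j * (u * t)) \<omega>"
          by (simp add: X_def strassen_path_def rescaled_def)
        also have "\<dots> = strassen_path B \<epsilon> \<omega> t"
          unfolding factor time by (simp add: strassen_path_def rescaled_def)
        finally show ?thesis by simp
      qed
      have "strassen_path B \<epsilon> \<omega> t - X t = (k - 1) *\<^sub>R X (u * t) + (X (u * t) - X t)"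
        by (simp add: scale algebra_simps)
      then have "norm (strassen_path B \<epsilon> \<omega> t - X t) \<le> norm ((k - 1) *\<^sub>R X (u * t)) + norm (X (u * t) - X t)"
        by (simp only: norm_triangle_ineq)
      also have "norm ((k - 1) *\<^sub>R X (u * t)) \<le> q * 56"
        using dyadic_modulus_bound[OF X X0 ut] k q unfolding X_def norm_scaleR by (intro mult_mono) auto
      also have "norm (X (u * t) - X t) \<le> 56 * (3 / 4) ^ m"
        unfolding X_def
      proof (rule dyadic_modulusD[OF X ut t])
        have "\<bar>u * t - t\<bar> = (1 - u) * t"
        proof -
          have "t - u * t = (1 - u) * t" by (simp add: algebra_simps)
          moreover have "0 \<le> (1 - u) * t" using u t by simp
          ultimately show ?thesis by linarith
        qed
        also have "\<dots> \<le> 1 - u" using t u by (intro mult_left_le) auto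
        finally show "\<bar>u * t - t\<bar> \<le> 1 / 2 ^ m" using u c(3) by linarith
      qed
      finally show "norm (strassen_path B \<epsilon> \<omega> t - strassen_path B (c ^ j) \<omega> t) \<le> \<gamma>"
        using m by (simp add: q_def X_def)
    qed
  qed
qed

lemma not_exceptional_imp_regular:
  fixes B :: "real \<Rightarrow> 'w \<Rightarrow> real^'k"
  assumes \<omega>: "\<omega> \<in> space M" "\<omega> \<notin> exceptional_event M B \<eta> n \<epsilon>" and \<epsilon>: "0 < \<epsilon>"
    and B: "continuous_on {0..} (\<lambda>t. B t \<omega>)" "B 0 \<omega> = 0"
  shows "continuous_on {0..1} (strassen_path B \<epsilon> \<omega>)" "strassen_path B \<epsilon> \<omega> 0 = 0"
    "dyadic_modulus (strassen_path B \<epsilon> \<omega>)" "step_energy n (strassen_path B \<epsilon> \<omega>) \<le> 1 + \<eta>"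
proof -
  have "continuous_on {0..1} (\<lambda>t. B (\<epsilon> * t) \<omega>)"
    using \<epsilon> by (intro continuous_on_compose2[OF B(1)] continuous_intros) auto
  then show cont: "continuous_on {0..1} (strassen_path B \<epsilon> \<omega>)"
    unfolding strassen_path_def rescaled_def by (intro continuous_intros)
  show "strassen_path B \<epsilon> \<omega> 0 = 0" by (simp add: strassen_path_def rescaled_def B(2))
  show "step_energy n (strassen_path B \<epsilon> \<omega>) \<le> 1 + \<eta>"
    using \<omega> unfolding exceptional_event_def by auto
  have "norm (strassen_path B \<epsilon> \<omega> ((real i + 1) / 2 ^ m) - strassen_path B \<epsilon> \<omega> (real i / 2 ^ m)) \<le> 8 * (3 / 4) ^ m"
    if "i < 2 ^ m" for m i
  proof -
    have "norm (increment (2 ^ m) (strassen_path B \<epsilon> \<omega>) i) \<le> 8 * (3 / 4) ^ m"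
      using \<omega> that unfolding exceptional_event_def by (auto simp: not_less)
    then show ?thesis by (simp add: increment_def)
  qed
  then have "norm (strassen_path B \<epsilon> \<omega> s - strassen_path B \<epsilon> \<omega> t) \<le> 7 * 8 * (3 / 4) ^ m"
    if "s \<in> {0..1}" "t \<in> {0..1}" "\<bar>s - t\<bar> \<le> 1 / 2 ^ m" for s t m
    by (intro dyadic_increments_imp_modulus[OF cont] that) auto
  then show "dyadic_modulus (strassen_path B \<epsilon> \<omega>)" unfolding dyadic_modulus_def by auto
qed


section \<open>Continuity in the parameter\<close>

text \<open>
  If \<open>1\<close> were an admissible parameter, the logarithm of \<open>ln 1 = 0\<close> would have to be positive; its
  default value is \<open>0\<close>.
\<close>

lemma loglog_pos_imp_less_one:
  assumes "\<forall>\<epsilon>\<in>{0<..eps_star}. loglog \<epsilon> > 0"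
  shows "eps_star < 1"
proof (rule ccontr)
  assume "\<not> eps_star < 1"
  then have "loglog 1 > 0" using assms by auto
  then show False by (simp add: loglog_def)
qed

lemma strassen_path_uniform_limit:
  fixes B :: "real \<Rightarrow> 'w \<Rightarrow> real^'k"
  assumes B: "continuous_on {0..} (\<lambda>t. B t \<omega>)" and \<delta>: "0 < \<delta>" "\<delta> < 1" "0 < loglog \<delta>"
    and e: "e \<longlonglongrightarrow> \<delta>" "\<And>n. e n \<in> {0..1}"
  shows "uniform_limit {0..1} (\<lambda>n t. strassen_path B (e n) \<omega> t) (strassen_path B \<delta> \<omega>) sequentially"
proof -
  define p where "p \<epsilon> = 1 / sqrt (loglog \<epsilon>) * (1 / sqrt \<epsilon>)" for \<epsilon>
  have path: "strassen_path B \<epsilon> \<omega> t = p \<epsilon> *\<^sub>R B (\<epsilon> * t) \<omega>" for \<epsilon> t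
    by (simp add: strassen_path_def rescaled_def p_def)
  have B01: "continuous_on {0..1} (\<lambda>t. B t \<omega>)" using B by (rule continuous_on_subset) auto
  have "isCont p \<delta>"
  proof -
    have "0 < ln (1 / \<delta>)" using \<delta> by simp
    then show ?thesis using \<delta> unfolding p_def loglog_def
      by (intro continuous_intros) (auto simp: loglog_def)
  qed
  then have p_lim: "(\<lambda>n. p (e n)) \<longlonglongrightarrow> p \<delta>" using e(1) by (rule isCont_tendsto_compose)
  have B_lim: "uniform_limit {0..1} (\<lambda>n t. B (e n * t) \<omega>) (\<lambda>t. B (\<delta> * t) \<omega>) sequentially"
  proof (rule uniform_limitI)
    fix a :: real assume a: "0 < a"
    have "uniformly_continuous_on {0..1} (\<lambda>t. B t \<omega>)" using B01 by (rule compact_uniformly_continuous) simp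
    then obtain d where d: "d > 0" "\<And>s s'. \<lbrakk>s \<in> {0..1}; s' \<in> {0..1}; dist s' s < d\<rbrakk> \<Longrightarrow> dist (B s' \<omega>) (B s \<omega>) < a"
      unfolding uniformly_continuous_on_def using a by metis
    show "\<forall>\<^sub>F n in sequentially. \<forall>t\<in>{0..1}. dist (B (e n * t) \<omega>) (B (\<delta> * t) \<omega>) < a"
      using tendstoD[OF e(1) d(1)]
    proof eventually_elim
      case (elim n)
      show ?case
      proof
        fix t :: real assume t: "t \<in> {0..1}"
        have "\<bar>e n * t - \<delta> * t\<bar> = \<bar>e n - \<delta>\<bar> * t" using t by (simp add: abs_mult flip: left_diff_distrib)
        also have "\<dots> \<le> \<bar>e n - \<delta>\<bar> * 1" using t by (intro mult_left_mono) auto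
        finally have "dist (e n * t) (\<delta> * t) < d" using elim by (simp add: dist_real_def)
        moreover have "e n * t \<in> {0..1}" "\<delta> * t \<in> {0..1}" using e(2)[of n] \<delta> t by (auto intro: mult_le_one)
        ultimately show "dist (B (e n * t) \<omega>) (B (\<delta> * t) \<omega>) < a" using d(2) by blast
      qed
    qed
  qed
  have "bounded ((\<lambda>t. B (\<delta> * t) \<omega>) ` {0..1})"
    using \<delta> by (intro compact_imp_bounded compact_continuous_image continuous_on_compose2[OF B01] continuous_intros)
      (auto intro: mult_le_one)
  then have "uniform_limit {0..1} (\<lambda>n t. p (e n) *\<^sub>R B (e n * t) \<omega>) (\<lambda>t. p \<delta> *\<^sub>R B (\<delta> * t) \<omega>) sequentially"
    by (intro bounded_bilinear.bounded_uniform_limit[OF bounded_bilinear_scaleR] B_lim)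
      (use p_lim in \<open>auto simp: uniform_limit_iff tendsto_iff image_constant_conv\<close>)
  moreover have "strassen_path B \<delta> \<omega> = (\<lambda>t. p \<delta> *\<^sub>R B (\<delta> * t) \<omega>)" by (intro ext path)
  ultimately show ?thesis by (simp add: path)
qed

lemma bounded_bilinear_matrix_vector_mult:
  "bounded_bilinear (\<lambda>(A :: real^'k^'d) v. A *v v)"
proof
  show "\<exists>K. \<forall>(A :: real^'k^'d) v. norm (A *v v) \<le> norm A * norm v * K"
    by (intro exI[of _ 1]) (simp add: norm_matrix_vector_mult_le)
qed (simp_all add: matrix_vector_mult_add_rdistrib matrix_vector_right_distrib matrix_vector_mult_scaleR scaleR_matrix_vector_assoc)

text \<open>
  A path that has not reached \<open>\<Delta>\<close> by time \<open>s\<close> traces a compact subset of \<open>U\<close> up to then.  On a compact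
  neighbourhood of this trace the coefficients converge uniformly, and the solutions \<open>yn\<close> cannot leave
  this neighbourhood before \<open>s\<close> by \<open>additive_solution_stays_close\<close>.
\<close>

lemma killed_solutions_converge:
  fixes W :: "nat \<Rightarrow> real \<Rightarrow> real^'d"
  assumes U: "open U" and t_star: "0 \<le> t_star" "t_star \<le> 1"
    and V: "open V" "U \<subseteq> V" and \<beta>: "locally_lipschitz_on V \<beta>"
    and y: "additive_solution V \<beta> w x y"
    and Vn: "\<And>n. open (Vn n)" "\<And>n. U \<subseteq> Vn n" and \<beta>n: "\<And>n. locally_lipschitz_on (Vn n) (\<beta>n n)"
    and yn: "\<And>n. additive_solution (Vn n) (\<beta>n n) (W n) x (yn n)"
    and drift: "\<And>K. compact K \<Longrightarrow> K \<subseteq> U \<Longrightarrow> uniform_limit K \<beta>n \<beta> sequentially"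
    and noise: "uniform_limit {0..1} W w sequentially"
  shows "path_converges t_star (\<lambda>n. killed_path t_star U (yn n)) (killed_path t_star U y)"
  unfolding path_converges_def
proof (intro ballI impI)
  fix s assume s: "s \<in> {0..t_star}" and less: "ereal s < exit_time t_star (killed_path t_star U y)"
  have y_space: "y \<in> path_space 1 V" "y 0 = Some x"
    using y unfolding additive_solution_def path_space_from_def by blast+
  have "killed_path t_star U y \<in> path_space t_star U"
    using killed_path_in_path_space[OF y_space(1) U V(2,1) t_star] .
  then have "killed_path t_star U y s \<noteq> None" using less_exit_time_iff[OF _ U s] less by blast
  then have y_U: "y ` {0..s} \<subseteq> Some ` U"
    using s by (auto simp: killed_path_def split: if_splits)
  have "y s \<in> Some ` U" using y_U s by force
  then have s1: "0 \<le> s" "s \<le> 1" "s \<in> {0..1}" "y s \<noteq> None" using s t_star by auto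
  note form = additive_solution_integral_form[OF y V(1) locally_lipschitz_on_imp_continuous_on[OF \<beta> V(1)] s1(3,4)]
  define G where "G t = the (y t)" for t
  have "compact (G ` {0..s})" unfolding G_def by (intro compact_continuous_image form(1) compact_Icc)
  moreover have "G ` {0..s} \<subseteq> U" using y_U by (fastforce simp: G_def)
  ultimately obtain \<rho> K where \<rho>: "0 < \<rho>" and K: "compact K" "K \<subseteq> U" and tube: "\<And>z. z \<in> G ` {0..s} \<Longrightarrow> cball z \<rho> \<subseteq> K"
    using compact_neighbourhood[OF _ _ U] by metis
  have tube': "cball (G t) (\<rho> / 2) \<subseteq> interior K" if "t \<in> {0..s}" for t
  proof -
    have "ball (G t) \<rho> \<subseteq> interior K"
      using tube[of "G t"] that ball_subset_cball by (intro interior_maximal) auto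
    then show ?thesis using \<rho> by (auto simp: subset_iff)
  qed
  have x_in: "x \<in> interior K"
  proof -
    have "G 0 = x" by (simp add: G_def y_space(2))
    then show ?thesis using tube'[of 0] \<rho> s1 by auto
  qed
  obtain C where C: "C-lipschitz_on K \<beta>" using \<beta> K V(2) unfolding locally_lipschitz_on_def by blast
  have close: "\<forall>\<^sub>F n in sequentially. \<forall>t\<in>{0..s}. yn n t \<in> Some ` interior K \<and> norm (the (yn n t) - G t) < e"
    if e: "0 < e" for e
  proof -
    define e' where "e' = min e (\<rho> / 2)"
    define a where "a = e' / (4 * exp C)"
    have e': "0 < e'" "e' \<le> e" "e' \<le> \<rho> / 2" using e \<rho> by (auto simp: e'_def)
    have a: "0 < a" "(a + a) * exp C = e' / 2" using e' by (auto simp: a_def)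
    show ?thesis
      using uniform_limitD[OF drift[OF K] a(1)] uniform_limitD[OF noise a(1)]
    proof eventually_elim
      case (elim n)
      show ?case
      proof
        fix t assume t: "t \<in> {0..s}"
        have "yn n t \<in> Some ` interior K \<and> norm (the (yn n t) - G t) \<le> (a + a) * exp C"
        proof (rule additive_solution_stays_close[OF yn Vn(1) locally_lipschitz_on_imp_continuous_on[OF \<beta>n Vn(1)] K(1) _ C])
          show "K \<subseteq> Vn n" using K(2) Vn(2) by blast
          show "norm (\<beta>n n z - \<beta> z) \<le> a" if "z \<in> K" for z using elim(1) that by (auto simp: dist_norm intro: order_less_imp_le)
          show "norm (W n u - w u) \<le> a" if "u \<in> {0..s}" for u using elim(2) that s1 by (auto simp: dist_norm intro: order_less_imp_le)
          show "continuous_on {0..s} G" unfolding G_def by (rule form(1))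
          show "G u = x + integral {0..u} (\<lambda>s. \<beta> (G s)) + w u" if "u \<in> {0..s}" for u
            unfolding G_def using form(3)[OF that] .
          show "cball (G u) (\<rho> / 2) \<subseteq> interior K" if "u \<in> {0..s}" for u using tube'[OF that] .
        qed (use s1 x_in a e' t \<rho> in auto)
        then show "yn n t \<in> Some ` interior K \<and> norm (the (yn n t) - G t) < e" using a(2) e' by auto
      qed
    qed
  qed
  have killed: "killed_path t_star U (yn n) u = yn n u"
    if "\<forall>t\<in>{0..s}. yn n t \<in> Some ` interior K \<and> P t" "u \<in> {0..s}" for n u P
  proof (rule killed_path_eq_Some[of _ s])
    show "yn n ` {0..s} \<subseteq> Some ` U" using that(1) K(2) interior_subset by fastforce
  qed (use s that in auto)
  have killed_y: "killed_path t_star U y u = y u" if "u \<in> {0..s}" for u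
    by (rule killed_path_eq_Some[OF y_U]) (use s that in auto)
  show "(\<forall>\<^sub>F n in sequentially. \<forall>u\<in>{0..s}. killed_path t_star U (yn n) u \<noteq> None) \<and>
       uniform_limit {0..s} (\<lambda>n u. the (killed_path t_star U (yn n) u)) (\<lambda>u. the (killed_path t_star U y u)) sequentially"
  proof
    show "\<forall>\<^sub>F n in sequentially. \<forall>u\<in>{0..s}. killed_path t_star U (yn n) u \<noteq> None"
      using close[OF zero_less_one]
    proof eventually_elim
      case (elim n)
      then show ?case using killed[OF elim] by fastforce
    qed
    show "uniform_limit {0..s} (\<lambda>n u. the (killed_path t_star U (yn n) u)) (\<lambda>u. the (killed_path t_star U y u)) sequentially"
    proof (rule uniform_limitI)
      fix e :: real assume "0 < e"
      from close[OF this] show "\<forall>\<^sub>F n in sequentially. \<forall>u\<in>{0..s}. dist (the (killed_path t_star U (yn n) u)) (the (killed_path t_star U y u)) < e"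
      proof eventually_elim
        case (elim n)
        then show ?case using killed[OF elim] killed_y by (auto simp: dist_norm G_def)
      qed
    qed
  qed
qed

text \<open>
  Closed sets of paths are defined by sequences, and in the parameter space sequences detect closed
  sets as well.
\<close>

lemma continuous_map_path_topologyI:
  fixes S :: "'e::first_countable_topology set"
  assumes Y: "\<And>e. e \<in> S \<Longrightarrow> Y e \<in> path_space_from t V x"
    and conv: "\<And>e \<delta>. \<lbrakk>\<And>n::nat. e n \<in> S; \<delta> \<in> S; e \<longlonglongrightarrow> \<delta>\<rbrakk> \<Longrightarrow> path_converges t (\<lambda>n. Y (e n)) (Y \<delta>)"
  shows "continuous_map (top_of_set S) (subtopology (path_topology t V) (path_space_from t V x)) Y"
proof -
  have Y': "Y e \<in> path_space t V" if "e \<in> S" for e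
    using Y[OF that] unfolding path_space_from_def by blast
  have "continuous_map (top_of_set S) (path_topology t V) Y"
    unfolding continuous_map_closedin
  proof (intro conjI allI impI)
    show "Y \<in> topspace (top_of_set S) \<rightarrow> topspace (path_topology t V)"
      using Y' by (auto simp: topspace_path_topology)
    fix C assume "closedin (path_topology t V) C"
    then have C: "path_closed t V C" by (simp add: closedin_path_topology)
    show "closedin (top_of_set S) {e \<in> topspace (top_of_set S). Y e \<in> C}"
      unfolding closedin_limpt
    proof (intro conjI allI impI)
      fix \<delta> assume "\<delta> islimpt {e \<in> topspace (top_of_set S). Y e \<in> C} \<and> \<delta> \<in> S"
      then have lim: "\<delta> islimpt {e \<in> topspace (top_of_set S). Y e \<in> C}" and \<delta>: "\<delta> \<in> S" by auto
      obtain e where e: "\<forall>n::nat. e n \<in> {e \<in> topspace (top_of_set S). Y e \<in> C} - {\<delta>}" "e \<longlonglongrightarrow> \<delta>"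
        using lim[unfolded islimpt_sequential] by blast
      then have eS: "e n \<in> S" and eC: "Y (e n) \<in> C" for n by auto
      have limit: "(\<forall>n. gs n \<in> C) \<and> g \<in> path_space t V \<and> path_converges t gs g \<longrightarrow> g \<in> C" for gs g
        using C unfolding path_closed_def by blast
      have "Y \<delta> \<in> C"
        using limit[of "\<lambda>n. Y (e n)" "Y \<delta>"] eC Y'[OF \<delta>] conv[OF eS \<delta> e(2)] by simp
      then show "\<delta> \<in> {e \<in> topspace (top_of_set S). Y e \<in> C}" using \<delta> by simp
    qed auto
  qed
  then show ?thesis using Y by (auto simp: continuous_map_in_subtopology)
qed

section \<open>The family of solutions\<close>

text \<open>
  The index is read off from the measurable sets \<open>A j\<close>.  The property \<open>P\<close>, which may be a
  statement about all parameters at once, enters through a null set, on which the index is \<open>\<infinity>\<close>.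
\<close>

lemma eventual_index_measurable:
  fixes A :: "nat \<Rightarrow> 'w set"
  assumes A: "\<And>j. A j \<in> sets M" and fin: "AE \<omega> in M. eventually (\<lambda>j. \<omega> \<notin> A j) sequentially"
    and P: "AE \<omega> in M. P \<omega>"
  shows "\<exists>J \<in> measurable M (count_space (UNIV :: enat set)). (AE \<omega> in M. J \<omega> < \<infinity>) \<and>
    (\<forall>\<omega>\<in>space M. \<forall>j. J \<omega> \<le> enat j \<longrightarrow> j0 \<le> j \<and> \<omega> \<notin> A j \<and> P \<omega>)"
proof -
  note A[measurable]
  have "AE \<omega> in M. eventually (\<lambda>j. \<omega> \<notin> A j) sequentially \<and> P \<omega>" using fin P by eventually_elim simp
  then obtain Z where Z: "{\<omega> \<in> space M. \<not> (eventually (\<lambda>j. \<omega> \<notin> A j) sequentially \<and> P \<omega>)} \<subseteq> Z"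
    "emeasure M Z = 0" "Z \<in> sets M"
    by (rule AE_E)
  note Z(3)[measurable]
  define K where "K \<omega> = (LEAST m. \<forall>j\<in>{m..}. \<omega> \<notin> A j)" for \<omega>
  have [measurable]: "K \<in> measurable M (count_space UNIV)"
    unfolding K_def by measurable
  define J where "J \<omega> = (if \<omega> \<in> Z then \<infinity> else enat (max j0 (K \<omega>)))" for \<omega>
  show ?thesis
  proof (intro bexI[of _ J] conjI ballI allI impI)
    show "J \<in> measurable M (count_space UNIV)"
      unfolding J_def by measurable
    have "AE \<omega> in M. \<omega> \<notin> Z" using Z by (intro AE_not_in) (auto simp: null_sets_def)
    then show "AE \<omega> in M. J \<omega> < \<infinity>" by eventually_elim (simp add: J_def)
    fix \<omega> j assume \<omega>: "\<omega> \<in> space M" and le: "J \<omega> \<le> enat j"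
    then have nZ: "\<omega> \<notin> Z" by (auto simp: J_def split: if_splits)
    then have ev: "eventually (\<lambda>j. \<omega> \<notin> A j) sequentially" "P \<omega>" using Z(1) \<omega> by auto
    from ev(1) have "\<exists>m. \<forall>j\<in>{m..}. \<omega> \<notin> A j" by (auto simp: eventually_sequentially)
    then have "\<forall>j\<in>{K \<omega>..}. \<omega> \<notin> A j" unfolding K_def by (rule LeastI_ex)
    moreover have "max j0 (K \<omega>) \<le> j" using le nZ by (simp add: J_def)
    ultimately show "j0 \<le> j" "\<omega> \<notin> A j" "P \<omega>" using ev(2) by auto
  qed
qed

theorem corollary2p10:
  fixes M :: "'w measure"
    and B :: "real \<Rightarrow> 'w \<Rightarrow> real^'k"
    and eps_star t_star :: real
    and x :: "real^'d"
    and U_star L :: "(real^'d) set"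
    and U :: "real \<Rightarrow> (real^'d) set"
    and b :: "real^'d \<Rightarrow> real^'d"
    and \<sigma> :: "real^'d \<Rightarrow> real^'k^'d"
    and b\<^sub>\<epsilon> :: "real \<Rightarrow> real^'d \<Rightarrow> real^'d"
    and \<sigma>\<^sub>\<epsilon> :: "real \<Rightarrow> real^'k^'d"
    and y :: "real \<Rightarrow> 'w \<Rightarrow> real \<Rightarrow> (real^'d) option"
  assumes brownian: "standard_brownian_motion M B"
    and loglog_pos: "\<forall>\<epsilon>\<in>{0<..eps_star}. loglog \<epsilon> > 0"
    and coefficients: "coefficient_assumption eps_star U_star b \<sigma> U b\<^sub>\<epsilon> (\<lambda>\<epsilon> _. \<sigma>\<^sub>\<epsilon> \<epsilon>)"
    and continuity: "\<forall>\<delta>\<in>{0<..eps_star}. \<forall>K. compact K \<and> K \<subseteq> U_star \<longrightarrow>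
          uniform_limit K (\<lambda>\<epsilon> _. \<sigma>\<^sub>\<epsilon> \<epsilon>) (\<lambda>_. \<sigma>\<^sub>\<epsilon> \<delta>) (at \<delta> within {0<..eps_star}) \<and>
          uniform_limit K b\<^sub>\<epsilon> (b\<^sub>\<epsilon> \<delta>) (at \<delta> within {0<..eps_star})"
    and solution: "AE \<omega> in M. \<forall>\<epsilon>\<in>{0<..eps_star}.
          additive_solution (U \<epsilon>) (b\<^sub>\<epsilon> \<epsilon>)
            (\<lambda>t. (1 / sqrt (loglog \<epsilon>)) *\<^sub>R (\<sigma>\<^sub>\<epsilon> \<epsilon> *v rescaled B \<epsilon> t \<omega>)) x (y \<epsilon> \<omega>)"
    and L: "compact L" "L \<subseteq> U_star" "x \<in> interior L"
    and horizon: "t_star \<in> {0<..1}"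
      "\<forall>g\<in>limit_set U_star b \<sigma> x. g ` {0..t_star} \<subseteq> Some ` interior L"
  shows "family_assumption M eps_star U_star x L t_star (\<lambda>\<epsilon> \<omega>. killed_path t_star U_star (y \<epsilon> \<omega>))"
proof -
  have eps_star: "0 < eps_star" "eps_star < 1"
    using coefficients loglog_pos_imp_less_one[OF loglog_pos] unfolding coefficient_assumption_def by blast+
  have t_star: "0 \<le> t_star" "t_star \<le> 1" using horizon(1) by auto
  have U_star: "open U_star" and b_lip: "locally_lipschitz_on U_star b"
    using coefficients unfolding coefficient_assumption_def by blast+
  have U_eps: "open (U \<epsilon>)" "U_star \<subseteq> U \<epsilon>" "locally_lipschitz_on (U \<epsilon>) (b\<^sub>\<epsilon> \<epsilon>)" if "0 < \<epsilon>" "\<epsilon> \<le> eps_star" for \<epsilon>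
    using coefficients that unfolding coefficient_assumption_def by auto
  have b_eps_cont: "continuous_on (U \<epsilon>) (b\<^sub>\<epsilon> \<epsilon>)" if "0 < \<epsilon>" "\<epsilon> \<le> eps_star" for \<epsilon>
    by (rule locally_lipschitz_on_imp_continuous_on[OF U_eps(3,1)[OF that]])
  have b_lim: "uniform_limit L b\<^sub>\<epsilon> b (at_right 0)"
    using coefficients L unfolding coefficient_assumption_def by blast
  have x: "x \<in> U_star" using L interior_subset by blast
  define \<sigma>0 where "\<sigma>0 = \<sigma> x"
  have \<sigma>_lim: "(\<sigma>\<^sub>\<epsilon> \<longlongrightarrow> \<sigma>0) (at_right 0)"
    unfolding \<sigma>0_def
  proof (rule constant_diffusion_limit[OF _ x])
    show "uniform_limit K (\<lambda>\<epsilon> _. \<sigma>\<^sub>\<epsilon> \<epsilon>) \<sigma> (at_right 0)" if "compact K \<and> K \<subseteq> U_star" for K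
      using coefficients that unfolding coefficient_assumption_def by blast
  qed
  define solves where "solves \<omega> \<longleftrightarrow> (\<forall>\<epsilon>\<in>{0<..eps_star}.
    additive_solution (U \<epsilon>) (b\<^sub>\<epsilon> \<epsilon>) (\<lambda>t. \<sigma>\<^sub>\<epsilon> \<epsilon> *v strassen_path B \<epsilon> \<omega> t) x (y \<epsilon> \<omega>)) \<and>
    continuous_on {0..} (\<lambda>t. B t \<omega>) \<and> B 0 \<omega> = 0" for \<omega>
  have "AE \<omega> in M. B 0 \<omega> = 0" "AE \<omega> in M. continuous_on {0..} (\<lambda>t. B t \<omega>)"
    using brownian unfolding standard_brownian_motion_def by blast+
  with solution have solves: "AE \<omega> in M. solves \<omega>"
    unfolding matrix_strassen_path solves_def by eventually_elim blast
  have solvesD: "additive_solution (U \<epsilon>) (b\<^sub>\<epsilon> \<epsilon>) (\<lambda>t. \<sigma>\<^sub>\<epsilon> \<epsilon> *v strassen_path B \<epsilon> \<omega> t) x (y \<epsilon> \<omega>)"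
    if "solves \<omega>" "0 < \<epsilon>" "\<epsilon> \<le> eps_star" for \<omega> \<epsilon>
    using that unfolding solves_def by auto
  have killed_space: "killed_path t_star U_star (y \<epsilon> \<omega>) \<in> path_space_from t_star U_star x"
    if "solves \<omega>" "0 < \<epsilon>" "\<epsilon> \<le> eps_star" for \<omega> \<epsilon>
  proof -
    have "y \<epsilon> \<omega> \<in> path_space 1 (U \<epsilon>)" "y \<epsilon> \<omega> 0 = Some x"
      using solvesD[OF that] unfolding additive_solution_def path_space_from_def by blast+
    then show ?thesis
      using killed_path_in_path_space[OF _ U_star U_eps(2,1)[OF that(2,3)] t_star] x t_star
      by (auto simp: path_space_from_def killed_path_def)
  qed
  obtain N :: nat where confined: "\<And>X W \<epsilon> y t.
    \<lbrakk>continuous_on {0..1} X; X 0 = 0; dyadic_modulus X; step_energy (2 ^ N) X \<le> 1 + 1 / (real N + 1);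
     \<And>t. t \<in> {0..1} \<Longrightarrow> norm (W t - X t) \<le> 1 / (real N + 1);
     0 < \<epsilon>; \<epsilon> \<le> 1 / (real N + 1); \<epsilon> \<le> eps_star;
     additive_solution (U \<epsilon>) (b\<^sub>\<epsilon> \<epsilon>) (\<lambda>t. \<sigma>\<^sub>\<epsilon> \<epsilon> *v W t) x y; t \<in> {0..t_star}\<rbrakk>
    \<Longrightarrow> y t \<in> Some ` interior L"
    using exists_uniform_confinement[OF coefficients L horizon] by metis
  obtain C where C: "C-lipschitz_on L b" using b_lip L unfolding locally_lipschitz_on_def by blast
  let ?R = "\<lambda>\<delta> c \<omega> j. c ^ j \<le> eps_star \<and>
            (\<forall>\<epsilon>\<in>{c ^ (j + 1)..c ^ j}.
               (\<forall>t\<in>{0..t_star}. killed_path t_star U_star (y \<epsilon> \<omega>) t \<in> Some ` L) \<and>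
               path_dist t_star t_star (killed_path t_star U_star (y (c ^ j) \<omega>)) (killed_path t_star U_star (y \<epsilon> \<omega>)) < ereal \<delta>)"
  have oscillation: "\<exists>c\<^sub>0\<in>{0<..<1}. \<forall>c\<in>{c\<^sub>0<..<1}.
       \<exists>J \<in> measurable M (count_space (UNIV::enat set)).
         (AE \<omega> in M. J \<omega> < \<infinity>) \<and>
         (\<forall>\<omega>\<in>space M. \<forall>j. enat j \<ge> J \<omega> \<longrightarrow> ?R \<delta> c \<omega> j)"
    if \<delta>: "0 < \<delta>" for \<delta>
  proof -
    \<comment> \<open>\<open>\<kappa>\<close> bounds the two drift errors and the noise error in the comparison estimate.  The noise error
      consists of \<open>\<sigma>\<^sub>\<epsilon>\<close> and \<open>\<sigma>\<close> at \<open>c\<^sup>j\<close> against their limit, on paths bounded by \<open>57\<close>, and of \<open>\<sigma>0\<close> applied to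
      a difference of paths; \<open>s\<close> and \<open>\<gamma>\<close> distribute \<open>\<kappa>\<close> among them.\<close>
    define \<kappa> where "\<kappa> = \<delta> / (6 * exp C)"
    have \<kappa>: "0 < \<kappa>" "(\<kappa> + \<kappa> + \<kappa>) * exp C = \<delta> / 2" using \<delta> by (auto simp: \<kappa>_def)
    define s where "s = \<kappa> / (4 * 57)"
    have s: "0 < s" using \<kappa> by (simp add: s_def)
    have pos: "0 < norm \<sigma>0 + 1" by (rule add_nonneg_pos) auto
    define \<gamma> where "\<gamma> = min (1 / (real N + 1)) (\<kappa> / (2 * (norm \<sigma>0 + 1)))"
    have \<gamma>: "0 < \<gamma>" "\<gamma> \<le> 1 / (real N + 1)" unfolding \<gamma>_def using \<kappa>(1) pos by auto
    have \<gamma>_le1: "\<gamma> \<le> 1"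
    proof -
      have "1 / (real N + 1) \<le> 1" by simp
      with \<gamma>(2) show ?thesis by linarith
    qed
    have \<gamma>': "norm \<sigma>0 * \<gamma> \<le> \<kappa> / 2"
    proof -
      have "norm \<sigma>0 * \<gamma> \<le> (norm \<sigma>0 + 1) * (\<kappa> / (2 * (norm \<sigma>0 + 1)))"
        using \<gamma>(1) by (intro mult_mono) (auto simp: \<gamma>_def)
      also have "\<dots> = \<kappa> / 2" using pos by (simp add: field_simps)
      finally show ?thesis .
    qed
    have "\<forall>\<^sub>F \<epsilon> in at_right 0. (\<forall>z\<in>L. dist (b\<^sub>\<epsilon> \<epsilon> z) (b z) < \<kappa>) \<and> dist (\<sigma>\<^sub>\<epsilon> \<epsilon>) \<sigma>0 < s"
      using uniform_limitD[OF b_lim \<kappa>(1)] tendstoD[OF \<sigma>_lim s] by (rule eventually_conj)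
    then obtain \<epsilon>1 where \<epsilon>1: "0 < \<epsilon>1" "\<And>\<epsilon>. \<lbrakk>0 < \<epsilon>; \<epsilon> < \<epsilon>1\<rbrakk> \<Longrightarrow> (\<forall>z\<in>L. dist (b\<^sub>\<epsilon> \<epsilon> z) (b z) < \<kappa>) \<and> dist (\<sigma>\<^sub>\<epsilon> \<epsilon>) \<sigma>0 < s"
      unfolding eventually_at_right_field by blast
    obtain c\<^sub>0 where c\<^sub>0: "c\<^sub>0 \<in> {0<..<1}" and between: "\<And>c. c \<in> {c\<^sub>0<..<1} \<Longrightarrow> \<exists>j0. \<forall>j\<ge>j0. \<forall>\<epsilon>\<in>{c ^ (j + 1)..c ^ j}.
      \<forall>B :: real \<Rightarrow> 'w \<Rightarrow> real^'k. \<forall>\<omega>. strassen_path B (c ^ j) \<omega> 0 = 0 \<and> dyadic_modulus (strassen_path B (c ^ j) \<omega>) \<longrightarrow>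
      (\<forall>t\<in>{0..1}. norm (strassen_path B \<epsilon> \<omega> t - strassen_path B (c ^ j) \<omega> t) \<le> \<gamma>)"
      using strassen_path_between_powers[OF \<gamma>(1), where 'w='w and 'k='k] by blast
    show ?thesis
    proof (intro bexI[OF _ c\<^sub>0] ballI)
      fix c assume c_in: "c \<in> {c\<^sub>0<..<1}"
      then have c: "0 < c" "c < 1" using c\<^sub>0 by auto
      obtain j1 where j1: "\<And>j \<epsilon> \<omega> t. \<lbrakk>j1 \<le> j; \<epsilon> \<in> {c ^ (j + 1)..c ^ j}; strassen_path B (c ^ j) \<omega> 0 = 0;
        dyadic_modulus (strassen_path B (c ^ j) \<omega>); t \<in> {0..1}\<rbrakk> \<Longrightarrow>
        norm (strassen_path B \<epsilon> \<omega> t - strassen_path B (c ^ j) \<omega> t) \<le> \<gamma>"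
        using between[OF c_in] by blast
      have "\<forall>\<^sub>F j in sequentially. c ^ j < min \<epsilon>1 (min eps_star (1 / (real N + 1)))"
        using LIMSEQ_power_zero[of c] c \<epsilon>1(1) eps_star by (intro order_tendstoD(2)) auto
      then obtain j2 where j2: "\<And>j. j2 \<le> j \<Longrightarrow> c ^ j < \<epsilon>1 \<and> c ^ j < eps_star \<and> c ^ j < 1 / (real N + 1)"
        unfolding eventually_sequentially by auto
      define bad where "bad j = exceptional_event M B (1 / (real N + 1)) (2 ^ N) (c ^ j)" for j
      have bad: "bad j \<in> sets M" for j
        unfolding bad_def using c by (intro exceptional_event_measurable[OF brownian]) simp
      have finitely: "AE \<omega> in M. eventually (\<lambda>j. \<omega> \<notin> bad j) sequentially"
        unfolding bad_def by (rule exceptional_events_finitely_often[OF brownian _ _ _ c]) auto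
      obtain J where J: "J \<in> measurable M (count_space (UNIV :: enat set))" "AE \<omega> in M. J \<omega> < \<infinity>"
        "\<forall>\<omega>\<in>space M. \<forall>j. J \<omega> \<le> enat j \<longrightarrow> max j1 j2 \<le> j \<and> \<omega> \<notin> bad j \<and> solves \<omega>"
        using eventual_index_measurable[where ?j0.0 = "max j1 j2", OF bad finitely solves] by blast
      have main: "?R \<delta> c \<omega> j"
        if \<omega>: "\<omega> \<in> space M" and j: "J \<omega> \<le> enat j" for \<omega> j
      proof -
        have jj: "j1 \<le> j" "j2 \<le> j" "\<omega> \<notin> bad j" and sol: "solves \<omega>" using J(3) \<omega> j by auto
        have cj: "0 < c ^ j" "c ^ j < \<epsilon>1" "c ^ j < eps_star" "c ^ j < 1 / (real N + 1)" "0 < c ^ (j + 1)" "c ^ (j + 1) \<le> c ^ j"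
          using c j2[OF jj(2)] by (auto intro: mult_left_le_one_le)
        define X where "X = strassen_path B (c ^ j) \<omega>"
        have Bw: "continuous_on {0..} (\<lambda>t. B t \<omega>)" "B 0 \<omega> = 0" using sol unfolding solves_def by blast+
        note X = not_exceptional_imp_regular[OF \<omega> jj(3)[unfolded bad_def] cj(1) Bw, folded X_def]
        have near: "norm (strassen_path B \<epsilon> \<omega> t - X t) \<le> \<gamma>" if "\<epsilon> \<in> {c ^ (j + 1)..c ^ j}" "t \<in> {0..1}" for \<epsilon> t
          unfolding X_def by (rule j1[OF jj(1) that(1) X(2,3)[unfolded X_def] that(2)])
        have small: "0 < \<epsilon>" "\<epsilon> < \<epsilon>1" "\<epsilon> \<le> eps_star" "\<epsilon> \<le> 1 / (real N + 1)" if "\<epsilon> \<in> {c ^ (j + 1)..c ^ j}" for \<epsilon>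
          using that cj by auto
        have inside: "y \<epsilon> \<omega> t \<in> Some ` interior L" if \<epsilon>: "\<epsilon> \<in> {c ^ (j + 1)..c ^ j}" and t: "t \<in> {0..t_star}" for \<epsilon> t
        proof (rule confined[OF X _ small(1,4,3)[OF \<epsilon>] solvesD[OF sol small(1,3)[OF \<epsilon>]] t])
          show "norm (strassen_path B \<epsilon> \<omega> u - X u) \<le> 1 / (real N + 1)" if "u \<in> {0..1}" for u
            using near[OF \<epsilon> that] \<gamma>(2) by linarith
        qed
        have killed: "killed_path t_star U_star (y \<epsilon> \<omega>) t = y \<epsilon> \<omega> t" if \<epsilon>: "\<epsilon> \<in> {c ^ (j + 1)..c ^ j}" and t: "t \<in> {0..t_star}" for \<epsilon> t
        proof (rule killed_path_eq_Some[OF _ t_star(1) order_refl t])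
          show "y \<epsilon> \<omega> ` {0..t_star} \<subseteq> Some ` U_star"
            using inside[OF \<epsilon>] L(2) interior_subset[of L] by blast
        qed
        have exit: "ereal t_star < exit_time t_star (killed_path t_star U_star (y \<epsilon> \<omega>))" if \<epsilon>: "\<epsilon> \<in> {c ^ (j + 1)..c ^ j}" for \<epsilon>
        proof -
          have "killed_path t_star U_star (y \<epsilon> \<omega>) \<in> path_space t_star U_star"
            using killed_space[OF sol small(1,3)[OF \<epsilon>]] by (simp add: path_space_from_def)
          moreover have "killed_path t_star U_star (y \<epsilon> \<omega>) t_star \<noteq> None"
            using killed[OF \<epsilon>, of t_star] inside[OF \<epsilon>, of t_star] t_star by auto
          ultimately show ?thesis using less_exit_time_iff[OF _ U_star, of _ t_star t_star] t_star by auto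
        qed
        have cj_in: "c ^ j \<in> {c ^ (j + 1)..c ^ j}" using cj(6) by simp
        have dist: "path_dist t_star t_star (killed_path t_star U_star (y (c ^ j) \<omega>)) (killed_path t_star U_star (y \<epsilon> \<omega>)) < ereal \<delta>"
          if \<epsilon>: "\<epsilon> \<in> {c ^ (j + 1)..c ^ j}" for \<epsilon>
        proof -
          have close: "norm (the (y (c ^ j) \<omega> t) - the (y \<epsilon> \<omega> t)) \<le> \<delta> / 2" if t: "t \<in> {0..t_star}" for t
          proof -
            have def: "y e \<omega> t_star \<noteq> None" if "e \<in> {c ^ (j + 1)..c ^ j}" for e using inside[OF that, of t_star] t_star by auto
            have t1: "t_star \<in> {0..1}" using t_star by auto
            have form: "continuous_on {0..t_star} (\<lambda>t. the (y e \<omega> t))"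
              "\<And>u. u \<in> {0..t_star} \<Longrightarrow> the (y e \<omega> u) = x + integral {0..u} (\<lambda>s. b\<^sub>\<epsilon> e (the (y e \<omega> s))) + \<sigma>\<^sub>\<epsilon> e *v strassen_path B e \<omega> u"
              if e: "e \<in> {c ^ (j + 1)..c ^ j}" for e
              using additive_solution_integral_form[OF solvesD[OF sol small(1,3)[OF e]] U_eps(1)[OF small(1,3)[OF e]]
                b_eps_cont[OF small(1,3)[OF e]] t1 def[OF e]] by blast+
            have vals: "(\<lambda>t. the (y e \<omega> t)) ` {0..t_star} \<subseteq> L" if "e \<in> {c ^ (j + 1)..c ^ j}" for e
              using inside[OF that] interior_subset[of L] by fastforce
            have drift: "continuous_on L (b\<^sub>\<epsilon> e)" "\<And>z. z \<in> L \<Longrightarrow> norm (b\<^sub>\<epsilon> e z - b z) \<le> \<kappa>" if e: "e \<in> {c ^ (j + 1)..c ^ j}" for e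
            proof -
              show "continuous_on L (b\<^sub>\<epsilon> e)"
                using b_eps_cont[OF small(1,3)[OF e]] U_eps(2)[OF small(1,3)[OF e]] L(2)
                by (blast intro: continuous_on_subset)
              show "norm (b\<^sub>\<epsilon> e z - b z) \<le> \<kappa>" if "z \<in> L" for z
                using \<epsilon>1(2)[OF small(1,2)[OF e]] that by (auto simp: dist_norm intro: order_less_imp_le)
            qed
            have noise: "norm (\<sigma>\<^sub>\<epsilon> (c ^ j) *v X u - \<sigma>\<^sub>\<epsilon> \<epsilon> *v strassen_path B \<epsilon> \<omega> u) \<le> \<kappa>" if u: "u \<in> {0..t_star}" for u
            proof -
              have u1: "u \<in> {0..1}" using u t_star by auto
              let ?W = "strassen_path B \<epsilon> \<omega> u"
              have X56: "norm (X u) \<le> 56" by (rule dyadic_modulus_bound[OF X(3,2) u1])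
              have WX: "norm (?W - X u) \<le> \<gamma>" by (rule near[OF \<epsilon> u1])
              have W57: "norm ?W \<le> 57"
                using norm_triangle_ineq[of "?W - X u" "X u"] WX \<gamma>_le1 X56 by simp
              have sj: "norm (\<sigma>\<^sub>\<epsilon> (c ^ j) - \<sigma>0) \<le> s" "norm (\<sigma>\<^sub>\<epsilon> \<epsilon> - \<sigma>0) \<le> s"
                using \<epsilon>1(2)[OF small(1,2)[OF cj_in]] \<epsilon>1(2)[OF small(1,2)[OF \<epsilon>]]
                by (auto simp: dist_norm intro: order_less_imp_le)
              have "norm (\<sigma>\<^sub>\<epsilon> (c ^ j) *v X u - \<sigma>0 *v X u) \<le> s * 56 + 0"
                using norm_matrix_vector_diff_le[of "\<sigma>\<^sub>\<epsilon> (c ^ j)" "X u" \<sigma>0 "X u"] mult_mono[OF sj(1) X56] s by simp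
              moreover have "norm (\<sigma>\<^sub>\<epsilon> \<epsilon> *v ?W - \<sigma>0 *v X u) \<le> s * 57 + norm \<sigma>0 * \<gamma>"
              proof -
                have "norm (\<sigma>\<^sub>\<epsilon> \<epsilon> - \<sigma>0) * norm ?W \<le> s * 57" using sj(2) W57 s by (intro mult_mono) auto
                moreover have "norm \<sigma>0 * norm (?W - X u) \<le> norm \<sigma>0 * \<gamma>" by (intro mult_left_mono WX) simp
                ultimately show ?thesis using norm_matrix_vector_diff_le[of "\<sigma>\<^sub>\<epsilon> \<epsilon>" ?W \<sigma>0 "X u"] by linarith
              qed
              moreover have "norm (\<sigma>\<^sub>\<epsilon> (c ^ j) *v X u - \<sigma>\<^sub>\<epsilon> \<epsilon> *v ?W) \<le>
                  norm (\<sigma>\<^sub>\<epsilon> (c ^ j) *v X u - \<sigma>0 *v X u) + norm (\<sigma>\<^sub>\<epsilon> \<epsilon> *v ?W - \<sigma>0 *v X u)"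
                using norm_triangle_ineq4[of "\<sigma>\<^sub>\<epsilon> (c ^ j) *v X u - \<sigma>0 *v X u" "\<sigma>\<^sub>\<epsilon> \<epsilon> *v ?W - \<sigma>0 *v X u"] by simp
              ultimately show ?thesis using \<gamma>' s by (simp add: s_def)
            qed
            have "norm (the (y (c ^ j) \<omega> t) - the (y \<epsilon> \<omega> t)) \<le> (\<kappa> + \<kappa> + \<kappa>) * exp C"
              by (rule solution_comparison[where x = x, OF form(1)[OF cj_in] form(1)[OF \<epsilon>] vals[OF cj_in] vals[OF \<epsilon>] C drift(1)[OF cj_in] drift(1)[OF \<epsilon>]
                drift(2)[OF cj_in] drift(2)[OF \<epsilon>] noise[unfolded X_def]
                form(2)[OF cj_in] form(2)[OF \<epsilon>] t_star(2) t])
            then show ?thesis by (simp only: \<kappa>(2))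
          qed
          have "path_dist t_star t_star (killed_path t_star U_star (y (c ^ j) \<omega>)) (killed_path t_star U_star (y \<epsilon> \<omega>))
             = (SUP u\<in>{0..t_star}. ereal (norm (the (y (c ^ j) \<omega> u) - the (y \<epsilon> \<omega> u))))"
            unfolding path_dist_def using exit[OF \<epsilon>] exit[OF cj_in] killed[OF \<epsilon>] killed[OF cj_in]
            by (auto intro!: SUP_cong)
          also have "\<dots> \<le> ereal (\<delta> / 2)" using close by (intro SUP_least) simp
          also have "\<dots> < ereal \<delta>" using \<delta> by simp
          finally show ?thesis .
        qed
        show ?thesis
        proof (intro conjI ballI)
          show "c ^ j \<le> eps_star" using cj by simp
          show "killed_path t_star U_star (y \<epsilon> \<omega>) t \<in> Some ` L" if "\<epsilon> \<in> {c ^ (j + 1)..c ^ j}" "t \<in> {0..t_star}" for \<epsilon> t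
            unfolding killed[OF that] using inside[OF that] interior_subset[of L] by blast
        qed (rule dist)
      qed
      show "\<exists>J \<in> measurable M (count_space (UNIV::enat set)).
         (AE \<omega> in M. J \<omega> < \<infinity>) \<and>
         (\<forall>\<omega>\<in>space M. \<forall>j. enat j \<ge> J \<omega> \<longrightarrow> ?R \<delta> c \<omega> j)"
        by (intro bexI[OF _ J(1)] conjI J(2) ballI allI impI main)
    qed
  qed
  have "AE \<omega> in M. continuous_map (top_of_set {0<..<eps_star})
       (subtopology (path_topology t_star U_star) (path_space_from t_star U_star x)) (\<lambda>\<epsilon>. killed_path t_star U_star (y \<epsilon> \<omega>))"
    using solves
  proof eventually_elim
    case (elim \<omega>)
    show ?case
    proof (rule continuous_map_path_topologyI)
      show "killed_path t_star U_star (y \<epsilon> \<omega>) \<in> path_space_from t_star U_star x" if "\<epsilon> \<in> {0<..<eps_star}" for \<epsilon>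
        using killed_space[OF elim, of \<epsilon>] that by auto
      fix e \<delta> assume e: "\<And>n::nat. e n \<in> {0<..<eps_star}" and \<delta>: "\<delta> \<in> {0<..<eps_star}" and lim: "e \<longlonglongrightarrow> \<delta>"
      have e': "0 < e n" "e n \<le> eps_star" for n using e[of n] by auto
      have \<delta>': "0 < \<delta>" "\<delta> \<le> eps_star" "\<delta> \<in> {0<..eps_star}" using \<delta> by auto
      have uniform_seq: "uniform_limit K (\<lambda>n. F (e n)) (F \<delta>) sequentially"
        if F: "uniform_limit K F (F \<delta>) (at \<delta> within {0<..eps_star})" for K :: "(real^'d) set" and F :: "real \<Rightarrow> real^'d \<Rightarrow> 'z::metric_space"
      proof (rule uniform_limitI)
        fix a :: real assume a: "0 < a"
        then have "\<forall>\<^sub>F \<epsilon> in at \<delta> within {0<..eps_star}. \<forall>z\<in>K. dist (F \<epsilon> z) (F \<delta> z) < a" using F by (rule uniform_limitD[rotated])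
        then obtain d where d: "0 < d" "\<And>\<epsilon>. \<lbrakk>\<epsilon> \<in> {0<..eps_star}; \<epsilon> \<noteq> \<delta>; dist \<epsilon> \<delta> < d\<rbrakk> \<Longrightarrow> \<forall>z\<in>K. dist (F \<epsilon> z) (F \<delta> z) < a"
          unfolding eventually_at by blast
        show "\<forall>\<^sub>F n in sequentially. \<forall>z\<in>K. dist (F (e n) z) (F \<delta> z) < a"
          using tendstoD[OF lim d(1)]
        proof eventually_elim
          case (elim n)
          then show ?case using d(2)[of "e n"] e' a by (cases "e n = \<delta>") auto
        qed
      qed
      have drift: "uniform_limit K (\<lambda>n. b\<^sub>\<epsilon> (e n)) (b\<^sub>\<epsilon> \<delta>) sequentially" if "compact K" "K \<subseteq> U_star" for K
        using uniform_seq[of "b\<^sub>\<epsilon>" K] continuity \<delta>'(3) that by blast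
      have "uniform_limit {x} (\<lambda>\<epsilon> _. \<sigma>\<^sub>\<epsilon> \<epsilon>) (\<lambda>_. \<sigma>\<^sub>\<epsilon> \<delta>) (at \<delta> within {0<..eps_star})"
        using continuity[rule_format, OF \<delta>'(3), of "{x}"] x by simp
      then have "uniform_limit {x} (\<lambda>n _. \<sigma>\<^sub>\<epsilon> (e n)) (\<lambda>_. \<sigma>\<^sub>\<epsilon> \<delta>) sequentially"
        by (rule uniform_seq[of "\<lambda>\<epsilon> _. \<sigma>\<^sub>\<epsilon> \<epsilon>"])
      then have \<sigma>e: "(\<lambda>n. \<sigma>\<^sub>\<epsilon> (e n)) \<longlonglongrightarrow> \<sigma>\<^sub>\<epsilon> \<delta>" by (rule tendsto_uniform_limitI) simp
      have Bw: "continuous_on {0..} (\<lambda>t. B t \<omega>)" using elim unfolding solves_def by blast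
      have W: "uniform_limit {0..1} (\<lambda>n t. strassen_path B (e n) \<omega> t) (strassen_path B \<delta> \<omega>) sequentially"
        using Bw \<delta>' eps_star loglog_pos e' by (intro strassen_path_uniform_limit lim) (auto intro: order_trans[OF e'(2)] less_imp_le)
      have noise: "uniform_limit {0..1} (\<lambda>n t. \<sigma>\<^sub>\<epsilon> (e n) *v strassen_path B (e n) \<omega> t) (\<lambda>t. \<sigma>\<^sub>\<epsilon> \<delta> *v strassen_path B \<delta> \<omega> t) sequentially"
      proof -
        have "continuous_on {0..1} (strassen_path B \<delta> \<omega>)"
          using \<delta>'(1) unfolding strassen_path_def rescaled_def
          by (intro continuous_intros continuous_on_compose2[OF Bw]) auto
        then have "bounded (strassen_path B \<delta> \<omega> ` {0..1})"
          by (intro compact_imp_bounded compact_continuous_image compact_Icc)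
        then show ?thesis
          by (intro bounded_bilinear.bounded_uniform_limit[OF bounded_bilinear_matrix_vector_mult] W)
            (use \<sigma>e in \<open>auto simp: uniform_limit_iff tendsto_iff image_constant_conv\<close>)
      qed
      show "path_converges t_star (\<lambda>n. killed_path t_star U_star (y (e n) \<omega>)) (killed_path t_star U_star (y \<delta> \<omega>))"
        by (rule killed_solutions_converge[OF U_star t_star U_eps(1,2,3)[OF \<delta>'(1,2)] solvesD[OF elim \<delta>'(1,2)]
          U_eps(1,2,3)[OF e'] solvesD[OF elim e'] drift noise])
    qed
  qed
  with oscillation show ?thesis unfolding family_assumption_def by blast
qed

end
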